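(* Let $S$ be a finite set of ground equations over a finite set of constants, a finite set $F_U$ of uninterpreted function symbols, and a finite set $F_{AC}$ of AC symbols, put into purified flat form $S=S_C\cup S_U\cup\bigcup_{f\in F_{AC}}S_f$ over an extended set $C$ of constants. Let $\gg_C$ be a total ordering on $C$, $\gg_U=\gg_C\cup\{h\gg c\mid h\in F_U, c\in C\}$, and for each $f\in F_{AC}$ let $\gg_f$ be a total admissible ordering on $f$-monomials extending $\gg_C$ (with nonconstant monomials greater than constants). Then the algorithm {\bf GeneralCongruenceClosure} generates a reduced canonical rewrite system $R_S=R_C\cup R_U\cup\bigcup_{f\in F_{AC}}R_f$ on the extended signature, where each of $R_C,R_U,R_f$ is a reduced canonical rewrite system with respect to the given orderings, and $ACCC(R_S)$, with the rules of $R_S$ viewed as equations, equals $ACCC(S)$ when restricted to the original signature. Further, for this given set of orderings $\gg_U$ and $\{\gg_f\mid f\in F_{AC}\}$, $R_S$ is unique for $S$ in the extended signature.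
   Context: Purification and flattening: nested occurrences of each AC symbol are flattened to variadic form, and nonconstant arguments of uninterpreted symbols, as well as nonconstant arguments of AC terms with a different outermost symbol, are replaced by fresh constants (one per distinct subterm) with the corresponding defining equations, recursively; the result consists of $S_C$ (equations between constants), $S_U$ (flat equations $h(c_1,\dots,c_k)=d$, $h\in F_U$, $c_i,d\in C$) and, for each $f\in F_{AC}$, $S_f$ (equations between $f$-monomials). An $f$-monomial is $f(M)$, $M$ a nonempty finite multiset over $C$, a constant $c$ identified with $f(\{\!\{c\}\!\})$; $\cup$ is multiset sum, $-$ truncated difference, $\subseteq$ sub-multiset; a rule $f(A)\rightarrow f(B)$ rewrites $f(M)$ to $f((M-A)\cup B)$ when $A\subseteq M$. Admissible ordering: total well-founded ordering extending $\gg_C$ with $f(A)\gg_f f(B)$ when $B$ is a proper sub-multiset of $A$ and $f(A_1)\gg_f f(A_2)\Rightarrow f(A_1\cup B)\gg_f f(A_2\cup B)$. $ACCC(E)$: smallest congruence on ground terms containing $E$ and all ground instances of associativity and commutativity of each $f\in F_{AC}$. Canonical: terminating and confluent; reduced: no left or right side of a rule is reducible by the other rules. Subroutines: $CC(S_C\cup S_U,\gg_U\cup\gg_C)$ returns the reduced canonical rewrite system (constant rules $c\rightarrow d$ and flat rules $h(c_1,\dots,c_k)\rightarrow d$ with distinct left sides, all constants canonical) for the congruence closure of $S_C\cup S_U$. SingleACCompletion$(S_f,\gg_f)$ returns a reduced canonical rewrite system for $ACCC(S_f)$ by orienting equations, adding non-joinable critical pairs $(f((AB-A_1)\cup A_2),f((AB-B_1)\cup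 B_2))$, $AB=(A_1\cup B_1)-(A_1\cap B_1)$, and interreducing. ${\bf update_C}(R_C,N)$ merges the constant equivalence classes using $N$, each constant rewriting to the $\gg_C$-least element of its class. ${\bf update_U}(R_U,N)$ updates the constant rules by $N$, replaces constants in flat rules by their representatives, and merges flat rules with identical left sides (keeping the least right side and producing new constant equalities), iterating until no new constant equalities arise. ${\bf update}_{AC}(R_f,R_C,\gg_f)$ normalizes, reorients and recompletes the rules of $R_f$ whose left sides are reducible by $R_C$, returning an updated canonical $R'_f$ and the set of new constant rules generated. Algorithm {\bf GeneralCongruenceClosure}$(S,\gg)$: $R_U:=CC(S_C\cup S_U,\gg_U\cup\gg_C)$; $R_C:=$ the constant rules of $R_U$; $NR_C:=\emptyset$; $new:=false$. For each $f\in F_{AC}$: normalize the constants of $S_f$ by $R_C$, $R_f:=$SingleACCompletion$(S_f,\gg_f)$, add the constant rules of $R_f$ to $NR_C$. Update $R_C$ by ${\bf update_C}(R_C,NR_C)$; if it changed, set $new:=true$ and $R_U:={\bf update_U}(R_U,NR_C)$. While $new$: $NNR_C:=\emptyset$, $new:=false$; for each $R_f$ with a rule whose left side is not in canonical form w.r.t. $R_C$: $(R'_f,NR_C):={\bf update}_{AC}(R_f,R_C,\gg_f)$, $R_f:=R'_f$, $NNR_C:=NNR_C\cup NR_C$; if $NNR_C\ne\emptyset$: $NR_C:=NNR_C$, $R_U:={\bf update_U}(R_U,R_C\cup NR_C)$, $new:=true$. Return $R_U\cup\bigcup_f R_f$ (where $R_U$ contains the constant rules $R_C$).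
   Formalization: In the while loop, R_f is updated when either side of a rule (not only its left side) is not canonical w.r.t. R_C; with left sides only, S_f={f(a,b)=c}, S_g={g(a,a)=c, g(a,a)=d}, c≫d leaves f(a,b)→c beside c→d, which is not reduced. *)

theory Defs
  imports "HOL-Library.Multiset" "HOL-Library.Confluence"
begin

section \<open>Ground terms and AC congruence closure\<close>

datatype ('c, 'u, 'f) trm =
    Cst 'c
  | Fun 'u "('c, 'u, 'f) trm list"
  | AC 'f "('c, 'u, 'f) trm" "('c, 'u, 'f) trm"

record ('c, 'u, 'f) signature =
  Consts :: "'c set"
  Usyms :: "'u set"
  arity :: "'u \<Rightarrow> nat"
  ACsyms :: "'f set"

inductive_set terms :: "('c, 'u, 'f) signature \<Rightarrow> ('c, 'u, 'f) trm set"
  for \<Sigma> :: "('c, 'u, 'f) signature" where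
  Cst: "c \<in> Consts \<Sigma> \<Longrightarrow> Cst c \<in> terms \<Sigma>"
| Fun: "h \<in> Usyms \<Sigma> \<Longrightarrow> length ts = arity \<Sigma> h \<Longrightarrow> (\<And>t. t \<in> set ts \<Longrightarrow> t \<in> terms \<Sigma>)
    \<Longrightarrow> Fun h ts \<in> terms \<Sigma>"
| AC: "f \<in> ACsyms \<Sigma> \<Longrightarrow> s \<in> terms \<Sigma> \<Longrightarrow> t \<in> terms \<Sigma> \<Longrightarrow> AC f s t \<in> terms \<Sigma>"

inductive_set ACCC ::
  "('c, 'u, 'f) signature \<Rightarrow> (('c, 'u, 'f) trm \<times> ('c, 'u, 'f) trm) set
    \<Rightarrow> (('c, 'u, 'f) trm \<times> ('c, 'u, 'f) trm) set"
  for \<Sigma> :: "('c, 'u, 'f) signature" and E :: "(('c, 'u, 'f) trm \<times> ('c, 'u, 'f) trm) set" where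
  base: "(s, t) \<in> E \<Longrightarrow> s \<in> terms \<Sigma> \<Longrightarrow> t \<in> terms \<Sigma> \<Longrightarrow> (s, t) \<in> ACCC \<Sigma> E"
| assoc: "AC f (AC f s t) u \<in> terms \<Sigma> \<Longrightarrow> (AC f (AC f s t) u, AC f s (AC f t u)) \<in> ACCC \<Sigma> E"
| comm: "AC f s t \<in> terms \<Sigma> \<Longrightarrow> (AC f s t, AC f t s) \<in> ACCC \<Sigma> E"
| refl: "t \<in> terms \<Sigma> \<Longrightarrow> (t, t) \<in> ACCC \<Sigma> E"
| sym: "(s, t) \<in> ACCC \<Sigma> E \<Longrightarrow> (t, s) \<in> ACCC \<Sigma> E"
| trans: "(s, t) \<in> ACCC \<Sigma> E \<Longrightarrow> (t, u) \<in> ACCC \<Sigma> E \<Longrightarrow> (s, u) \<in> ACCC \<Sigma> E"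
| cong_Fun: "h \<in> Usyms \<Sigma> \<Longrightarrow> length ss = arity \<Sigma> h \<Longrightarrow> length ts = arity \<Sigma> h
    \<Longrightarrow> (\<And>i. i < arity \<Sigma> h \<Longrightarrow> (ss ! i, ts ! i) \<in> ACCC \<Sigma> E)
    \<Longrightarrow> (Fun h ss, Fun h ts) \<in> ACCC \<Sigma> E"
| cong_AC: "f \<in> ACsyms \<Sigma> \<Longrightarrow> (s, s') \<in> ACCC \<Sigma> E \<Longrightarrow> (t, t') \<in> ACCC \<Sigma> E
    \<Longrightarrow> (AC f s t, AC f s' t') \<in> ACCC \<Sigma> E"


section \<open>Flattened terms and monomials\<close>

text \<open>In a flattened term the arguments of an AC symbol form a multiset of at least two terms
  whose root is a different symbol; the flattened terms over \<open>\<Sigma>\<close> are \<open>flatten ` terms \<Sigma>\<close>.\<close>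

datatype ('c, 'u, 'f) fterm =
    FCst 'c
  | FFun 'u "('c, 'u, 'f) fterm list"
  | FAC 'f "('c, 'u, 'f) fterm multiset"

fun ac_args :: "'f \<Rightarrow> ('c, 'u, 'f) fterm \<Rightarrow> ('c, 'u, 'f) fterm multiset" where
  "ac_args f (FAC g M) = (if g = f then M else {#FAC g M#})"
| "ac_args f (FCst c) = {#FCst c#}"
| "ac_args f (FFun h ts) = {#FFun h ts#}"

text \<open>The variadic application of \<open>f\<close>: nested occurrences of \<open>f\<close> are flattened, and \<open>f\<close> applied to a
  single term is that term.\<close>

definition mkAC :: "'f \<Rightarrow> ('c, 'u, 'f) fterm multiset \<Rightarrow> ('c, 'u, 'f) fterm" where
  "mkAC f M = (let N = \<Sum>\<^sub># (image_mset (ac_args f) M)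
    in if size N = 1 then the_elem (set_mset N) else FAC f N)"

primrec flatten :: "('c, 'u, 'f) trm \<Rightarrow> ('c, 'u, 'f) fterm" where
  "flatten (Cst c) = FCst c"
| "flatten (Fun h ts) = FFun h (map flatten ts)"
| "flatten (AC f s t) = mkAC f {#flatten s, flatten t#}"

definition monomials :: "'c set \<Rightarrow> 'c multiset set" where
  "monomials C = {M. M \<noteq> {#} \<and> set_mset M \<subseteq> C}"

text \<open>The \<open>f\<close>-monomial \<open>f(M)\<close> as a flattened term; \<open>monom f {#c#} = FCst c\<close>.\<close>

definition monom :: "'f \<Rightarrow> 'c multiset \<Rightarrow> ('c, 'u, 'f) fterm" where
  "monom f M = mkAC f (image_mset FCst M)"

text \<open>Flattened equations (or rules) viewed as equations between ground terms.\<close>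

definition as_equations ::
  "(('c, 'u, 'f) fterm \<times> ('c, 'u, 'f) fterm) set \<Rightarrow> (('c, 'u, 'f) trm \<times> ('c, 'u, 'f) trm) set" where
  "as_equations R = {(s, t). (flatten s, flatten t) \<in> R}"


section \<open>Purification\<close>

definition arg_rel :: "(('c, 'u, 'f) fterm \<times> ('c, 'u, 'f) fterm) set" where
  "arg_rel = {(u, FFun h ts) | u h ts. u \<in> set ts} \<union> {(u, FAC f M) | u f M. u \<in># M}"

definition flat_eqs ::
  "(('c, 'u, 'f) trm \<times> ('c, 'u, 'f) trm) set \<Rightarrow> (('c, 'u, 'f) fterm \<times> ('c, 'u, 'f) fterm) set" where
  "flat_eqs S = map_prod flatten flatten ` S"

text \<open>Equations that need no constant for a whole side. The sides of all other equations (between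
  two terms with uninterpreted roots, or with two different nonconstant kinds of root) are named too,
  so that only equations of the three flat kinds remain.\<close>

fun pure_eq :: "('c, 'u, 'f) fterm \<Rightarrow> ('c, 'u, 'f) fterm \<Rightarrow> bool" where
  "pure_eq (FCst _) _ = True"
| "pure_eq _ (FCst _) = True"
| "pure_eq (FAC f _) (FAC g _) = (f = g)"
| "pure_eq _ _ = False"

definition named :: "(('c, 'u, 'f) trm \<times> ('c, 'u, 'f) trm) set \<Rightarrow> ('c, 'u, 'f) fterm set" where
  "named S = {u. (\<forall>c. u \<noteq> FCst c) \<and> (\<exists>(s, t) \<in> flat_eqs S.
     (u, s) \<in> arg_rel\<^sup>+ \<or> (u, t) \<in> arg_rel\<^sup>+ \<or> (\<not> pure_eq s t \<and> (u = s \<or> u = t)))}"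

text \<open>The function \<open>\<nu>\<close> supplies the fresh constant for each abstracted subterm.\<close>

definition fresh_naming ::
  "('c, 'u, 'f) signature \<Rightarrow> (('c, 'u, 'f) trm \<times> ('c, 'u, 'f) trm) set
    \<Rightarrow> (('c, 'u, 'f) fterm \<Rightarrow> 'c) \<Rightarrow> bool" where
  "fresh_naming \<Sigma> S \<nu> \<longleftrightarrow> inj_on \<nu> (named S) \<and> \<nu> ` named S \<inter> Consts \<Sigma> = {}"

definition ext_sig ::
  "('c, 'u, 'f) signature \<Rightarrow> (('c, 'u, 'f) trm \<times> ('c, 'u, 'f) trm) set
    \<Rightarrow> (('c, 'u, 'f) fterm \<Rightarrow> 'c) \<Rightarrow> ('c, 'u, 'f) signature" where
  "ext_sig \<Sigma> S \<nu> = \<Sigma>\<lparr>Consts := Consts \<Sigma> \<union> \<nu> ` named S\<rparr>"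

fun const_of :: "(('c, 'u, 'f) fterm \<Rightarrow> 'c) \<Rightarrow> ('c, 'u, 'f) fterm \<Rightarrow> 'c" where
  "const_of \<nu> (FCst c) = c"
| "const_of \<nu> (FFun h ts) = \<nu> (FFun h ts)"
| "const_of \<nu> (FAC f M) = \<nu> (FAC f M)"

definition pure_C ::
  "(('c, 'u, 'f) trm \<times> ('c, 'u, 'f) trm) set \<Rightarrow> (('c, 'u, 'f) fterm \<Rightarrow> 'c) \<Rightarrow> ('c \<times> 'c) set" where
  "pure_C S \<nu> = {(c, d). (FCst c, FCst d) \<in> flat_eqs S}
     \<union> {(const_of \<nu> s, const_of \<nu> t) | s t. (s, t) \<in> flat_eqs S \<and> \<not> pure_eq s t}"

definition pure_U ::
  "(('c, 'u, 'f) trm \<times> ('c, 'u, 'f) trm) set \<Rightarrow> (('c, 'u, 'f) fterm \<Rightarrow> 'c)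
    \<Rightarrow> (('u \<times> 'c list) \<times> 'c) set" where
  "pure_U S \<nu> =
     {((h, map (const_of \<nu>) ts), d) | h ts d.
        (FFun h ts, FCst d) \<in> flat_eqs S \<or> (FCst d, FFun h ts) \<in> flat_eqs S}
     \<union> {((h, map (const_of \<nu>) ts), \<nu> (FFun h ts)) | h ts. FFun h ts \<in> named S}"

definition pure_AC ::
  "(('c, 'u, 'f) trm \<times> ('c, 'u, 'f) trm) set \<Rightarrow> (('c, 'u, 'f) fterm \<Rightarrow> 'c)
    \<Rightarrow> 'f \<Rightarrow> ('c multiset \<times> 'c multiset) set" where
  "pure_AC S \<nu> f =
     {(image_mset (const_of \<nu>) (ac_args f s), image_mset (const_of \<nu>) (ac_args f t)) | s t.
        (s, t) \<in> flat_eqs S \<and> pure_eq s t \<and> (\<exists>M. s = FAC f M \<or> t = FAC f M)}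
     \<union> {(image_mset (const_of \<nu>) M, {#\<nu> (FAC f M)#}) | M. FAC f M \<in> named S}"

text \<open>The three kinds of equations (rules) as pairs of flattened terms.\<close>

definition C_pairs :: "('c \<times> 'c) set \<Rightarrow> (('c, 'u, 'f) fterm \<times> ('c, 'u, 'f) fterm) set" where
  "C_pairs E = {(FCst c, FCst d) | c d. (c, d) \<in> E}"

definition U_pairs ::
  "(('u \<times> 'c list) \<times> 'c) set \<Rightarrow> (('c, 'u, 'f) fterm \<times> ('c, 'u, 'f) fterm) set" where
  "U_pairs E = {(FFun h (map FCst cs), FCst d) | h cs d. ((h, cs), d) \<in> E}"

definition AC_pairs ::
  "'f \<Rightarrow> ('c multiset \<times> 'c multiset) set \<Rightarrow> (('c, 'u, 'f) fterm \<times> ('c, 'u, 'f) fterm) set" where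
  "AC_pairs f E = {(monom f A, monom f B) | A B. (A, B) \<in> E}"

definition pure_form ::
  "('c, 'u, 'f) signature \<Rightarrow> (('c, 'u, 'f) trm \<times> ('c, 'u, 'f) trm) set
    \<Rightarrow> (('c, 'u, 'f) fterm \<Rightarrow> 'c) \<Rightarrow> (('c, 'u, 'f) fterm \<times> ('c, 'u, 'f) fterm) set" where
  "pure_form \<Sigma> S \<nu> =
     C_pairs (pure_C S \<nu>) \<union> U_pairs (pure_U S \<nu>) \<union> (\<Union>f \<in> ACsyms \<Sigma>. AC_pairs f (pure_AC S \<nu> f))"


section \<open>Orderings\<close>

definition strict_total_on :: "'a set \<Rightarrow> ('a \<Rightarrow> 'a \<Rightarrow> bool) \<Rightarrow> bool" where
  "strict_total_on A gt \<longleftrightarrow> irreflp_on A gt \<and> transp_on A gt \<and> totalp_on A gt"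

fun gtU :: "'u set \<Rightarrow> 'c set \<Rightarrow> ('c \<Rightarrow> 'c \<Rightarrow> bool) \<Rightarrow> 'u + 'c \<Rightarrow> 'u + 'c \<Rightarrow> bool" where
  "gtU F C gtC (Inr c) (Inr d) = gtC c d"
| "gtU F C gtC (Inl h) (Inr c) = (h \<in> F \<and> c \<in> C)"
| "gtU F C gtC _ (Inl _) = False"

definition admissible ::
  "'c set \<Rightarrow> ('c \<Rightarrow> 'c \<Rightarrow> bool) \<Rightarrow> ('c multiset \<Rightarrow> 'c multiset \<Rightarrow> bool) \<Rightarrow> bool" where
  "admissible C gtC gt \<longleftrightarrow>
     strict_total_on (monomials C) gt \<and>
     wfp_on (monomials C) (\<lambda>A B. gt B A) \<and>
     (\<forall>c \<in> C. \<forall>d \<in> C. gtC c d \<longrightarrow> gt {#c#} {#d#}) \<and>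
     (\<forall>A \<in> monomials C. \<forall>B \<in> monomials C. B \<subset># A \<longrightarrow> gt A B) \<and>
     (\<forall>A1 \<in> monomials C. \<forall>A2 \<in> monomials C. \<forall>B. set_mset B \<subseteq> C \<longrightarrow>
        gt A1 A2 \<longrightarrow> gt (A1 + B) (A2 + B)) \<and>
     (\<forall>A \<in> monomials C. \<forall>c \<in> C. 1 < size A \<longrightarrow> gt A {#c#})"


section \<open>Rewrite systems\<close>

text \<open>Rules oriented by the given orderings.\<close>

definition C_rules ::
  "('c, 'u, 'f) signature \<Rightarrow> ('c \<Rightarrow> 'c \<Rightarrow> bool) \<Rightarrow> (('c, 'u, 'f) fterm \<times> ('c, 'u, 'f) fterm) set" where
  "C_rules \<Sigma> gtC = {(FCst c, FCst d) | c d. c \<in> Consts \<Sigma> \<and> d \<in> Consts \<Sigma> \<and> gtC c d}"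

definition U_rules ::
  "('c, 'u, 'f) signature \<Rightarrow> ('u + 'c \<Rightarrow> 'u + 'c \<Rightarrow> bool)
    \<Rightarrow> (('c, 'u, 'f) fterm \<times> ('c, 'u, 'f) fterm) set" where
  "U_rules \<Sigma> gt =
     {(FCst c, FCst d) | c d. c \<in> Consts \<Sigma> \<and> d \<in> Consts \<Sigma> \<and> gt (Inr c) (Inr d)}
     \<union> {(FFun h (map FCst cs), FCst d) | h cs d. h \<in> Usyms \<Sigma> \<and> length cs = arity \<Sigma> h \<and>
          set cs \<subseteq> Consts \<Sigma> \<and> d \<in> Consts \<Sigma> \<and> gt (Inl h) (Inr d)}"

definition AC_rules ::
  "('c, 'u, 'f) signature \<Rightarrow> ('c multiset \<Rightarrow> 'c multiset \<Rightarrow> bool) \<Rightarrow> 'f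
    \<Rightarrow> (('c, 'u, 'f) fterm \<times> ('c, 'u, 'f) fterm) set" where
  "AC_rules \<Sigma> gt f = {(monom f A, monom f B) | A B.
     A \<in> monomials (Consts \<Sigma>) \<and> B \<in> monomials (Consts \<Sigma>) \<and> gt A B}"

text \<open>One rewrite step on flattened terms. By the second clause a rule \<open>f(A) \<rightarrow> f(B)\<close> rewrites any
  \<open>f\<close>-term whose argument multiset includes \<open>A\<close>.\<close>

inductive rew ::
  "(('c, 'u, 'f) fterm \<times> ('c, 'u, 'f) fterm) set \<Rightarrow> ('c, 'u, 'f) fterm \<Rightarrow> ('c, 'u, 'f) fterm \<Rightarrow> bool"
  for R :: "(('c, 'u, 'f) fterm \<times> ('c, 'u, 'f) fterm) set" where
  root: "(l, r) \<in> R \<Longrightarrow> rew R l r"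
| ac: "(monom f A, monom f B) \<in> R \<Longrightarrow> image_mset FCst A \<subseteq># M
    \<Longrightarrow> rew R (FAC f M) (mkAC f (M - image_mset FCst A + image_mset FCst B))"
| fun_arg: "rew R s t \<Longrightarrow> rew R (FFun h (us @ s # vs)) (FFun h (us @ t # vs))"
| ac_arg: "rew R s t \<Longrightarrow> rew R (FAC f (add_mset s M)) (mkAC f (add_mset t M))"

definition rew_on ::
  "('c, 'u, 'f) signature \<Rightarrow> (('c, 'u, 'f) fterm \<times> ('c, 'u, 'f) fterm) set
    \<Rightarrow> ('c, 'u, 'f) fterm \<Rightarrow> ('c, 'u, 'f) fterm \<Rightarrow> bool" where
  "rew_on \<Sigma> R s t \<longleftrightarrow> s \<in> flatten ` terms \<Sigma> \<and> rew R s t"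

definition canonical ::
  "('c, 'u, 'f) signature \<Rightarrow> (('c, 'u, 'f) fterm \<times> ('c, 'u, 'f) fterm) set \<Rightarrow> bool" where
  "canonical \<Sigma> R \<longleftrightarrow> wfp ((rew_on \<Sigma> R)\<inverse>\<inverse>) \<and> confluentp (rew_on \<Sigma> R)"

definition reduced :: "(('c, 'u, 'f) fterm \<times> ('c, 'u, 'f) fterm) set \<Rightarrow> bool" where
  "reduced R \<longleftrightarrow> (\<forall>(l, r) \<in> R. (\<nexists>t. rew (R - {(l, r)}) l t) \<and> (\<nexists>t. rew (R - {(l, r)}) r t))"

definition reduced_canonical ::
  "('c, 'u, 'f) signature \<Rightarrow> (('c, 'u, 'f) fterm \<times> ('c, 'u, 'f) fterm) set \<Rightarrow> bool" where
  "reduced_canonical \<Sigma> R \<longleftrightarrow> reduced R \<and> canonical \<Sigma> R"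


section \<open>Constant and flat rules\<close>

text \<open>The \<open>gtC\<close>-least element of the class of \<open>c\<close> in the equivalence generated by \<open>E\<close>.\<close>

definition rep :: "('c \<Rightarrow> 'c \<Rightarrow> bool) \<Rightarrow> ('c \<times> 'c) set \<Rightarrow> 'c \<Rightarrow> 'c" where
  "rep gtC E c = (THE d. (c, d) \<in> (E \<union> E\<inverse>)\<^sup>* \<and> (\<forall>e. (c, e) \<in> (E \<union> E\<inverse>)\<^sup>* \<longrightarrow> e \<noteq> d \<longrightarrow> gtC e d))"

definition update_C :: "('c \<Rightarrow> 'c \<Rightarrow> bool) \<Rightarrow> ('c \<times> 'c) set \<Rightarrow> ('c \<times> 'c) set \<Rightarrow> ('c \<times> 'c) set" where
  "update_C gtC RC N =
     {(c, rep gtC (RC \<union> N) c) | c. c \<in> Field (RC \<union> N) \<and> rep gtC (RC \<union> N) c \<noteq> c}"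

definition norm_U ::
  "('c \<Rightarrow> 'c \<Rightarrow> bool) \<Rightarrow> ('c \<times> 'c) set \<Rightarrow> (('u \<times> 'c list) \<times> 'c) set \<Rightarrow> (('u \<times> 'c list) \<times> 'c) set" where
  "norm_U gtC RC RU = (\<lambda>((h, cs), d). ((h, map (rep gtC RC) cs), rep gtC RC d)) ` RU"

definition merge_U ::
  "('c \<Rightarrow> 'c \<Rightarrow> bool) \<Rightarrow> (('u \<times> 'c list) \<times> 'c) set \<Rightarrow> (('u \<times> 'c list) \<times> 'c) set" where
  "merge_U gtC RU = {(l, d) \<in> RU. \<forall>d'. (l, d') \<in> RU \<longrightarrow> d' \<noteq> d \<longrightarrow> gtC d' d}"

definition new_eqs :: "(('u \<times> 'c list) \<times> 'c) set \<Rightarrow> ('c \<times> 'c) set" where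
  "new_eqs RU = {(d, d'). d \<noteq> d' \<and> (\<exists>l. (l, d) \<in> RU \<and> (l, d') \<in> RU)}"

text \<open>In this and the following loops, the result \<open>None\<close> means divergence.\<close>

partial_function (option) update_U ::
  "('c \<Rightarrow> 'c \<Rightarrow> bool) \<Rightarrow> ('c \<times> 'c) set \<Rightarrow> (('u \<times> 'c list) \<times> 'c) set \<Rightarrow> ('c \<times> 'c) set
    \<Rightarrow> (('c \<times> 'c) set \<times> (('u \<times> 'c list) \<times> 'c) set) option" where
  "update_U gtC RC RU N =
    (let RC' = update_C gtC RC N; F = norm_U gtC RC' RU
     in if new_eqs F = {} then Some (RC', F)
        else update_U gtC RC' (merge_U gtC F) (new_eqs F))"

definition CC ::
  "('c \<Rightarrow> 'c \<Rightarrow> bool) \<Rightarrow> ('c \<times> 'c) set \<Rightarrow> (('u \<times> 'c list) \<times> 'c) set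
    \<Rightarrow> (('c \<times> 'c) set \<times> (('u \<times> 'c list) \<times> 'c) set) option" where
  "CC gtC SC SU = update_U gtC {} SU SC"


section \<open>Completion for one AC symbol\<close>

type_synonym 'c mrules = "('c multiset \<times> 'c multiset) set"

definition mono_rew :: "'c mrules \<Rightarrow> ('c multiset \<times> 'c multiset) set" where
  "mono_rew R = {(M, M - A + B) | M A B. (A, B) \<in> R \<and> A \<subseteq># M}"

text \<open>The completion procedure leaves open how normal forms are computed and which equation is
  treated next; both choices are parameters (\<open>nf\<close> and \<open>pick\<close>) subject to these conditions.\<close>

definition normalizer ::
  "'c set \<Rightarrow> ('c multiset \<Rightarrow> 'c multiset \<Rightarrow> bool)
    \<Rightarrow> ('c mrules \<Rightarrow> 'c multiset \<Rightarrow> 'c multiset) \<Rightarrow> bool" where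
  "normalizer C gt nf \<longleftrightarrow> (\<forall>R M. finite R \<longrightarrow> M \<in> monomials C \<longrightarrow>
     (\<forall>(A, B) \<in> R. A \<in> monomials C \<and> B \<in> monomials C \<and> gt A B) \<longrightarrow>
     (M, nf R M) \<in> (mono_rew R)\<^sup>* \<and> nf R M \<notin> Domain (mono_rew R))"

definition selection ::
  "('c mrules \<Rightarrow> 'c mrules \<Rightarrow> 'c multiset \<times> 'c multiset) \<Rightarrow> bool" where
  "selection pick \<longleftrightarrow> (\<forall>R T. T \<noteq> {} \<longrightarrow> pick R T \<in> T)"

fun critical_pair ::
  "'c multiset \<times> 'c multiset \<Rightarrow> 'c multiset \<times> 'c multiset \<Rightarrow> 'c multiset \<times> 'c multiset" where
  "critical_pair (A1, A2) (B1, B2) =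
    (let AB = (A1 + B1) - (A1 \<inter># B1) in ((AB - A1) + A2, (AB - B1) + B2))"

definition reduce_rhs :: "('c mrules \<Rightarrow> 'c multiset \<Rightarrow> 'c multiset) \<Rightarrow> 'c mrules \<Rightarrow> 'c mrules" where
  "reduce_rhs nf R = (\<lambda>(A, B). (A, nf R B)) ` R"

definition orient ::
  "('c multiset \<Rightarrow> 'c multiset \<Rightarrow> bool) \<Rightarrow> 'c multiset \<Rightarrow> 'c multiset \<Rightarrow> 'c multiset \<times> 'c multiset" where
  "orient gt P Q = (if gt P Q then (P, Q) else (Q, P))"

text \<open>A state \<open>(R, T)\<close> consists of the current rules and the pending equations. The chosen equation is
  normalized; if it is not joinable, it is oriented and added as a rule, its critical pairs with the
  rules become pending, and rules with a left side reducible by it are turned back into equations.\<close>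

definition completion_step ::
  "('c multiset \<Rightarrow> 'c multiset \<Rightarrow> bool) \<Rightarrow> ('c mrules \<Rightarrow> 'c mrules \<Rightarrow> 'c multiset \<times> 'c multiset)
    \<Rightarrow> ('c mrules \<Rightarrow> 'c multiset \<Rightarrow> 'c multiset) \<Rightarrow> 'c mrules \<Rightarrow> 'c mrules \<Rightarrow> 'c mrules \<times> 'c mrules" where
  "completion_step gt pick nf R T =
    (let e = pick R T; P = nf R (fst e); Q = nf R (snd e)
     in if P = Q then (R, T - {e})
        else
          let new = orient gt P Q; collapsed = {rl \<in> R. fst new \<subseteq># fst rl}
          in (reduce_rhs nf (insert new (R - collapsed)),
              (T - {e}) \<union> collapsed \<union> critical_pair new ` R))"

partial_function (option) complete ::
  "('c multiset \<Rightarrow> 'c multiset \<Rightarrow> bool) \<Rightarrow> ('c mrules \<Rightarrow> 'c mrules \<Rightarrow> 'c multiset \<times> 'c multiset)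
    \<Rightarrow> ('c mrules \<Rightarrow> 'c multiset \<Rightarrow> 'c multiset) \<Rightarrow> 'c mrules \<Rightarrow> 'c mrules \<Rightarrow> 'c mrules option" where
  "complete gt pick nf R T =
    (if T = {} then Some R
     else let st = completion_step gt pick nf R T in complete gt pick nf (fst st) (snd st))"

definition SingleACCompletion ::
  "('c multiset \<Rightarrow> 'c multiset \<Rightarrow> bool) \<Rightarrow> ('c mrules \<Rightarrow> 'c mrules \<Rightarrow> 'c multiset \<times> 'c multiset)
    \<Rightarrow> ('c mrules \<Rightarrow> 'c multiset \<Rightarrow> 'c multiset) \<Rightarrow> 'c mrules \<Rightarrow> 'c mrules option" where
  "SingleACCompletion gt pick nf Sf = complete gt pick nf {} Sf"

definition const_rules :: "'c mrules \<Rightarrow> ('c \<times> 'c) set" where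
  "const_rules R = {(c, d). ({#c#}, {#d#}) \<in> R}"

definition norm_mono :: "('c \<Rightarrow> 'c \<Rightarrow> bool) \<Rightarrow> ('c \<times> 'c) set \<Rightarrow> 'c multiset \<Rightarrow> 'c multiset" where
  "norm_mono gtC RC M = image_mset (rep gtC RC) M"

text \<open>The rules with a left side in canonical form w.r.t. the constant rules are kept, with their right
  sides normalized; the others are normalized and handed to completion as equations.\<close>

definition update_AC ::
  "('c \<Rightarrow> 'c \<Rightarrow> bool) \<Rightarrow> ('c multiset \<Rightarrow> 'c multiset \<Rightarrow> bool)
    \<Rightarrow> ('c mrules \<Rightarrow> 'c mrules \<Rightarrow> 'c multiset \<times> 'c multiset)
    \<Rightarrow> ('c mrules \<Rightarrow> 'c multiset \<Rightarrow> 'c multiset) \<Rightarrow> 'c mrules \<Rightarrow> ('c \<times> 'c) set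
    \<Rightarrow> ('c mrules \<times> ('c \<times> 'c) set) option" where
  "update_AC gtC gt pick nf Rf RC =
    (let n = norm_mono gtC RC;
         kept = {(A, n B) | A B. (A, B) \<in> Rf \<and> n A = A};
         changed = {(n A, n B) | A B. (A, B) \<in> Rf \<and> n A \<noteq> A}
     in Option.bind (complete gt pick nf (reduce_rhs nf kept) changed)
          (\<lambda>Rf'. Some (Rf', const_rules Rf')))"


section \<open>The combined algorithm\<close>

definition for_each :: "'f set \<Rightarrow> ('f \<Rightarrow> 'a option) \<Rightarrow> ('f \<Rightarrow> 'a) option" where
  "for_each F g = (if \<forall>f \<in> F. g f \<noteq> None then Some (\<lambda>f. the (g f)) else None)"

text \<open>The test covers both sides of the rules: a rule with only a noncanonical right side does not
  require recompletion, but its right side has to be normalized for the result to be reduced.\<close>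

definition update_AC_if_needed ::
  "('c \<Rightarrow> 'c \<Rightarrow> bool) \<Rightarrow> ('c multiset \<Rightarrow> 'c multiset \<Rightarrow> bool)
    \<Rightarrow> ('c mrules \<Rightarrow> 'c mrules \<Rightarrow> 'c multiset \<times> 'c multiset)
    \<Rightarrow> ('c mrules \<Rightarrow> 'c multiset \<Rightarrow> 'c multiset) \<Rightarrow> 'c mrules \<Rightarrow> ('c \<times> 'c) set
    \<Rightarrow> ('c mrules \<times> ('c \<times> 'c) set) option" where
  "update_AC_if_needed gtC gt pick nf Rf RC =
    (if \<exists>(A, B) \<in> Rf. norm_mono gtC RC A \<noteq> A \<or> norm_mono gtC RC B \<noteq> B
     then update_AC gtC gt pick nf Rf RC else Some (Rf, {}))"

partial_function (option) GCC_loop ::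
  "'f set \<Rightarrow> ('c \<Rightarrow> 'c \<Rightarrow> bool) \<Rightarrow> ('f \<Rightarrow> 'c multiset \<Rightarrow> 'c multiset \<Rightarrow> bool)
    \<Rightarrow> ('f \<Rightarrow> 'c mrules \<Rightarrow> 'c mrules \<Rightarrow> 'c multiset \<times> 'c multiset)
    \<Rightarrow> ('f \<Rightarrow> 'c mrules \<Rightarrow> 'c multiset \<Rightarrow> 'c multiset)
    \<Rightarrow> ('c \<times> 'c) set \<Rightarrow> (('u \<times> 'c list) \<times> 'c) set \<Rightarrow> ('f \<Rightarrow> 'c mrules)
    \<Rightarrow> (('c \<times> 'c) set \<times> (('u \<times> 'c list) \<times> 'c) set \<times> ('f \<Rightarrow> 'c mrules)) option" where
  "GCC_loop F gtC gt pick nf RC RU RF =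
    Option.bind
      (for_each F (\<lambda>f. update_AC_if_needed gtC (gt f) (pick f) (nf f) (RF f) RC))
      (\<lambda>res. let RF' = (\<lambda>f. fst (res f)); NNRC = (\<Union>f \<in> F. snd (res f))
        in if NNRC = {} then Some (RC, RU, RF')
           else Option.bind (update_U gtC RC RU (RC \<union> NNRC))
             (\<lambda>p. GCC_loop F gtC gt pick nf (fst p) (snd p) RF'))"

text \<open>The system of constant and flat rules is held as the pair \<open>(RC, RU)\<close> of its constant rules and
  its flat rules.\<close>

definition GeneralCongruenceClosure ::
  "'f set \<Rightarrow> ('c \<Rightarrow> 'c \<Rightarrow> bool) \<Rightarrow> ('f \<Rightarrow> 'c multiset \<Rightarrow> 'c multiset \<Rightarrow> bool)
    \<Rightarrow> ('f \<Rightarrow> 'c mrules \<Rightarrow> 'c mrules \<Rightarrow> 'c multiset \<times> 'c multiset)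
    \<Rightarrow> ('f \<Rightarrow> 'c mrules \<Rightarrow> 'c multiset \<Rightarrow> 'c multiset)
    \<Rightarrow> ('c \<times> 'c) set \<Rightarrow> (('u \<times> 'c list) \<times> 'c) set \<Rightarrow> ('f \<Rightarrow> 'c mrules)
    \<Rightarrow> (('c \<times> 'c) set \<times> (('u \<times> 'c list) \<times> 'c) set \<times> ('f \<Rightarrow> 'c mrules)) option" where
  "GeneralCongruenceClosure F gtC gt pick nf SC SU SF =
    Option.bind (CC gtC SC SU) (\<lambda>(RC, RU).
    Option.bind
      (for_each F (\<lambda>f. SingleACCompletion (gt f) (pick f) (nf f)
         (map_prod (norm_mono gtC RC) (norm_mono gtC RC) ` SF f))) (\<lambda>RF.
      let NRC = (\<Union>f \<in> F. const_rules (RF f))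
      in if update_C gtC RC NRC = RC then Some (RC, RU, RF)
         else Option.bind (update_U gtC RC RU NRC)
           (\<lambda>(RC', RU'). GCC_loop F gtC gt pick nf RC' RU' RF)))"

end

theory Submission
  imports Defs
begin

text \<open>Completion for one AC symbol terminates because the multisets covered by left sides grow at every
  new rule (Dickson's lemma). Its loop invariant is that every critical peak is connected below its
  overlap by the current rules and pending equations; at the end this gives unique normal forms of
  monomials, and it survives the normalization of constants since replacing constants by smaller ones
  maps such a proof to one that is no larger. Each further round of the combined loop merges two canonical
  constants, so it stops with systems over canonical constants only and without constant rules in the
  systems of the AC symbols. Such a system computes values in an algebra on flattened terms that
  satisfies AC and all rules, whence confluence of the union. Uniqueness holds because an irreducible
  monomial is the least one of its congruence class, so that left sides are the minimal reducible
  monomials.\<close>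

section \<open>Flattening\<close>

text \<open>Equality of generated congruences is not tracked from state to state, since later states
  mention fewer constants. Instead each procedure is shown to preserve, for every compatible triple
  of relations (\<open>model\<close>), whether the current state holds in it. Every congruence on
  terms yields such a triple, so input and output are compared at the end by taking the congruences
  that they generate themselves. Two obstacles shape the rest. The orderings \<open>gt f\<close>
  live on monomials and are unrelated to one another beyond the constants, so no single ordering on
  terms is at hand for termination of the union; accessibility of a term is derived from that of its
  arguments. And flattening does not keep subterms in place: a term headed by \<open>f\<close>
  dissolves when it is put into an \<open>f\<close>-context, so closure of rewriting under contexts
  needs a proof. For the same reason the confluence proof avoids peaks between terms altogether and
  works with peaks of monomials only.\<close>

definition flat_ac :: "('c, 'u, 'f) fterm \<Rightarrow> bool" where
  "flat_ac x \<longleftrightarrow> (\<forall>f M. x = FAC f M \<longrightarrow> 2 \<le> size M \<and> (\<forall>y \<in># M. ac_args f y = {#y#}))"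

text \<open>The second half of \<open>mkAC\<close>: the arguments arrive already flattened, and only
  a single one is collapsed.\<close>

definition mk :: "'f \<Rightarrow> ('c, 'u, 'f) fterm multiset \<Rightarrow> ('c, 'u, 'f) fterm" where
  "mk f N = (if size N = 1 then the_elem (set_mset N) else FAC f N)"

lemma mkAC_mk: "mkAC f M = mk f (\<Sum>\<^sub># (image_mset (ac_args f) M))"
  by (simp add: mkAC_def mk_def Let_def)

lemma mk_single [simp]: "mk f {#x#} = x"
  by (simp add: mk_def)

lemma mk_big: "size N \<noteq> 1 \<Longrightarrow> mk f N = FAC f N"
  by (simp add: mk_def)

lemma flat_ac_simps [simp]: "flat_ac (FCst c)" "flat_ac (FFun h ts)"
  by (auto simp: flat_ac_def)

lemma ac_args_ac_args: "flat_ac x \<Longrightarrow> y \<in># ac_args f x \<Longrightarrow> ac_args f y = {#y#}"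
  by (cases x) (auto simp: flat_ac_def split: if_splits)

lemma ac_args_nonempty: "flat_ac x \<Longrightarrow> ac_args f x \<noteq> {#}"
  by (cases x) (auto simp: flat_ac_def)

lemma mk_ac_args: "flat_ac x \<Longrightarrow> mk f (ac_args f x) = x"
  by (cases x) (auto simp: flat_ac_def mk_def)

text \<open>Together with \<open>mk_ac_args\<close>: on terms with a flat root and on multisets of
  arguments not headed by \<open>f\<close>, the maps \<open>ac_args f\<close> and
  \<open>mk f\<close> undo one another. Identities about \<open>mkAC\<close> thereby become
  identities of multiset sums.\<close>

lemma ac_args_mk: "(\<And>y. y \<in># N \<Longrightarrow> ac_args f y = {#y#}) \<Longrightarrow> ac_args f (mk f N) = N"
proof (cases "size N = 1")
  case True
  then obtain y where "N = {#y#}" using size_1_singleton_mset by blast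
  moreover assume "\<And>y. y \<in># N \<Longrightarrow> ac_args f y = {#y#}"
  ultimately show ?thesis by simp
qed (simp add: mk_big)

lemma sum_ac_args_trivial:
  "(\<And>y. y \<in># N \<Longrightarrow> ac_args f y = {#y#}) \<Longrightarrow> \<Sum>\<^sub># (image_mset (ac_args f) N) = N"
  by (induction N) auto

lemma mkAC_trivial: "(\<And>y. y \<in># N \<Longrightarrow> ac_args f y = {#y#}) \<Longrightarrow> mkAC f N = mk f N"
  by (simp add: mkAC_mk sum_ac_args_trivial)

lemma ac_args_mkAC:
  "(\<And>y. y \<in># N \<Longrightarrow> flat_ac y) \<Longrightarrow> ac_args f (mkAC f N) = \<Sum>\<^sub># (image_mset (ac_args f) N)"
  unfolding mkAC_mk by (rule ac_args_mk) (auto intro: ac_args_ac_args)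

lemma mkAC_single: "flat_ac x \<Longrightarrow> mkAC f {#x#} = x"
  by (simp add: mkAC_mk mk_ac_args)

text \<open>Flattening in two stages agrees with flattening at once; this is associativity on the
  level of flattened terms.\<close>

lemma mkAC_add_mkAC:
  "(\<And>y. y \<in># X \<Longrightarrow> flat_ac y) \<Longrightarrow> mkAC f (add_mset (mkAC f X) Y) = mkAC f (X + Y)"
  using ac_args_mkAC[of X f] by (simp add: mkAC_mk)

lemma mkAC_pair_FAC:
  assumes "flat_ac x" "flat_ac y"
  shows "mkAC f {#x, y#} = FAC f (ac_args f x + ac_args f y)"
proof -
  have "size (ac_args f x) \<noteq> 0" "size (ac_args f y) \<noteq> 0"
    using assms ac_args_nonempty[of x] ac_args_nonempty[of y] by auto
  then have "size (ac_args f x + ac_args f y) \<noteq> 1" unfolding size_union by linarith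
  then show ?thesis by (simp add: mkAC_mk mk_big)
qed

lemma flat_ac_flatten [simp]: "flat_ac (flatten t)"
proof (induction t)
  case (AC f s t)
  have "size (ac_args f (flatten s)) \<noteq> 0" "size (ac_args f (flatten t)) \<noteq> 0"
    using AC ac_args_nonempty[of "flatten s"] ac_args_nonempty[of "flatten t"] by auto
  then have "2 \<le> size (ac_args f (flatten s)) + size (ac_args f (flatten t))"
    by linarith
  then show ?case using AC
    by (auto simp: mkAC_pair_FAC flat_ac_def[of "FAC _ _"] intro: ac_args_ac_args)
qed auto

lemma flatten_AC: "flatten (AC f s t) = FAC f (ac_args f (flatten s) + ac_args f (flatten t))"
  by (simp add: mkAC_pair_FAC)

section \<open>Completeness of flattening for AC-equality\<close>

lemma ACCC_terms: "(s, t) \<in> ACCC \<Sigma> E \<Longrightarrow> s \<in> terms \<Sigma> \<and> t \<in> terms \<Sigma>"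
proof (induction rule: ACCC.induct)
  case (assoc f s t u)
  then show ?case by (auto elim!: terms.cases intro!: terms.intros)
next
  case (comm f s t)
  then show ?case by (auto elim!: terms.cases intro!: terms.intros)
next
  case (cong_Fun h ss ts)
  then show ?case by (auto intro!: terms.intros simp: in_set_conv_nth)
qed (auto intro: terms.intros)

lemma terms_Fun_iff:
  "Fun h ts \<in> terms \<Sigma> \<longleftrightarrow> h \<in> Usyms \<Sigma> \<and> length ts = arity \<Sigma> h \<and> set ts \<subseteq> terms \<Sigma>"
  by (auto elim: terms.cases intro: terms.intros)

lemma terms_AC_iff: "AC f s t \<in> terms \<Sigma> \<longleftrightarrow> f \<in> ACsyms \<Sigma> \<and> s \<in> terms \<Sigma> \<and> t \<in> terms \<Sigma>"
  by (auto elim: terms.cases intro: terms.intros)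

lemma terms_Cst_iff: "Cst c \<in> terms \<Sigma> \<longleftrightarrow> c \<in> Consts \<Sigma>"
  by (auto elim: terms.cases intro: terms.intros)

lemmas terms_iff = terms_Fun_iff terms_AC_iff terms_Cst_iff

text \<open>The leaves of the \<open>f\<close>-tree at the root, in their order; unlike
  \<open>ac_args f\<close> it acts on terms that are not flattened.\<close>

fun fargs :: "'f \<Rightarrow> ('c, 'u, 'f) trm \<Rightarrow> ('c, 'u, 'f) trm list" where
  "fargs f (AC g s t) = (if g = f then fargs f s @ fargs f t else [AC g s t])"
| "fargs f t = [t]"

text \<open>The right-nested representative to which every \<open>f\<close>-tree is brought. The
  empty list gets no value because \<open>f\<close> has no unit.\<close>

fun comb :: "'f \<Rightarrow> ('c, 'u, 'f) trm list \<Rightarrow> ('c, 'u, 'f) trm" where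
  "comb f [] = undefined"
| "comb f [x] = x"
| "comb f (x # y # zs) = AC f x (comb f (y # zs))"

lemma comb_Cons: "xs \<noteq> [] \<Longrightarrow> comb f (x # xs) = AC f x (comb f xs)"
  by (cases xs) auto

lemma comb_terms: "f \<in> ACsyms \<Sigma> \<Longrightarrow> xs \<noteq> [] \<Longrightarrow> set xs \<subseteq> terms \<Sigma> \<Longrightarrow> comb f xs \<in> terms \<Sigma>"
  by (induction f xs rule: comb.induct) (auto simp: terms_iff)

lemma fargs_nonempty [simp]: "fargs f t \<noteq> []"
  by (induction t) auto

lemma fargs_terms: "t \<in> terms \<Sigma> \<Longrightarrow> set (fargs f t) \<subseteq> terms \<Sigma>"
  by (induction t) (auto simp: terms_iff)

lemma ac_args_flatten: "ac_args f (flatten t) = mset (map flatten (fargs f t))"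
proof (induction t)
  case (AC g s t)
  then show ?case by (auto simp add: flatten_AC simp del: flatten.simps(3))
qed auto

lemma ACCC_comb_append:
  assumes "f \<in> ACsyms \<Sigma>" "xs \<noteq> []" "ys \<noteq> []" "set xs \<subseteq> terms \<Sigma>" "set ys \<subseteq> terms \<Sigma>"
  shows "(comb f (xs @ ys), AC f (comb f xs) (comb f ys)) \<in> ACCC \<Sigma> E"
  using assms(2,4)
proof (induction xs)
  case (Cons x xs)
  have ys: "comb f ys \<in> terms \<Sigma>" by (rule comb_terms[OF assms(1,3,5)])
  show ?case
  proof (cases "xs = []")
    case True
    then show ?thesis using Cons ys assms by (auto simp: comb_Cons terms_iff intro!: ACCC.refl)
  next
    case False
    then have xs: "comb f xs \<in> terms \<Sigma>" using Cons assms comb_terms by (metis set_subset_Cons subset_trans)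
    have "(AC f x (comb f (xs @ ys)), AC f x (AC f (comb f xs) (comb f ys))) \<in> ACCC \<Sigma> E"
      using False Cons assms by (auto intro!: ACCC.cong_AC ACCC.refl)
    moreover have "(AC f (AC f x (comb f xs)) (comb f ys), AC f x (AC f (comb f xs) (comb f ys))) \<in> ACCC \<Sigma> E"
      using xs ys Cons assms by (auto simp: terms_iff intro!: ACCC.assoc)
    ultimately show ?thesis using False ACCC.trans[OF _ ACCC.sym] by (simp add: comb_Cons)
  qed
qed simp

lemma ACCC_comb_fargs:
  assumes "f \<in> ACsyms \<Sigma>" "t \<in> terms \<Sigma>"
  shows "(t, comb f (fargs f t)) \<in> ACCC \<Sigma> E"
  using assms(2)
proof (induction t)
  case (AC g s t)
  then have st: "s \<in> terms \<Sigma>" "t \<in> terms \<Sigma>" by (auto simp: terms_iff)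
  show ?case
  proof (cases "g = f")
    case True
    have "(AC f s t, AC f (comb f (fargs f s)) (comb f (fargs f t))) \<in> ACCC \<Sigma> E"
      using AC st assms by (auto intro!: ACCC.cong_AC)
    moreover have "(comb f (fargs f s @ fargs f t), AC f (comb f (fargs f s)) (comb f (fargs f t))) \<in> ACCC \<Sigma> E"
      using st assms by (intro ACCC_comb_append) (auto dest: fargs_terms)
    ultimately show ?thesis using True ACCC.trans[OF _ ACCC.sym] by simp
  next
    case False
    then show ?thesis using AC by (simp add: ACCC.refl terms_iff)
  qed
qed (auto intro!: ACCC.refl simp: terms_iff)

text \<open>Commutativity is used at most once, to swap the block \<open>comb f as\<close> with
  \<open>x\<close>; everything else is regrouping by associativity.\<close>

lemma ACCC_comb_middle:
  assumes f: "f \<in> ACsyms \<Sigma>" and x: "x \<in> terms \<Sigma>" and as: "set as \<subseteq> terms \<Sigma>" and bs: "set bs \<subseteq> terms \<Sigma>"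
  shows "(comb f (as @ x # bs), comb f (x # as @ bs)) \<in> ACCC \<Sigma> E"
proof (cases "as = []")
  case True
  then show ?thesis using assms comb_terms[of f \<Sigma> "x # bs"] by (auto intro: ACCC.refl)
next
  case False
  have a: "comb f as \<in> terms \<Sigma>" by (rule comb_terms[OF f False as])
  have 1: "(comb f (as @ x # bs), AC f (comb f as) (comb f (x # bs))) \<in> ACCC \<Sigma> E"
    using assms False by (intro ACCC_comb_append) auto
  show ?thesis
  proof (cases "bs = []")
    case True
    have "(AC f (comb f as) x, AC f x (comb f as)) \<in> ACCC \<Sigma> E"
      using a f x by (auto intro!: ACCC.comm simp: terms_iff)
    then show ?thesis using 1 True False using ACCC.trans[OF 1] by (simp add: comb_Cons)
  next
    case b: False
    have bt: "comb f bs \<in> terms \<Sigma>" by (rule comb_terms[OF f b bs])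
    have 2: "(AC f (comb f as) (AC f x (comb f bs)), AC f (AC f (comb f as) x) (comb f bs)) \<in> ACCC \<Sigma> E"
      using a bt f x by (intro ACCC.sym[OF ACCC.assoc]) (auto simp: terms_iff)
    have 3: "(AC f (AC f (comb f as) x) (comb f bs), AC f (AC f x (comb f as)) (comb f bs)) \<in> ACCC \<Sigma> E"
      using a bt f x by (auto intro!: ACCC.cong_AC ACCC.comm ACCC.refl simp: terms_iff)
    have 4: "(AC f (AC f x (comb f as)) (comb f bs), AC f x (AC f (comb f as) (comb f bs))) \<in> ACCC \<Sigma> E"
      using a bt f x by (intro ACCC.assoc) (auto simp: terms_iff)
    have 5: "(AC f x (AC f (comb f as) (comb f bs)), AC f x (comb f (as @ bs))) \<in> ACCC \<Sigma> E"
      using assms False b by (intro ACCC.cong_AC ACCC.refl ACCC.sym[OF ACCC_comb_append]) auto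
    have "(AC f (comb f as) (comb f (x # bs)), AC f x (comb f (as @ bs))) \<in> ACCC \<Sigma> E"
      using ACCC.trans[OF 2 ACCC.trans[OF 3 ACCC.trans[OF 4 5]]] b by (simp add: comb_Cons)
    then show ?thesis using ACCC.trans[OF 1] False by (simp add: comb_Cons)
  qed
qed

lemma ACCC_comb_perm:
  assumes "f \<in> ACsyms \<Sigma>" "xs \<noteq> []" "set xs \<subseteq> terms \<Sigma>" "mset xs = mset ys"
  shows "(comb f xs, comb f ys) \<in> ACCC \<Sigma> E"
  using assms(2-)
proof (induction xs arbitrary: ys)
  case (Cons x xs)
  have "x \<in> set ys" using Cons by (metis list.set_intros(1) set_mset_mset)
  then obtain as bs where ys: "ys = as @ x # bs" by (meson split_list)
  have m: "mset xs = mset (as @ bs)" using Cons ys by simp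
  have st: "set as \<subseteq> terms \<Sigma>" "set bs \<subseteq> terms \<Sigma>" "x \<in> terms \<Sigma>" "set xs \<subseteq> terms \<Sigma>"
    using Cons ys mset_eq_setD[OF m] by auto
  have 2: "(comb f (x # as @ bs), comb f ys) \<in> ACCC \<Sigma> E"
    unfolding ys using st assms by (intro ACCC.sym[OF ACCC_comb_middle]) auto
  show ?case
  proof (cases "xs = []")
    case True
    then show ?thesis using 2 m by simp
  next
    case False
    then have "as @ bs \<noteq> []" using m by auto
    moreover have "(comb f xs, comb f (as @ bs)) \<in> ACCC \<Sigma> E" using False m st Cons by blast
    ultimately have "(comb f (x # xs), comb f (x # as @ bs)) \<in> ACCC \<Sigma> E"
      using False st assms(1) ACCC.cong_AC[OF assms(1) ACCC.refl] by (simp add: comb_Cons del: append_is_Nil_conv)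
    then show ?thesis using 2 by (rule ACCC.trans)
  qed
qed simp

lemma ACCC_comb_cong:
  assumes "list_all2 (\<lambda>s t. (s, t) \<in> ACCC \<Sigma> E) xs ys" "f \<in> ACsyms \<Sigma>" "xs \<noteq> []"
  shows "(comb f xs, comb f ys) \<in> ACCC \<Sigma> E"
  using assms(1,3)
proof (induction xs ys rule: list_all2_induct)
  case (Cons x xs y ys)
  show ?case
  proof (cases "xs = []")
    case False
    then have "ys \<noteq> []" using Cons by auto
    then show ?thesis using False Cons assms by (auto simp: comb_Cons intro: ACCC.cong_AC)
  qed (use Cons in auto)
qed simp

lemma size_fargs: "u \<in> set (fargs f (AC f s t)) \<Longrightarrow> size u < size (AC f s t)"
proof -
  have "u \<in> set (fargs f v) \<Longrightarrow> size u \<le> size v" for v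
    by (induction v) (auto split: if_splits)
  then show "u \<in> set (fargs f (AC f s t)) \<Longrightarrow> size u < size (AC f s t)" by fastforce
qed

text \<open>Both terms are AC-equal to the combs of their \<open>f\<close>-arguments. These
  arguments have equal flattenings only up to a permutation, which \<open>ACCC_comb_perm\<close>
  realizes. They need not be direct subterms, so the induction is on size.\<close>

lemma flatten_eq_ACCC:
  "s \<in> terms \<Sigma> \<Longrightarrow> t \<in> terms \<Sigma> \<Longrightarrow> flatten s = flatten t \<Longrightarrow> (s, t) \<in> ACCC \<Sigma> E"
proof (induction s arbitrary: t rule: measure_induct_rule[of size])
  case (less s)
  show ?case
  proof (cases s)
    case (Cst c)
    then show ?thesis using less by (cases t) (auto simp: mkAC_pair_FAC intro: ACCC.refl)
  next
    case (Fun h ss)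
    then obtain ts where t: "t = Fun h ts" "map flatten ss = map flatten ts"
      using less by (cases t) (auto simp: mkAC_pair_FAC)
    have len: "length ss = length ts" using t by (metis length_map)
    have "(ss ! i, ts ! i) \<in> ACCC \<Sigma> E" if "i < length ss" for i
    proof (rule less.IH)
      have "ss ! i \<in> set ss" using that by simp
      then show "size (ss ! i) < size s" using Fun by (auto simp: less_Suc_eq_le size_list_estimation')
      show "ss ! i \<in> terms \<Sigma>" "ts ! i \<in> terms \<Sigma>" using less Fun t that len
        by (auto simp: terms_iff)
      show "flatten (ss ! i) = flatten (ts ! i)" using t(2) that len by (metis nth_map)
    qed
    then show ?thesis using less Fun t len by (auto simp: terms_iff intro!: ACCC.cong_Fun)
  next
    case (AC f s1 s2)
    then obtain t1 t2 where t: "t = AC f t1 t2"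
      using less by (cases t) (auto simp: mkAC_pair_FAC)
    have f: "f \<in> ACsyms \<Sigma>" using less AC by (auto simp: terms_iff)
    have "mset (map flatten (fargs f s)) = mset (map flatten (fargs f t))"
      using less(4) by (metis ac_args_flatten)
    moreover have "list_all2 (\<lambda>x b. x = flatten b) (map flatten (fargs f t)) (fargs f t)"
      by (auto simp: list_all2_conv_all_nth)
    \<comment> \<open>\<open>bs\<close> is the argument list of \<open>t\<close>, reordered so that
      its flattenings match those of \<open>s\<close> position by position.\<close>
    ultimately obtain bs where bs: "list_all2 (\<lambda>x b. x = flatten b) (map flatten (fargs f s)) bs"
      "mset bs = mset (fargs f t)"
      using list_all2_reorder_left_invariance by metis
    have bst: "set bs \<subseteq> terms \<Sigma>" using bs(2) less(3) by (metis fargs_terms mset_eq_setD)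
    have "list_all2 (\<lambda>x y. (x, y) \<in> ACCC \<Sigma> E) (fargs f s) bs"
    proof (unfold list_all2_conv_all_nth, intro conjI allI impI)
      show l: "length (fargs f s) = length bs" using bs(1) by (auto dest: list_all2_lengthD)
      fix i assume i: "i < length (fargs f s)"
      show "(fargs f s ! i, bs ! i) \<in> ACCC \<Sigma> E"
      proof (rule less.IH)
        have "fargs f s ! i \<in> set (fargs f s)" using i by simp
        then show "size (fargs f s ! i) < size s" "fargs f s ! i \<in> terms \<Sigma>"
          using AC size_fargs[of "fargs f s ! i" f s1 s2] fargs_terms[OF less(2), of f] by auto
        show "bs ! i \<in> terms \<Sigma>" using bst i l by auto
        show "flatten (fargs f s ! i) = flatten (bs ! i)" using bs(1) i
          by (auto simp: list_all2_conv_all_nth)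
      qed
    qed
    then have "(comb f (fargs f s), comb f bs) \<in> ACCC \<Sigma> E"
      using f by (auto intro: ACCC_comb_cong)
    moreover have "(comb f bs, comb f (fargs f t)) \<in> ACCC \<Sigma> E"
    proof (rule ACCC_comb_perm[OF f _ bst bs(2)])
      show "bs \<noteq> []" using bs(2) by (metis fargs_nonempty mset_zero_iff)
    qed
    moreover have "(s, comb f (fargs f s)) \<in> ACCC \<Sigma> E" "(comb f (fargs f t), t) \<in> ACCC \<Sigma> E"
      using ACCC_comb_fargs[OF f less(2)] ACCC.sym[OF ACCC_comb_fargs[OF f less(3)]] by auto
    ultimately show ?thesis by (meson ACCC.trans)
  qed
qed

section \<open>The congruence on flattened terms\<close>

abbreviation fterms :: "('c, 'u, 'f) signature \<Rightarrow> ('c, 'u, 'f) fterm set" where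
  "fterms \<Sigma> \<equiv> flatten ` terms \<Sigma>"

lemma fterms_flat_ac: "x \<in> fterms \<Sigma> \<Longrightarrow> flat_ac x"
  by auto

lemma fterms_FCst_iff: "FCst c \<in> fterms \<Sigma> \<longleftrightarrow> c \<in> Consts \<Sigma>"
proof
  assume "FCst c \<in> fterms \<Sigma>"
  then obtain t where "t \<in> terms \<Sigma>" "flatten t = FCst c" by auto
  then show "c \<in> Consts \<Sigma>" by (cases t) (auto simp: terms_iff mkAC_pair_FAC)
qed (metis flatten.simps(1) imageI terms.Cst)

lemma fterms_FFun_iff:
  "FFun h xs \<in> fterms \<Sigma> \<longleftrightarrow> h \<in> Usyms \<Sigma> \<and> length xs = arity \<Sigma> h \<and> set xs \<subseteq> fterms \<Sigma>"
proof
  assume "FFun h xs \<in> fterms \<Sigma>"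
  then obtain t where "t \<in> terms \<Sigma>" "flatten t = FFun h xs" by auto
  then show "h \<in> Usyms \<Sigma> \<and> length xs = arity \<Sigma> h \<and> set xs \<subseteq> fterms \<Sigma>"
    by (cases t) (auto simp: terms_iff mkAC_pair_FAC)
next
  assume *: "h \<in> Usyms \<Sigma> \<and> length xs = arity \<Sigma> h \<and> set xs \<subseteq> fterms \<Sigma>"
  then have "xs \<in> lists (flatten ` terms \<Sigma>)" by auto
  then obtain ts where "xs = map flatten ts" "set ts \<subseteq> terms \<Sigma>"
    by (auto simp: lists_image)
  then show "FFun h xs \<in> fterms \<Sigma>" using *
    by (intro image_eqI[of _ _ "Fun h ts"]) (auto simp: terms_iff)
qed

lemma fterms_FAC:
  assumes "FAC f M \<in> fterms \<Sigma>"
  shows "f \<in> ACsyms \<Sigma> \<and> set_mset M \<subseteq> fterms \<Sigma> \<and> 2 \<le> size M \<and> (\<forall>y \<in># M. ac_args f y = {#y#})"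
proof -
  obtain t where t: "t \<in> terms \<Sigma>" "flatten t = FAC f M" using assms by auto
  then have f: "f \<in> ACsyms \<Sigma>" by (cases t) (auto simp: terms_iff mkAC_pair_FAC)
  have "M = mset (map flatten (fargs f t))" using t(2) ac_args_flatten[of f t] by simp
  then have "set_mset M \<subseteq> fterms \<Sigma>" using fargs_terms[OF t(1)] by auto
  then show ?thesis using f fterms_flat_ac[OF assms] by (auto simp: flat_ac_def)
qed

lemma fterms_mkAC_pair:
  "f \<in> ACsyms \<Sigma> \<Longrightarrow> x \<in> fterms \<Sigma> \<Longrightarrow> y \<in> fterms \<Sigma> \<Longrightarrow> mkAC f {#x, y#} \<in> fterms \<Sigma>"
  using flatten.simps(3)[of f, symmetric] by (auto intro!: imageI terms.AC simp del: flatten.simps(3))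

lemma mkAC_add:
  assumes "set_mset M \<subseteq> fterms \<Sigma>"
  shows "mkAC f (add_mset x M) = mkAC f {#x, mkAC f M#}"
proof -
  have "mkAC f (add_mset (mkAC f M) {#x#}) = mkAC f (M + {#x#})"
    using assms by (intro mkAC_add_mkAC) auto
  then show ?thesis by (simp add: add_mset_commute)
qed

lemma fterms_mkAC:
  "f \<in> ACsyms \<Sigma> \<Longrightarrow> M \<noteq> {#} \<Longrightarrow> set_mset M \<subseteq> fterms \<Sigma> \<Longrightarrow> mkAC f M \<in> fterms \<Sigma>"
proof (induction M)
  case (add x M)
  show ?case
  proof (cases "M = {#}")
    case True
    then show ?thesis using add by (auto simp: mkAC_single)
  next
    case False
    then show ?thesis using add by (auto simp: mkAC_add[of M \<Sigma>] intro!: fterms_mkAC_pair)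
  qed
qed simp

text \<open>Passing to flattened terms removes AC from the equational reasoning: there associativity
  and commutativity are plain equalities.\<close>

definition fcong ::
  "('c, 'u, 'f) signature \<Rightarrow> (('c, 'u, 'f) trm \<times> ('c, 'u, 'f) trm) set
    \<Rightarrow> (('c, 'u, 'f) fterm \<times> ('c, 'u, 'f) fterm) set" where
  "fcong \<Sigma> E = {(flatten s, flatten t) | s t. (s, t) \<in> ACCC \<Sigma> E}"

text \<open>A pair may be in \<open>fcong\<close> because of other preimages of the same flattened
  terms; by \<open>flatten_eq_ACCC\<close> these are congruent anyway.\<close>

lemma fcong_iff:
  assumes "s \<in> terms \<Sigma>" "t \<in> terms \<Sigma>"
  shows "(flatten s, flatten t) \<in> fcong \<Sigma> E \<longleftrightarrow> (s, t) \<in> ACCC \<Sigma> E"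
proof
  assume "(flatten s, flatten t) \<in> fcong \<Sigma> E"
  then obtain s' t' where "(s', t') \<in> ACCC \<Sigma> E" "flatten s = flatten s'" "flatten t = flatten t'"
    by (auto simp: fcong_def)
  then show "(s, t) \<in> ACCC \<Sigma> E" using assms
    by (metis ACCC.sym ACCC.trans ACCC_terms flatten_eq_ACCC)
qed (auto simp: fcong_def)

lemma ACCC_fcong: "ACCC \<Sigma> E = {(s, t). s \<in> terms \<Sigma> \<and> t \<in> terms \<Sigma> \<and> (flatten s, flatten t) \<in> fcong \<Sigma> E}"
proof (intro set_eqI, clarify)
  fix s t
  show "(s, t) \<in> ACCC \<Sigma> E \<longleftrightarrow>
    (s, t) \<in> {(s, t). s \<in> terms \<Sigma> \<and> t \<in> terms \<Sigma> \<and> (flatten s, flatten t) \<in> fcong \<Sigma> E}"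
    using fcong_iff[of s \<Sigma> t E] ACCC_terms[of s t \<Sigma> E] by auto
qed

lemma fcong_fterms: "(x, y) \<in> fcong \<Sigma> E \<Longrightarrow> x \<in> fterms \<Sigma> \<and> y \<in> fterms \<Sigma>"
  by (auto simp: fcong_def dest: ACCC_terms)

lemma fcong_refl: "x \<in> fterms \<Sigma> \<Longrightarrow> (x, x) \<in> fcong \<Sigma> E"
  by (auto simp: fcong_def intro: ACCC.refl)

lemma fcong_sym: "(x, y) \<in> fcong \<Sigma> E \<Longrightarrow> (y, x) \<in> fcong \<Sigma> E"
  by (auto simp: fcong_def intro: ACCC.sym)

lemma fcong_trans: "(x, y) \<in> fcong \<Sigma> E \<Longrightarrow> (y, z) \<in> fcong \<Sigma> E \<Longrightarrow> (x, z) \<in> fcong \<Sigma> E"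
proof -
  assume xy: "(x, y) \<in> fcong \<Sigma> E" and yz: "(y, z) \<in> fcong \<Sigma> E"
  obtain s t where s: "s \<in> terms \<Sigma>" "x = flatten s" and t: "t \<in> terms \<Sigma>" "y = flatten t"
    using fcong_fterms[OF xy] by auto
  obtain u where u: "u \<in> terms \<Sigma>" "z = flatten u"
    using fcong_fterms[OF yz] by auto
  have "(s, t) \<in> ACCC \<Sigma> E" "(t, u) \<in> ACCC \<Sigma> E" using xy yz s t u by (simp_all add: fcong_iff)
  then have "(s, u) \<in> ACCC \<Sigma> E" by (rule ACCC.trans)
  then show "(x, z) \<in> fcong \<Sigma> E" using s u by (simp add: fcong_iff)
qed

lemma fcong_FFun:
  assumes "h \<in> Usyms \<Sigma>" "length xs = arity \<Sigma> h" "list_all2 (\<lambda>x y. (x, y) \<in> fcong \<Sigma> E) xs ys"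
  shows "(FFun h xs, FFun h ys) \<in> fcong \<Sigma> E"
proof -
  have "\<exists>ss ts. list_all2 (\<lambda>s t. (s, t) \<in> ACCC \<Sigma> E) ss ts \<and> xs = map flatten ss \<and> ys = map flatten ts"
    using assms(3)
  proof (induction xs ys rule: list_all2_induct)
    case (Cons x xs y ys)
    then obtain ss ts where "list_all2 (\<lambda>s t. (s, t) \<in> ACCC \<Sigma> E) ss ts" "xs = map flatten ss" "ys = map flatten ts"
      by auto
    moreover obtain s t where "(s, t) \<in> ACCC \<Sigma> E" "x = flatten s" "y = flatten t"
      using Cons by (auto simp: fcong_def)
    ultimately show ?case by (intro exI[of _ "s # ss"] exI[of _ "t # ts"]) auto
  qed simp
  then obtain ss ts where st: "list_all2 (\<lambda>s t. (s, t) \<in> ACCC \<Sigma> E) ss ts" "xs = map flatten ss" "ys = map flatten ts"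
    by auto
  then have "(Fun h ss, Fun h ts) \<in> ACCC \<Sigma> E" using assms
    by (intro ACCC.cong_Fun) (auto simp: list_all2_conv_all_nth)
  then show ?thesis unfolding fcong_def using st by force
qed

lemma fcong_mkAC_pair:
  assumes "f \<in> ACsyms \<Sigma>" "(x, x') \<in> fcong \<Sigma> E" "(y, y') \<in> fcong \<Sigma> E"
  shows "(mkAC f {#x, y#}, mkAC f {#x', y'#}) \<in> fcong \<Sigma> E"
proof -
  obtain s s' t t' where "(s, s') \<in> ACCC \<Sigma> E" "(t, t') \<in> ACCC \<Sigma> E"
    "x = flatten s" "x' = flatten s'" "y = flatten t" "y' = flatten t'"
    using assms by (auto simp: fcong_def)
  moreover from this have "(AC f s t, AC f s' t') \<in> ACCC \<Sigma> E" using assms by (intro ACCC.cong_AC)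
  ultimately show ?thesis unfolding fcong_def by force
qed

lemma fcong_mkAC_add:
  assumes "f \<in> ACsyms \<Sigma>" "(x, x') \<in> fcong \<Sigma> E" "set_mset M \<subseteq> fterms \<Sigma>"
  shows "(mkAC f (add_mset x M), mkAC f (add_mset x' M)) \<in> fcong \<Sigma> E"
proof (cases "M = {#}")
  case True
  then show ?thesis using assms fcong_fterms[OF assms(2)] by (auto simp: mkAC_single)
next
  case False
  then show ?thesis unfolding mkAC_add[OF assms(3)]
    using assms fterms_mkAC by (intro fcong_mkAC_pair fcong_refl) auto
qed

text \<open>Lists are used because congruent argument multisets need a chosen matching of their
  elements.\<close>

lemma fcong_mkAC_list:
  assumes f: "f \<in> ACsyms \<Sigma>" and r: "list_all2 (\<lambda>x y. (x, y) \<in> fcong \<Sigma> E) xs ys" and ne: "xs \<noteq> []"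
  shows "(mkAC f (mset xs), mkAC f (mset ys)) \<in> fcong \<Sigma> E"
  using r ne
proof (induction xs ys rule: list_all2_induct)
  case (Cons x xs y ys)
  have "u \<in> fterms \<Sigma> \<and> v \<in> fterms \<Sigma>" if "(u, v) \<in> set (zip xs ys)" for u v
    using that Cons(2) fcong_fterms[of u v \<Sigma> E] by (auto simp: list_all2_iff)
  then have M: "set_mset (mset xs) \<subseteq> fterms \<Sigma>" and N: "set_mset (mset ys) \<subseteq> fterms \<Sigma>"
    using Cons(2) by (auto simp: list_all2_iff in_set_conv_nth set_zip) (metis nth_mem imageE)+
  show ?case
  proof (cases "xs = []")
    case True
    then have "ys = []" using Cons by simp
    then show ?thesis using True Cons fcong_fterms[OF Cons(1)] by (auto simp: mkAC_single)
  next
    case False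
    then show ?thesis using Cons f unfolding mset.simps mkAC_add[OF M] mkAC_add[OF N]
      by (intro fcong_mkAC_pair) auto
  qed
qed simp

text \<open>Inclusion of generated congruences is checked on the generators; pairs with a side
  outside the signature generate nothing.\<close>

lemma fcong_as_equations:
  assumes "\<And>x y. (x, y) \<in> X \<Longrightarrow> x \<in> fterms \<Sigma> \<Longrightarrow> y \<in> fterms \<Sigma> \<Longrightarrow> (x, y) \<in> fcong \<Sigma> E"
  shows "fcong \<Sigma> (as_equations X) \<subseteq> fcong \<Sigma> E"
proof -
  have "(s, t) \<in> ACCC \<Sigma> (as_equations X) \<Longrightarrow> (s, t) \<in> ACCC \<Sigma> E" for s t
  proof (induction rule: ACCC.induct)
    case (base s t)
    then show ?case using assms[of "flatten s" "flatten t"] fcong_iff[of s \<Sigma> t] by (auto simp: as_equations_def)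
  qed (auto intro: ACCC.intros)
  then show ?thesis by (auto simp: fcong_def)
qed

lemma fcong_base: "(x, y) \<in> X \<Longrightarrow> x \<in> fterms \<Sigma> \<Longrightarrow> y \<in> fterms \<Sigma> \<Longrightarrow> (x, y) \<in> fcong \<Sigma> (as_equations X)"
  by (auto simp: fcong_def as_equations_def intro: ACCC.base)

section \<open>Monomials and rewriting\<close>

lemma monom_single [simp]: "monom f {#c#} = FCst c"
  by (simp add: monom_def mkAC_mk)

lemma monom_mk: "monom f A = mk f (image_mset FCst A)"
  unfolding monom_def by (rule mkAC_trivial) auto

lemma monom_big: "size A \<noteq> 1 \<Longrightarrow> monom f A = FAC f (image_mset FCst A)"
  by (simp add: monom_mk mk_big)

lemma ac_args_monom: "ac_args f (monom f A) = image_mset FCst A"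
  unfolding monom_mk by (rule ac_args_mk) auto

lemma image_FCst_inject [simp]: "image_mset FCst A = image_mset FCst B \<longleftrightarrow> A = B"
  using multiset.inj_map[of FCst] by (auto simp: inj_def)

lemma monom_inject [simp]: "monom f A = monom f B \<longleftrightarrow> A = B"
  by (metis ac_args_monom image_FCst_inject)

lemma fterms_monom_iff:
  assumes "f \<in> ACsyms \<Sigma>"
  shows "monom f A \<in> fterms \<Sigma> \<longleftrightarrow> A \<in> monomials (Consts \<Sigma>)"
proof
  assume *: "monom f A \<in> fterms \<Sigma>"
  show "A \<in> monomials (Consts \<Sigma>)"
  proof (cases "size A = 1")
    case True
    then obtain c where "A = {#c#}" using size_1_singleton_mset by auto
    then show ?thesis using * by (auto simp: monomials_def fterms_FCst_iff)
  next
    case False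
    then have "FAC f (image_mset FCst A) \<in> fterms \<Sigma>" using * by (simp add: monom_big)
    from fterms_FAC[OF this] have "FCst ` set_mset A \<subseteq> fterms \<Sigma>" "2 \<le> size A" by auto
    then show ?thesis by (auto simp: monomials_def simp flip: fterms_FCst_iff)
  qed
next
  assume "A \<in> monomials (Consts \<Sigma>)"
  then show "monom f A \<in> fterms \<Sigma>" unfolding monom_def using assms
    by (intro fterms_mkAC) (auto simp: monomials_def fterms_FCst_iff)
qed

lemma monom_plus: "B \<noteq> {#} \<Longrightarrow> A \<noteq> {#} \<Longrightarrow> monom f (A + B) = mkAC f {#monom f A, monom f B#}"
  by (simp add: mkAC_mk ac_args_monom) (simp add: monom_mk)

text \<open>Rules with an AC root are forced to be monomial rules, since inside a larger
  \<open>f\<close>-term only \<open>rew.ac\<close> can apply them. This is what makes rewriting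
  closed under \<open>f\<close>-contexts (\<open>rew_mkAC_context\<close>).\<close>

definition flat_rules ::
  "('c, 'u, 'f) signature \<Rightarrow> (('c, 'u, 'f) fterm \<times> ('c, 'u, 'f) fterm) set \<Rightarrow> bool" where
  "flat_rules \<Sigma> R \<longleftrightarrow> (\<forall>(l, r) \<in> R. l \<in> fterms \<Sigma> \<and> r \<in> fterms \<Sigma> \<and>
     (\<forall>f M. l = FAC f M \<longrightarrow> (\<exists>A B. l = monom f A \<and> r = monom f B)))"

lemma flat_rules_D:
  assumes "flat_rules \<Sigma> R" "(l, r) \<in> R"
  shows "l \<in> fterms \<Sigma>" "r \<in> fterms \<Sigma>"
  using assms by (auto simp: flat_rules_def)

lemma monom_nonempty: "monom f A \<in> fterms \<Sigma> \<Longrightarrow> A \<noteq> {#}"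
proof
  assume "monom f A \<in> fterms \<Sigma>" "A = {#}"
  then show False using fterms_FAC[of f "{#}" \<Sigma>] by (simp add: monom_big)
qed

lemma rew_fcong:
  assumes "rew R x y" "flat_rules \<Sigma> R" "x \<in> fterms \<Sigma>"
  shows "(x, y) \<in> fcong \<Sigma> (as_equations R)"
  using assms
proof (induction rule: rew.induct)
  case (root l r)
  then show ?case by (auto intro: fcong_base simp: flat_rules_def)
next
  case (ac f A B M)
  note M = fterms_FAC[OF ac(4)]
  have AB: "monom f A \<in> fterms \<Sigma>" "monom f B \<in> fterms \<Sigma>" using flat_rules_D[OF ac(3,1)] .
  note ne = AB[THEN monom_nonempty]
  have flA: "flat_ac y" if "y \<in># image_mset FCst A" for y using that by auto
  have flB: "flat_ac y" if "y \<in># image_mset FCst B" for y using that by auto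
  \<comment> \<open>\<open>f(A)\<close> is treated as one argument next to \<open>M0\<close>.
    Replacing it by \<open>f(B)\<close> is an ordinary congruence step, and flattening turns its two
    sides into those of the rewrite step.\<close>
  define M0 where "M0 = M - image_mset FCst A"
  have MA: "M = image_mset FCst A + M0" using ac(2) by (simp add: M0_def)
  have "(mkAC f (add_mset (monom f A) M0), mkAC f (add_mset (monom f B) M0)) \<in> fcong \<Sigma> (as_equations R)"
    using M MA ac(1) AB by (intro fcong_mkAC_add fcong_base) auto
  also have "mkAC f (add_mset (monom f A) M0) = mkAC f M"
    unfolding monom_def MA by (rule mkAC_add_mkAC) (rule flA)
  also have "\<dots> = FAC f M"
    using M by (subst mkAC_trivial) (auto simp: mk_big)
  also have "mkAC f (add_mset (monom f B) M0) = mkAC f (M0 + image_mset FCst B)"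
    unfolding monom_def by (subst mkAC_add_mkAC) (auto simp: add.commute)
  finally show ?case by (simp add: M0_def)
next
  case (fun_arg s t h us vs)
  have *: "h \<in> Usyms \<Sigma>" "length (us @ s # vs) = arity \<Sigma> h" "set (us @ s # vs) \<subseteq> fterms \<Sigma>"
    using fun_arg(4) unfolding fterms_FFun_iff by auto
  show ?case
  proof (rule fcong_FFun)
    have "list_all2 (\<lambda>x y. (x, y) \<in> fcong \<Sigma> (as_equations R)) us us"
      "list_all2 (\<lambda>x y. (x, y) \<in> fcong \<Sigma> (as_equations R)) vs vs"
      using *(3) by (auto simp: list_all2_same intro: fcong_refl)
    then show "list_all2 (\<lambda>x y. (x, y) \<in> fcong \<Sigma> (as_equations R)) (us @ s # vs) (us @ t # vs)"
      using * fun_arg by (intro list_all2_appendI) auto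
  qed (use * in auto)
next
  case (ac_arg s t f M)
  note M = fterms_FAC[OF ac_arg(4)]
  have "(mkAC f (add_mset s M), mkAC f (add_mset t M)) \<in> fcong \<Sigma> (as_equations R)"
    using M ac_arg by (intro fcong_mkAC_add) auto
  moreover have "mkAC f (add_mset s M) = FAC f (add_mset s M)"
  proof -
    have "size (add_mset s M) \<noteq> 1" using M by auto
    then show ?thesis using M mkAC_trivial[of "add_mset s M" f] mk_big[of "add_mset s M" f] by metis
  qed
  ultimately show ?case by simp
qed

lemma rew_fterms:
  assumes "rew R x y" "flat_rules \<Sigma> R" "x \<in> fterms \<Sigma>"
  shows "y \<in> fterms \<Sigma>"
  using rew_fcong[OF assms] fcong_fterms by blast

lemma mkAC_trailing_args:
  assumes "flat_ac y" "\<And>z. z \<in># X \<Longrightarrow> flat_ac z"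
  shows "mkAC f (X + ac_args f y) = mkAC f {#mkAC f X, y#}"
proof -
  have "\<Sum>\<^sub># (image_mset (ac_args f) (ac_args f y)) = ac_args f y"
    using ac_args_ac_args[OF assms(1)] by (intro sum_ac_args_trivial)
  then show ?thesis using assms by (simp add: mkAC_mk[of f "_ + _"] mkAC_mk[of f "{#_, _#}"] ac_args_mkAC)
qed

text \<open>If \<open>x\<close> is headed by \<open>f\<close>, the context dissolves it and the
  position of the step is lost. A step at the root of \<open>x\<close> or by \<open>rew.ac\<close>
  then becomes a \<open>rew.ac\<close> step on the joint argument multiset, and an argument step
  stays one.\<close>

lemma rew_mkAC_context:
  assumes "rew R x x'" "flat_rules \<Sigma> R" "x \<in> fterms \<Sigma>" "y \<in> fterms \<Sigma>"
  shows "rew R (mkAC f {#x, y#}) (mkAC f {#x', y#})"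
proof -
  have x': "x' \<in> fterms \<Sigma>" using rew_fterms assms by blast
  have fx: "flat_ac x" and fy: "flat_ac y" and fx': "flat_ac x'" using assms x' fterms_flat_ac by blast+
  have eq: "mkAC f {#x, y#} = FAC f (ac_args f x + ac_args f y)"
    using fx fy by (rule mkAC_pair_FAC)
  have sumy: "\<Sum>\<^sub># (image_mset (ac_args f) (ac_args f y)) = ac_args f y"
    using ac_args_ac_args[OF fy] by (intro sum_ac_args_trivial)
  show ?thesis
  proof (cases "\<exists>M. x = FAC f M")
    case False
    then have a: "ac_args f x = {#x#}" by (cases x) auto
    have "rew R (FAC f (add_mset x (ac_args f y))) (mkAC f (add_mset x' (ac_args f y)))"
      using assms by (intro rew.ac_arg)
    also have "mkAC f (add_mset x' (ac_args f y)) = mkAC f {#x', y#}"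
      using sumy by (simp add: mkAC_mk)
    finally show ?thesis using eq a by simp
  next
    case True
    then obtain M where M: "x = FAC f M" by auto
    note MM = fterms_FAC[OF assms(3)[unfolded M]]
    have flatM: "z \<in># M \<Longrightarrow> flat_ac z" for z using MM fterms_flat_ac by blast
    \<comment> \<open>Serves both the root case, with all of \<open>M\<close> as redex, and the
      \<open>rew.ac\<close> case.\<close>
    have acstep: "rew R (FAC f (M + ac_args f y)) (mkAC f {#mkAC f (M - image_mset FCst A + image_mset FCst B), y#})"
      if AB: "(monom f A, monom f B) \<in> R" "image_mset FCst A \<subseteq># M" for A B
    proof -
      have "rew R (FAC f (M + ac_args f y)) (mkAC f (M + ac_args f y - image_mset FCst A + image_mset FCst B))"
        using AB by (intro rew.ac) (auto simp: subset_mset.add_increasing2)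
      also have "M + ac_args f y - image_mset FCst A + image_mset FCst B
          = (M - image_mset FCst A + image_mset FCst B) + ac_args f y"
        using AB(2) by (auto simp: mset_subset_eq_exists_conv ac_simps)
      also have "mkAC f \<dots> = mkAC f {#mkAC f (M - image_mset FCst A + image_mset FCst B), y#}"
        using fy flatM by (intro mkAC_trailing_args) (auto dest: in_diffD)
      finally show ?thesis .
    qed
    from assms(1) show ?thesis
    proof cases
      case root
      then obtain A B where AB: "x = monom f A" "x' = monom f B" using assms(2) M
        unfolding flat_rules_def by fastforce
      then have M2: "M = image_mset FCst A" using M ac_args_monom[of f A] by (metis ac_args.simps(1))
      show ?thesis using acstep[of A B] AB root M2 M eq by (simp add: monom_def[of f B] ac_args_monom)
    next
      case (ac g A B N)
      then show ?thesis using acstep[of A B] M eq by simp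
    next
      case (fun_arg s t h us vs)
      then show ?thesis using M by simp
    next
      case (ac_arg s t g N)
      have st: "rew R s t" "M = add_mset s N" "g = f" using ac_arg M by auto
      have t: "t \<in> fterms \<Sigma>" using rew_fterms[OF st(1) assms(2)] MM st by auto
      have "rew R (FAC f (add_mset s (N + ac_args f y))) (mkAC f (add_mset t (N + ac_args f y)))"
        using st by (intro rew.ac_arg)
      also have "mkAC f (add_mset t (N + ac_args f y)) = mkAC f {#mkAC f (add_mset t N), y#}"
        using mkAC_trailing_args[OF fy, of "add_mset t N" f] flatM st t fterms_flat_ac by fastforce
      finally show ?thesis using M st ac_arg eq by simp
    qed
  qed
qed

section \<open>Many-step rewriting and the Church-Rosser property\<close>

lemma rew_on_steps_fcong:
  assumes "(rew_on \<Sigma> R)\<^sup>*\<^sup>* x y" "flat_rules \<Sigma> R" "x \<in> fterms \<Sigma>"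
  shows "(x, y) \<in> fcong \<Sigma> (as_equations R)"
  using assms(1)
proof (induction rule: rtranclp_induct)
  case base
  then show ?case using assms fcong_refl by blast
next
  case (step y z)
  then show ?case using rew_fcong[of R y z \<Sigma>] assms(2) fcong_trans by (metis rew_on_def)
qed

lemma rew_on_steps_fterms:
  assumes "(rew_on \<Sigma> R)\<^sup>*\<^sup>* x y" "flat_rules \<Sigma> R" "x \<in> fterms \<Sigma>"
  shows "y \<in> fterms \<Sigma>"
  using rew_on_steps_fcong[OF assms] fcong_fterms by blast

lemma rew_on_steps_mkAC:
  assumes "(rew_on \<Sigma> R)\<^sup>*\<^sup>* x x'" "flat_rules \<Sigma> R" "x \<in> fterms \<Sigma>" "y \<in> fterms \<Sigma>" "f \<in> ACsyms \<Sigma>"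
  shows "(rew_on \<Sigma> R)\<^sup>*\<^sup>* (mkAC f {#x, y#}) (mkAC f {#x', y#})"
  using assms(1)
proof (induction rule: rtranclp_induct)
  case (step u v)
  have "u \<in> fterms \<Sigma>" "rew R u v" using step(2) by (auto simp: rew_on_def)
  then have "rew_on \<Sigma> R (mkAC f {#u, y#}) (mkAC f {#v, y#})"
    using rew_mkAC_context assms fterms_mkAC_pair by (metis rew_on_def)
  then show ?case using step by simp
qed simp

lemma rew_on_steps_mkAC2:
  assumes "(rew_on \<Sigma> R)\<^sup>*\<^sup>* x x'" "(rew_on \<Sigma> R)\<^sup>*\<^sup>* y y'"
    and "flat_rules \<Sigma> R" "x \<in> fterms \<Sigma>" "y \<in> fterms \<Sigma>" "f \<in> ACsyms \<Sigma>"
  shows "(rew_on \<Sigma> R)\<^sup>*\<^sup>* (mkAC f {#x, y#}) (mkAC f {#x', y'#})"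
proof -
  have "x' \<in> fterms \<Sigma>" using assms rew_on_steps_fterms by blast
  then have "(rew_on \<Sigma> R)\<^sup>*\<^sup>* (mkAC f {#y, x'#}) (mkAC f {#y', x'#})"
    using assms by (intro rew_on_steps_mkAC)
  moreover have "(rew_on \<Sigma> R)\<^sup>*\<^sup>* (mkAC f {#x, y#}) (mkAC f {#x', y#})"
    using assms by (intro rew_on_steps_mkAC)
  ultimately show ?thesis by (simp add: add_mset_commute)
qed

lemma rew_on_steps_FFun:
  assumes "list_all2 (rew_on \<Sigma> R)\<^sup>*\<^sup>* xs ys" "flat_rules \<Sigma> R" "FFun h (us @ xs) \<in> fterms \<Sigma>"
  shows "(rew_on \<Sigma> R)\<^sup>*\<^sup>* (FFun h (us @ xs)) (FFun h (us @ ys))"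
  using assms(1,3)
proof (induction xs ys arbitrary: us rule: list_all2_induct)
  case (Cons x xs y ys)
  have "(rew_on \<Sigma> R)\<^sup>*\<^sup>* (FFun h (us @ x # xs)) (FFun h (us @ y # xs))"
    using Cons(1)
  proof (induction rule: rtranclp_induct)
    case (step u v)
    have "FFun h (us @ u # xs) \<in> fterms \<Sigma>"
      using Cons(4) step(2) unfolding fterms_FFun_iff rew_on_def by auto
    then have "rew_on \<Sigma> R (FFun h (us @ u # xs)) (FFun h (us @ v # xs))"
      using step(2) by (auto simp: rew_on_def intro: rew.fun_arg)
    then show ?case using step by simp
  qed simp
  moreover have "(rew_on \<Sigma> R)\<^sup>*\<^sup>* (FFun h ((us @ [y]) @ xs)) (FFun h ((us @ [y]) @ ys))"
  proof (rule Cons.IH)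
    show "FFun h ((us @ [y]) @ xs) \<in> fterms \<Sigma>"
      using Cons rew_on_steps_fterms[OF Cons(1) assms(2)] unfolding fterms_FFun_iff by auto
  qed
  ultimately show ?case by simp
qed simp

text \<open>The AC axioms hold as equalities of flattened terms, the congruence rules follow from
  closure of rewriting under contexts, and confluence enters in the transitivity case only.\<close>

lemma fcong_joinable:
  assumes R: "flat_rules \<Sigma> R" and conf: "confluentp (rew_on \<Sigma> R)" and xy: "(x, y) \<in> fcong \<Sigma> (as_equations R)"
  shows "\<exists>z. (rew_on \<Sigma> R)\<^sup>*\<^sup>* x z \<and> (rew_on \<Sigma> R)\<^sup>*\<^sup>* y z"
proof -
  let ?S = "(rew_on \<Sigma> R)\<^sup>*\<^sup>*"
  have "\<exists>z. ?S (flatten s) z \<and> ?S (flatten t) z" if "(s, t) \<in> ACCC \<Sigma> (as_equations R)" for s t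
    using that
  proof (induction rule: ACCC.induct)
    case (base s t)
    then have "rew_on \<Sigma> R (flatten s) (flatten t)" by (auto simp: as_equations_def rew_on_def intro: rew.root)
    then show ?case by blast
  next
    case (assoc f s t u)
    have "flatten (AC f (AC f s t) u) = flatten (AC f s (AC f t u))"
      by (simp add: flatten_AC ac_simps del: flatten.simps(3))
    then show ?case by (metis rtranclp.rtrancl_refl)
  next
    case (comm f s t)
    have "flatten (AC f s t) = flatten (AC f t s)"
      by (simp add: flatten_AC ac_simps del: flatten.simps(3))
    then show ?case by (metis rtranclp.rtrancl_refl)
  next
    case (trans s t u)
    then obtain z z' where z: "?S (flatten s) z" "?S (flatten t) z" "?S (flatten t) z'" "?S (flatten u) z'" by auto
    then obtain w where "?S z w" "?S z' w" using confluentpD[OF conf] by blast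
    then show ?case using z by (meson rtranclp_trans)
  next
    case (cong_Fun h ss ts)
    then obtain z where z: "\<And>i. i < arity \<Sigma> h \<Longrightarrow> ?S (flatten (ss ! i)) (z i) \<and> ?S (flatten (ts ! i)) (z i)"
      by metis
    let ?zs = "map z [0..<arity \<Sigma> h]"
    have t: "ss ! i \<in> terms \<Sigma> \<and> ts ! i \<in> terms \<Sigma>" if "i < arity \<Sigma> h" for i
      using cong_Fun(4) that ACCC_terms by blast
    have st: "Fun h ss \<in> terms \<Sigma>" "Fun h ts \<in> terms \<Sigma>"
      using cong_Fun t by (auto simp: terms_iff in_set_conv_nth)
    have "?S (FFun h ([] @ map flatten ss)) (FFun h ([] @ ?zs))"
      using z cong_Fun imageI[OF st(1), of flatten] by (intro rew_on_steps_FFun[OF _ R]) (auto simp: list_all2_conv_all_nth)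
    moreover have "?S (FFun h ([] @ map flatten ts)) (FFun h ([] @ ?zs))"
      using z cong_Fun imageI[OF st(2), of flatten] by (intro rew_on_steps_FFun[OF _ R]) (auto simp: list_all2_conv_all_nth)
    ultimately show ?case by auto
  next
    case (cong_AC f s s' t t')
    then obtain z w where "?S (flatten s) z" "?S (flatten s') z" "?S (flatten t) w" "?S (flatten t') w" by auto
    then show ?case using cong_AC R ACCC_terms
      by (intro exI[of _ "mkAC f {#z, w#}"]) (auto intro!: rew_on_steps_mkAC2 imageI dest: ACCC_terms)
  qed blast+
  then show ?thesis using xy by (auto simp: fcong_def)
qed

section \<open>Dickson's lemma\<close>

text \<open>Repeatedly take a position where the minimum of the remaining tail is attained.\<close>

lemma nat_seq_mono_subseq:
  fixes s :: "nat \<Rightarrow> nat"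
  shows "\<exists>r :: nat \<Rightarrow> nat. strict_mono r \<and> (\<forall>i j. i \<le> j \<longrightarrow> s (r i) \<le> s (r j))"
proof -
  have ex: "\<exists>m \<ge> n. \<forall>k \<ge> n. s m \<le> s k" for n
    using ex_has_least_nat[of "\<lambda>m. n \<le> m" n s] by auto
  define g where "g n = (SOME m. m \<ge> n \<and> (\<forall>k \<ge> n. s m \<le> s k))" for n
  have g: "g n \<ge> n \<and> (\<forall>k \<ge> n. s (g n) \<le> s k)" for n
    unfolding g_def by (rule someI_ex) (use ex in blast)
  define r where "r = rec_nat (g 0) (\<lambda>_ x. g (Suc x))"
  have r: "r (Suc i) = g (Suc (r i))" for i by (simp add: r_def)
  have lt: "r i < r (Suc i)" for i using g[of "Suc (r i)"] r by simp
  then have mono: "strict_mono r" by (simp add: strict_mono_Suc_iff)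
  \<comment> \<open>Each chosen position minimizes \<open>s\<close> on a tail that contains it, so
    no later value is smaller.\<close>
  have "\<exists>n \<le> r i. r i = g n" for i
    using g[of 0] g r by (cases i) (auto simp: r_def)
  then have "s (r i) \<le> s k" if "r i \<le> k" for i k
    using g that by (metis order_trans)
  then show ?thesis using mono by (intro exI[of _ r]) (auto simp: strict_mono_less_eq)
qed

text \<open>One constant at a time: a subsequence along which the counts of \<open>C\<close> are
  monotone is thinned out until the count of \<open>x\<close> is monotone as well.\<close>

lemma dickson_subseq:
  fixes s :: "nat \<Rightarrow> 'c multiset"
  assumes "finite C"
  shows "\<exists>r :: nat \<Rightarrow> nat. strict_mono r \<and> (\<forall>c \<in> C. \<forall>i j. i \<le> j \<longrightarrow> count (s (r i)) c \<le> count (s (r j)) c)"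
  using assms
proof (induction C)
  case empty
  show ?case by (intro exI[of _ id]) (auto simp: strict_mono_def)
next
  case (insert x C)
  then obtain r :: "nat \<Rightarrow> nat" where r: "strict_mono r" "\<forall>c \<in> C. \<forall>i j. i \<le> j \<longrightarrow> count (s (r i)) c \<le> count (s (r j)) c" by auto
  obtain q :: "nat \<Rightarrow> nat" where q: "strict_mono q" "\<forall>i j. i \<le> j \<longrightarrow> count (s (r (q i))) x \<le> count (s (r (q j))) x"
    using nat_seq_mono_subseq[of "\<lambda>i. count (s (r i)) x"] by auto
  have "strict_mono (\<lambda>i. r (q i))" using r(1) q(1) by (simp add: strict_mono_def)
  then show ?case using r q by (intro exI[of _ "\<lambda>i. r (q i)"]) (auto simp: strict_mono_less_eq)
qed

lemma dickson:
  fixes s :: "nat \<Rightarrow> 'c multiset"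
  assumes "finite C" "\<And>i. set_mset (s i) \<subseteq> C"
  shows "\<exists>i j. i < j \<and> s i \<subseteq># s j"
proof -
  obtain r :: "nat \<Rightarrow> nat" where r: "strict_mono r" "\<forall>c \<in> C. \<forall>i j. i \<le> j \<longrightarrow> count (s (r i)) c \<le> count (s (r j)) c"
    using dickson_subseq[OF assms(1)] by blast
  have "s (r 0) \<subseteq># s (r 1)"
  proof (rule mset_subset_eqI)
    fix c show "count (s (r 0)) c \<le> count (s (r 1)) c"
    proof (cases "c \<in> C")
      case False
      then have "c \<notin># s (r 0)" using assms(2) by blast
      then show ?thesis by (simp add: not_in_iff)
    qed (use r(2) in auto)
  qed
  moreover have "r 0 < r 1" using r(1) by (simp add: strict_mono_def)
  ultimately show ?thesis by blast
qed

section \<open>Completion for one AC symbol\<close>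

text \<open>The monomial ideal generated by the left sides, cut down to \<open>C\<close> so that
  Dickson's lemma applies when \<open>C\<close> is finite.\<close>

definition covered :: "'c set \<Rightarrow> 'c mrules \<Rightarrow> 'c multiset set" where
  "covered C R = {M. set_mset M \<subseteq> C \<and> (\<exists>(A, B) \<in> R. A \<subseteq># M)}"

text \<open>The ascending chain condition. If step \<open>i\<close> adds a monomial
  \<open>s i\<close>, Dickson's lemma gives \<open>i < j\<close> with \<open>s i\<close> inside
  \<open>s j\<close>, so \<open>s j\<close> was covered before it was added.\<close>

lemma wf_covered: "finite C \<Longrightarrow> wf {(R', R). covered C R \<subset> covered C R'}"
proof (rule ccontr)
  assume C: "finite C" and "\<not> wf {(R', R). covered C R \<subset> covered C R'}"
  then obtain R where R: "\<And>i. covered C (R i) \<subset> covered C (R (Suc i))"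
    unfolding wf_iff_no_infinite_down_chain by auto
  then have "\<exists>M. M \<in> covered C (R (Suc i)) - covered C (R i)" for i by blast
  then obtain s where s: "\<And>i. s i \<in> covered C (R (Suc i)) - covered C (R i)" by metis
  have mono: "i \<le> j \<Longrightarrow> covered C (R i) \<subseteq> covered C (R j)" for i j
    using R lift_Suc_mono_le[of "\<lambda>i. covered C (R i)" i j] by blast
  have sC: "set_mset (s i) \<subseteq> C" for i using s[of i] by (simp add: covered_def)
  obtain i j where ij: "i < j" "s i \<subseteq># s j" using dickson[OF C, of s] sC by blast
  have "s i \<in> covered C (R j)" using s[of i] mono[of "Suc i" j] ij by auto
  then have "s j \<in> covered C (R j)" using ij(2) sC[of j] subset_mset.order_trans
    unfolding covered_def by blast
  then show False using s[of j] by blast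
qed

definition oriented :: "'c set \<Rightarrow> ('c multiset \<Rightarrow> 'c multiset \<Rightarrow> bool) \<Rightarrow> 'c mrules \<Rightarrow> bool" where
  "oriented C gt R \<longleftrightarrow> (\<forall>(A, B) \<in> R. A \<in> monomials C \<and> B \<in> monomials C \<and> gt A B)"

text \<open>Also makes the rules a function of their left sides.\<close>

definition left_reduced :: "'c mrules \<Rightarrow> bool" where
  "left_reduced R \<longleftrightarrow> (\<forall>(A, B) \<in> R. \<forall>(A', B') \<in> R. A' \<subseteq># A \<longrightarrow> A' = A \<and> B' = B)"

definition right_reduced :: "'c mrules \<Rightarrow> bool" where
  "right_reduced R \<longleftrightarrow> (\<forall>(A, B) \<in> R. \<forall>(A', B') \<in> R. \<not> A' \<subseteq># B)"

definition estep :: "'c set \<Rightarrow> 'c mrules \<Rightarrow> 'c mrules" where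
  "estep C X = {(P + D, Q + D) | P Q D. ((P, Q) \<in> X \<or> (Q, P) \<in> X) \<and> set_mset D \<subseteq> C}"

text \<open>Connectedness below \<open>M\<close> in the sense of Winkler and Buchberger: all
  monomials of the chain of equational steps are smaller than \<open>M\<close>. The empty chain
  carries no bound.\<close>

definition conn ::
  "'c set \<Rightarrow> ('c multiset \<Rightarrow> 'c multiset \<Rightarrow> bool) \<Rightarrow> 'c mrules \<Rightarrow> 'c multiset \<Rightarrow> 'c mrules" where
  "conn C gt X M = {(U, V). (U, V) \<in> estep C X \<and> gt M U \<and> gt M V}\<^sup>*"

text \<open>The bound \<open>A1 + (B1 - A1)\<close> is the least common multiple of the left sides,
  the top of the peak. All pairs are included, also those with disjoint left sides. \<open>X\<close>
  will be the rules together with the pending equations, so a rule that is turned back into an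
  equation still counts.\<close>

definition peaks ::
  "'c set \<Rightarrow> ('c multiset \<Rightarrow> 'c multiset \<Rightarrow> bool) \<Rightarrow> 'c mrules \<Rightarrow> 'c mrules \<Rightarrow> bool" where
  "peaks C gt X R \<longleftrightarrow> (\<forall>(A1, A2) \<in> R. \<forall>(B1, B2) \<in> R.
     critical_pair (A1, A2) (B1, B2) \<in> conn C gt X (A1 + (B1 - A1)))"

text \<open>The replacement of an equation has to respect every bound \<open>M\<close>, which is
  more than equational consequence; only then does connectedness below \<open>M\<close> carry over
  from \<open>X\<close> to \<open>X'\<close>.\<close>

definition simulates ::
  "'c set \<Rightarrow> ('c multiset \<Rightarrow> 'c multiset \<Rightarrow> bool) \<Rightarrow> 'c mrules \<Rightarrow> 'c mrules \<Rightarrow> bool" where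
  "simulates C gt X' X \<longleftrightarrow> (\<forall>(P, Q) \<in> X. \<forall>D. \<forall>M \<in> monomials C. set_mset D \<subseteq> C \<longrightarrow>
     gt M (P + D) \<longrightarrow> gt M (Q + D) \<longrightarrow> (P + D, Q + D) \<in> conn C gt X' M)"

text \<open>Test objects: two systems of equations between monomials over \<open>C\<close> that are
  contained in the same congruences have the same consequences.\<close>

definition mcongr :: "'c set \<Rightarrow> 'c mrules \<Rightarrow> bool" where
  "mcongr C r \<longleftrightarrow> (\<forall>A \<in> monomials C. (A, A) \<in> r) \<and> sym r \<and> trans r \<and>
     (\<forall>A \<in> monomials C. \<forall>B \<in> monomials C. \<forall>D. (A, B) \<in> r \<longrightarrow> set_mset D \<subseteq> C \<longrightarrow> (A + D, B + D) \<in> r)"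

definition completion_inv ::
  "'c set \<Rightarrow> ('c multiset \<Rightarrow> 'c multiset \<Rightarrow> bool) \<Rightarrow> 'c mrules \<Rightarrow> 'c mrules \<Rightarrow> bool" where
  "completion_inv C gt R T \<longleftrightarrow> finite R \<and> finite T \<and> oriented C gt R \<and> T \<subseteq> monomials C \<times> monomials C \<and>
     left_reduced R \<and> right_reduced R \<and> peaks C gt (R \<union> T) R"

lemma critical_pair_eq: "critical_pair (A1, A2) (B1, B2) = ((B1 - A1) + A2, (A1 - B1) + B2)"
proof -
  have "A1 + B1 - A1 \<inter># B1 - A1 = B1 - A1" "A1 + B1 - A1 \<inter># B1 - B1 = A1 - B1"
    by (auto intro!: multiset_eqI)
  then show ?thesis by (simp add: Let_def)
qed

lemma lcm_commute: "(A::'a multiset) + (B - A) = B + (A - B)"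
  by (auto intro!: multiset_eqI)

lemma monomials_add: "A \<in> monomials C \<Longrightarrow> set_mset D \<subseteq> C \<Longrightarrow> A + D \<in> monomials C"
  by (auto simp: monomials_def)

lemma monomials_add2: "A \<in> monomials C \<Longrightarrow> set_mset D \<subseteq> C \<Longrightarrow> D + A \<in> monomials C"
  by (auto simp: monomials_def)

lemma monomials_diff: "A \<in> monomials C \<Longrightarrow> set_mset (A - B) \<subseteq> C"
  by (auto simp: monomials_def dest: in_diffD)

lemma monomials_mono: "D \<subseteq> C \<Longrightarrow> A \<in> monomials D \<Longrightarrow> A \<in> monomials C"
  by (auto simp: monomials_def)

lemma conn_refl [simp]: "(U, U) \<in> conn C gt X M"
  by (simp add: conn_def)

lemma conn_trans: "(U, V) \<in> conn C gt X M \<Longrightarrow> (V, W) \<in> conn C gt X M \<Longrightarrow> (U, W) \<in> conn C gt X M"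
  by (auto simp: conn_def)

lemma conn_sym: "(U, V) \<in> conn C gt X M \<Longrightarrow> (V, U) \<in> conn C gt X M"
proof -
  have "sym {(U, V). (U, V) \<in> estep C X \<and> gt M U \<and> gt M V}"
    unfolding sym_def estep_def by blast
  then show "(U, V) \<in> conn C gt X M \<Longrightarrow> (V, U) \<in> conn C gt X M"
    unfolding conn_def by (meson sym_rtrancl symD)
qed

lemma estep_mono: "X \<subseteq> Y \<Longrightarrow> D \<subseteq> C \<Longrightarrow> estep D X \<subseteq> estep C Y"
  unfolding estep_def by blast

lemma conn_mono: "X \<subseteq> Y \<Longrightarrow> D \<subseteq> C \<Longrightarrow> conn D gt X M \<subseteq> conn C gt Y M"
  unfolding conn_def by (rule rtrancl_mono) (use estep_mono in blast)

lemma conn_step: "(P, Q) \<in> X \<Longrightarrow> set_mset D \<subseteq> C \<Longrightarrow> gt M (P + D) \<Longrightarrow> gt M (Q + D)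
    \<Longrightarrow> (P + D, Q + D) \<in> conn C gt X M"
  unfolding conn_def estep_def by blast

section \<open>Changing the set of constants\<close>

lemma peaks_mono: "X \<subseteq> Y \<Longrightarrow> D \<subseteq> C \<Longrightarrow> peaks D gt X R \<Longrightarrow> peaks C gt Y R"
  unfolding peaks_def using conn_mono[of X Y D C gt] by blast

lemma oriented_mono: "D \<subseteq> C \<Longrightarrow> oriented D gt R \<Longrightarrow> oriented C gt R"
  unfolding oriented_def using monomials_mono by blast

lemma completion_inv_mono: "D \<subseteq> C \<Longrightarrow> completion_inv D gt R {} \<Longrightarrow> completion_inv C gt R {}"
  unfolding completion_inv_def using oriented_mono peaks_mono[of R R D C gt R] by auto

lemma mcongr_anti: "D \<subseteq> C \<Longrightarrow> mcongr C r \<Longrightarrow> mcongr D r"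
  unfolding mcongr_def by (meson monomials_mono order_trans)

text \<open>After constants have been merged, completion runs over the canonical ones alone.\<close>

lemma admissible_anti: "D \<subseteq> C \<Longrightarrow> admissible C gtC gt \<Longrightarrow> admissible D gtC gt"
proof -
  assume D: "D \<subseteq> C" and a: "admissible C gtC gt"
  have m: "monomials D \<subseteq> monomials C" using D by (auto simp: monomials_def)
  show "admissible D gtC gt"
    unfolding admissible_def strict_total_on_def
  proof (intro conjI ballI allI impI)
    show "irreflp_on (monomials D) gt" "transp_on (monomials D) gt" "totalp_on (monomials D) gt"
      using a m unfolding admissible_def strict_total_on_def
      by (meson irreflp_on_subset transp_on_subset totalp_on_subset)+
    show "wfp_on (monomials D) (\<lambda>A B. gt B A)"
      using a m wfp_on_subset unfolding admissible_def by blast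
  qed (use a m D in \<open>unfold admissible_def, blast+\<close>)
qed

lemma normalizer_anti: "D \<subseteq> C \<Longrightarrow> normalizer C gt nf \<Longrightarrow> normalizer D gt nf"
proof (unfold normalizer_def, intro allI impI)
  fix R M assume D: "D \<subseteq> C" and n: "\<forall>R M. finite R \<longrightarrow> M \<in> monomials C \<longrightarrow>
     (\<forall>(A, B) \<in> R. A \<in> monomials C \<and> B \<in> monomials C \<and> gt A B) \<longrightarrow>
     (M, nf R M) \<in> (mono_rew R)\<^sup>* \<and> nf R M \<notin> Domain (mono_rew R)"
    and "finite R" "M \<in> monomials D" "\<forall>(A, B) \<in> R. A \<in> monomials D \<and> B \<in> monomials D \<and> gt A B"
  moreover from this have "\<forall>(A, B) \<in> R. A \<in> monomials C \<and> B \<in> monomials C \<and> gt A B" "M \<in> monomials C"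
    by (auto dest: monomials_mono[OF D])
  ultimately show "(M, nf R M) \<in> (mono_rew R)\<^sup>* \<and> nf R M \<notin> Domain (mono_rew R)" by blast
qed

lemma mono_rew_iff: "(M, N) \<in> mono_rew R \<longleftrightarrow> (\<exists>A B D. (A, B) \<in> R \<and> M = A + D \<and> N = B + D)"
proof
  assume "(M, N) \<in> mono_rew R"
  then obtain A B where "(A, B) \<in> R" "A \<subseteq># M" "N = M - A + B" by (auto simp: mono_rew_def)
  then show "\<exists>A B D. (A, B) \<in> R \<and> M = A + D \<and> N = B + D"
    by (intro exI[of _ A] exI[of _ B] exI[of _ "M - A"]) (auto simp: ac_simps)
next
  assume "\<exists>A B D. (A, B) \<in> R \<and> M = A + D \<and> N = B + D"
  then obtain A B D where "(A, B) \<in> R" "M = A + D" "N = B + D" by blast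
  then show "(M, N) \<in> mono_rew R"
    unfolding mono_rew_def by (intro CollectI exI[of _ M] exI[of _ A] exI[of _ B]) (auto simp: ac_simps)
qed

lemma Domain_mono_rew: "M \<in> Domain (mono_rew R) \<longleftrightarrow> (\<exists>(A, B) \<in> R. A \<subseteq># M)"
  by (auto simp: mono_rew_def)

text \<open>A choice of normal form that does not refer to the normalizer of the algorithm;
  uniqueness of normal forms is proved about this choice.\<close>

definition nfm :: "'c mrules \<Rightarrow> 'c multiset \<Rightarrow> 'c multiset" where
  "nfm R M = (SOME N. (M, N) \<in> (mono_rew R)\<^sup>* \<and> N \<notin> Domain (mono_rew R))"

section \<open>Rewriting and connectedness under an admissible ordering\<close>

locale monomial_order =
  fixes C :: "'c set" and gtC :: "'c \<Rightarrow> 'c \<Rightarrow> bool" and gt :: "'c multiset \<Rightarrow> 'c multiset \<Rightarrow> bool"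
  assumes adm: "admissible C gtC gt" and finC: "finite C"
begin

abbreviation "Mon \<equiv> monomials C"

lemma gt_irrefl: "A \<in> Mon \<Longrightarrow> \<not> gt A A"
  using adm by (auto simp: admissible_def strict_total_on_def irreflp_on_def)

lemma gt_trans: "A \<in> Mon \<Longrightarrow> B \<in> Mon \<Longrightarrow> D \<in> Mon \<Longrightarrow> gt A B \<Longrightarrow> gt B D \<Longrightarrow> gt A D"
  using adm unfolding admissible_def strict_total_on_def transp_on_def by blast

lemma gt_total: "A \<in> Mon \<Longrightarrow> B \<in> Mon \<Longrightarrow> A \<noteq> B \<Longrightarrow> gt A B \<or> gt B A"
  using adm unfolding admissible_def strict_total_on_def totalp_on_def by blast

lemma gt_sub: "A \<in> Mon \<Longrightarrow> B \<in> Mon \<Longrightarrow> B \<subset># A \<Longrightarrow> gt A B"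
  using adm unfolding admissible_def by blast

lemma gt_add: "A \<in> Mon \<Longrightarrow> B \<in> Mon \<Longrightarrow> gt A B \<Longrightarrow> set_mset D \<subseteq> C \<Longrightarrow> gt (A + D) (B + D)"
  using adm unfolding admissible_def by blast

lemma gt_const: "c \<in> C \<Longrightarrow> d \<in> C \<Longrightarrow> gtC c d \<Longrightarrow> gt {#c#} {#d#}"
  using adm unfolding admissible_def by blast

lemma gt_big: "A \<in> Mon \<Longrightarrow> c \<in> C \<Longrightarrow> 1 < size A \<Longrightarrow> gt A {#c#}"
  using adm unfolding admissible_def by blast

lemma wf_gt: "wf {(B, A). A \<in> Mon \<and> B \<in> Mon \<and> gt A B}"
proof -
  have "wfp_on Mon (\<lambda>A B. gt B A)" using adm by (simp add: admissible_def)
  then have "wfp (\<lambda>B A. gt A B \<and> B \<in> Mon \<and> A \<in> Mon)"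
    by (simp only: wfp_on_iff_wfp[of Mon "\<lambda>A B. gt B A"])
  then have "wf {(B, A). gt A B \<and> B \<in> Mon \<and> A \<in> Mon}" by (simp add: wfp_def)
  then show ?thesis by (rule wf_subset) auto
qed

lemma gt_induct [consumes 1, case_names less]:
  assumes "M \<in> Mon" "\<And>M. M \<in> Mon \<Longrightarrow> (\<And>N. N \<in> Mon \<Longrightarrow> gt M N \<Longrightarrow> P N) \<Longrightarrow> P M"
  shows "P M"
  using assms(1)
proof (induction M rule: wf_induct_rule[OF wf_gt])
  case (1 M)
  then show ?case using assms(2) by blast
qed

lemma sub_le: "A \<in> Mon \<Longrightarrow> A + D \<in> Mon \<Longrightarrow> A + D = A \<or> gt (A + D) A"
  using gt_sub[of "A + D" A] by (cases "D = {#}") (auto simp: subset_mset.less_le)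

lemma mono_rew_gt:
  assumes "oriented C gt R" "M \<in> Mon" "(M, N) \<in> mono_rew R"
  shows "N \<in> Mon \<and> gt M N"
proof -
  obtain A B D where *: "(A, B) \<in> R" "M = A + D" "N = B + D" using assms mono_rew_iff by metis
  then have "A \<in> Mon" "B \<in> Mon" "gt A B" using assms(1) by (auto simp: oriented_def)
  moreover have "set_mset D \<subseteq> C" using assms(2) * by (auto simp: monomials_def)
  ultimately show ?thesis using * gt_add monomials_add by blast
qed

lemma mono_steps_ge:
  assumes "oriented C gt R" "M \<in> Mon" "(M, N) \<in> (mono_rew R)\<^sup>*"
  shows "N \<in> Mon \<and> (N = M \<or> gt M N)"
  using assms(3)
proof (induction rule: rtrancl_induct)
  case (step N N')
  then have "N' \<in> Mon \<and> gt N N'" using mono_rew_gt[OF assms(1)] by blast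
  then show ?case using step gt_trans[of M N N'] assms(2) by blast
qed (use assms in simp)

text \<open>Admissibility moves the bound along with the context, so a chain for the bare overlap
  serves every monomial that contains it.\<close>

lemma conn_add:
  assumes X: "X \<subseteq> Mon \<times> Mon" and M: "M \<in> Mon" and D: "set_mset D \<subseteq> C" and UV: "(U, V) \<in> conn C gt X M"
  shows "(U + D, V + D) \<in> conn C gt X (M + D)"
  using UV unfolding conn_def
proof (induction rule: rtrancl_induct)
  case (step V W)
  then obtain P Q D' where *: "(P, Q) \<in> X \<or> (Q, P) \<in> X" "V = P + D'" "W = Q + D'" "set_mset D' \<subseteq> C"
    by (auto simp: estep_def)
  then have "V \<in> Mon" "W \<in> Mon" using X by (auto intro!: monomials_add)
  then have "gt (M + D) (V + D)" "gt (M + D) (W + D)" using step M D gt_add by auto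
  moreover have "(V + D, W + D) \<in> estep C X"
    unfolding estep_def using * D
    by (intro CollectI exI[of _ P] exI[of _ Q] exI[of _ "D' + D"]) (auto simp: ac_simps)
  ultimately show ?case using step(3) by (auto intro: rtrancl_into_rtrancl)
qed simp

lemma simulates_conn:
  assumes "simulates C gt X' X" "M \<in> Mon"
  shows "conn C gt X M \<subseteq> conn C gt X' M"
proof (rule subrelI)
  fix U V assume "(U, V) \<in> conn C gt X M"
  then show "(U, V) \<in> conn C gt X' M"
    unfolding conn_def[of C gt X M]
  proof (induction rule: rtrancl_induct)
    case (step V W)
    then obtain P Q D' where *: "(P, Q) \<in> X \<or> (Q, P) \<in> X" "V = P + D'" "W = Q + D'" "set_mset D' \<subseteq> C"
      by (auto simp: estep_def)
    have "(V, W) \<in> conn C gt X' M"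
      using * step(2) assms unfolding simulates_def by (blast intro: conn_sym)
    then show ?case using step(3) conn_trans by metis
  qed simp
qed

lemma simulates_refl: "X \<subseteq> X' \<Longrightarrow> simulates C gt X' X"
  unfolding simulates_def by (blast intro: conn_step)

lemma simulates_Un: "simulates C gt X' X \<Longrightarrow> simulates C gt X' Y \<Longrightarrow> simulates C gt X' (X \<union> Y)"
  unfolding simulates_def by blast

lemma simulates_mono: "simulates C gt X' X \<Longrightarrow> X' \<subseteq> Y \<Longrightarrow> simulates C gt Y X"
  unfolding simulates_def using conn_mono[of X' Y C C gt] by blast

text \<open>Rewriting only goes down, so a bound on the first monomial covers the whole
  chain.\<close>

lemma steps_conn:
  assumes R: "oriented C gt R" "M \<in> Mon" "U \<in> Mon" and D: "set_mset D \<subseteq> C" and U: "gt M (U + D)"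
    and UV: "(U, V) \<in> (mono_rew R)\<^sup>*"
  shows "(U + D, V + D) \<in> conn C gt R M"
  using UV
proof (induction rule: rtrancl_induct)
  case (step V W)
  have V: "V \<in> Mon" "V = U \<or> gt U V" using mono_steps_ge[OF R(1,3)] step(1) by auto
  have W: "W \<in> Mon" "gt V W" using mono_rew_gt[OF R(1) V(1)] step(2) by auto
  have UD: "U + D \<in> Mon" "V + D \<in> Mon" "W + D \<in> Mon" using R V W D monomials_add by auto
  have "gt M (V + D)" using V gt_add[OF R(3) V(1) _ D] U gt_trans[OF R(2) UD(1,2)] by auto
  moreover from this have "gt M (W + D)" using gt_add[OF V(1) W(1,2) D] gt_trans[OF R(2) UD(2,3)] by auto
  moreover obtain A B E where "(A, B) \<in> R" "V = A + E" "W = B + E" using step(2) mono_rew_iff by metis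
  moreover have "set_mset E \<subseteq> C" using V(1) \<open>V = A + E\<close> by (auto simp: monomials_def)
  ultimately have "(V + D, W + D) \<in> conn C gt R M"
    using conn_step[of A B R "E + D" C gt M] D by (simp add: ac_simps)
  then show ?case using step(3) conn_trans by metis
qed simp

lemma mcongr_step:
  assumes r: "mcongr C r" and R: "oriented C gt R" "R \<subseteq> r" and M: "M \<in> Mon" and MN: "(M, N) \<in> (mono_rew R)\<^sup>*"
  shows "(M, N) \<in> r"
  using MN
proof (induction rule: rtrancl_induct)
  case base
  show ?case using r M by (simp add: mcongr_def)
next
  case (step V W)
  obtain A B E where *: "(A, B) \<in> R" "V = A + E" "W = B + E" using step(2) mono_rew_iff by metis
  have "V \<in> Mon" using mono_steps_ge[OF R(1) M] step(1) by auto
  then have "set_mset E \<subseteq> C" using * by (auto simp: monomials_def)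
  then have "(V, W) \<in> r" using * r R unfolding mcongr_def oriented_def by blast
  then show ?case using step(3) r unfolding mcongr_def by (meson transD)
qed

lemma mcongr_conn:
  assumes r: "mcongr C r" and X: "X \<subseteq> Mon \<times> Mon" "X \<subseteq> r" and U: "U \<in> Mon" and UV: "(U, V) \<in> conn C gt X M"
  shows "(U, V) \<in> r"
  using UV unfolding conn_def
proof (induction rule: rtrancl_induct)
  case base
  show ?case using r U by (simp add: mcongr_def)
next
  case (step V W)
  then obtain P Q D where *: "(P, Q) \<in> X \<or> (Q, P) \<in> X" "V = P + D" "W = Q + D" "set_mset D \<subseteq> C"
    by (auto simp: estep_def)
  then have "(P, Q) \<in> r" using X r unfolding mcongr_def by (meson subsetD symD)
  then have "(V, W) \<in> r" using * X r unfolding mcongr_def by blast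
  then show ?case using step(3) r unfolding mcongr_def by (meson transD)
qed

lemma simulates_mcongr:
  assumes s: "simulates C gt X' X" and r: "mcongr C r" and X: "X \<subseteq> Mon \<times> Mon" and X': "X' \<subseteq> Mon \<times> Mon" "X' \<subseteq> r"
  shows "X \<subseteq> r"
proof (rule subrelI)
  fix P Q assume PQ: "(P, Q) \<in> X"
  then have m: "P \<in> Mon" "Q \<in> Mon" using X by auto
  \<comment> \<open>\<open>simulates\<close> asks for a bound above both sides. The sum is one,
    since both monomials are nonempty and hence properly contained in it.\<close>
  then have "P + Q \<in> Mon" by (auto simp: monomials_def)
  moreover from this m have "gt (P + Q) P" "gt (P + Q) Q"
    by (auto intro!: gt_sub simp: subset_mset.less_le monomials_def)
  ultimately have "(P + {#}, Q + {#}) \<in> conn C gt X' (P + Q)"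
    using s PQ unfolding simulates_def by (metis (no_types, lifting) add_0_right case_prodD empty_subsetI set_mset_empty)
  then show "(P, Q) \<in> r" using mcongr_conn[OF r X' m(1)] by simp
qed

lemma oriented_Mon: "oriented C gt R \<Longrightarrow> R \<subseteq> Mon \<times> Mon"
  by (auto simp: oriented_def)

section \<open>Invariants and termination of completion\<close>

context
  fixes nf :: "'c mrules \<Rightarrow> 'c multiset \<Rightarrow> 'c multiset"
  assumes norm: "normalizer C gt nf"
begin

lemma nf_props:
  assumes "finite R" "oriented C gt R" "M \<in> Mon"
  shows "(M, nf R M) \<in> (mono_rew R)\<^sup>*" "nf R M \<in> Mon" "nf R M = M \<or> gt M (nf R M)"
    "(A, B) \<in> R \<Longrightarrow> \<not> A \<subseteq># nf R M"
proof -
  have *: "(M, nf R M) \<in> (mono_rew R)\<^sup>* \<and> nf R M \<notin> Domain (mono_rew R)"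
    using norm assms by (simp add: normalizer_def oriented_def)
  then show "(M, nf R M) \<in> (mono_rew R)\<^sup>*" by simp
  show "nf R M \<in> Mon" "nf R M = M \<or> gt M (nf R M)" using mono_steps_ge[OF assms(2,3)] * by auto
  show "(A, B) \<in> R \<Longrightarrow> \<not> A \<subseteq># nf R M" using * by (auto simp: Domain_mono_rew)
qed

lemma reduce_rhs_oriented:
  assumes "finite R" "oriented C gt R"
  shows "oriented C gt (reduce_rhs nf R)"
  unfolding oriented_def reduce_rhs_def
proof (clarsimp, intro conjI)
  fix A B assume "(A, B) \<in> R"
  then have AB: "A \<in> Mon" "B \<in> Mon" "gt A B" using assms by (auto simp: oriented_def)
  then show "A \<in> Mon" "nf R B \<in> Mon" "gt A (nf R B)"
    using nf_props(2,3)[OF assms AB(2)] gt_trans[of A B "nf R B"] by auto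
qed

text \<open>The detour from \<open>A\<close> over \<open>nf R B\<close> back to \<open>B\<close>
  uses rules of \<open>R\<close>, which have to be replaced in turn. The left side \<open>A'\<close>
  of such a rule is contained in a monomial that is at most \<open>B\<close>, so it is below
  \<open>A\<close>, and induction on the left side succeeds.\<close>

lemma reduce_rhs_simulates:
  assumes "finite R" "oriented C gt R"
  shows "simulates C gt (reduce_rhs nf R) R"
proof -
  let ?R = "reduce_rhs nf R"
  have "\<forall>B. (A, B) \<in> R \<longrightarrow> (\<forall>D. \<forall>M \<in> Mon. set_mset D \<subseteq> C \<longrightarrow> gt M (A + D) \<longrightarrow> (A + D, B + D) \<in> conn C gt ?R M)"
    if "A \<in> Mon" for A
    using that
  proof (induction rule: gt_induct)
    case (less A)
    show ?case
    proof (intro allI ballI impI)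
      fix B D M assume AB: "(A, B) \<in> R" and D: "set_mset D \<subseteq> C" and M: "M \<in> Mon" "gt M (A + D)"
      have B: "B \<in> Mon" "gt A B" using assms AB by (auto simp: oriented_def)
      note nB = nf_props[OF assms B(1)]
      have mons: "A + D \<in> Mon" "B + D \<in> Mon" "nf R B + D \<in> Mon" using less(1) B(1) nB(2) D by (auto intro: monomials_add)
      have AnB: "gt A (nf R B)" using nB(2,3) B less(1) gt_trans[of A B "nf R B"] by auto
      have "gt M (nf R B + D)"
        using gt_add[OF less(1) nB(2) AnB D] gt_trans[OF M(1) mons(1,3)] M by auto
      then have 1: "(A + D, nf R B + D) \<in> conn C gt ?R M"
        using AB D M by (intro conn_step) (auto simp: reduce_rhs_def)
      \<comment> \<open>Each step in the reduction of \<open>B\<close> is replaced by the induction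
        hypothesis for its left side, in the enlarged context \<open>E + D\<close>.\<close>
      have "(B + D, V + D) \<in> conn C gt ?R M" if "(B, V) \<in> (mono_rew R)\<^sup>*" for V
        using that
      proof (induction rule: rtrancl_induct)
        case (step V W)
        obtain A' B' E where r: "(A', B') \<in> R" "V = A' + E" "W = B' + E" using step(2) mono_rew_iff by metis
        have V: "V \<in> Mon" "V = B \<or> gt B V" using mono_steps_ge[OF assms(2) B(1) step(1)] by auto
        then have AV: "gt A V" using B less(1) gt_trans[of A B V] by auto
        have E: "set_mset E \<subseteq> C" using V r by (auto simp: monomials_def)
        have A': "A' \<in> Mon" using r(1) assms(2) by (auto simp: oriented_def)
        have "gt A A'" using sub_le[OF A', of E] V(1) AV r(2) gt_trans[of A V A'] less(1) A' by auto
        moreover have "gt M (A' + (E + D))"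
          using gt_add[OF less(1) V(1) AV D] gt_trans[OF M(1) mons(1) _ M(2)] V(1) D r(2)
          by (metis add.assoc monomials_add)
        ultimately have "(A' + (E + D), B' + (E + D)) \<in> conn C gt ?R M"
          using less(2)[OF A'] r(1) M(1) D E by simp
        then show ?case using step(3) r conn_trans by (metis add.assoc)
      qed simp
      from conn_sym[OF this[OF nB(1)]] show "(A + D, B + D) \<in> conn C gt ?R M"
        using 1 conn_trans by metis
    qed
  qed
  then show ?thesis unfolding simulates_def using assms(2) by (auto simp: oriented_def)
qed

text \<open>As \<open>A2\<close> is below \<open>A1\<close>, normalizing it inside the critical pair
  stays below the overlap.\<close>

lemma conn_critical_left:
  assumes "finite R" "oriented C gt R" "(A1, A2) \<in> R" "(B1, B2) \<in> R"
  shows "((B1 - A1) + A2, (B1 - A1) + nf R A2) \<in> conn C gt R (A1 + (B1 - A1))"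
proof -
  have m: "A1 \<in> Mon" "A2 \<in> Mon" "gt A1 A2" "B1 \<in> Mon" using assms by (auto simp: oriented_def)
  have D: "set_mset (B1 - A1) \<subseteq> C" using m(4) monomials_diff by blast
  have "gt (A1 + (B1 - A1)) (A2 + (B1 - A1))" using gt_add m D by blast
  then have "(A2 + (B1 - A1), nf R A2 + (B1 - A1)) \<in> conn C gt R (A1 + (B1 - A1))"
    using steps_conn[OF assms(2) _ m(2) D _ nf_props(1)[OF assms(1,2) m(2)]] monomials_add[OF m(1) D] by blast
  then show ?thesis by (simp add: ac_simps)
qed

text \<open>The new critical pair is the old one prolonged at both ends by
  \<open>conn_critical_left\<close>. The resulting chain still uses the old rules, which
  \<open>reduce_rhs_simulates\<close> then replaces.\<close>

lemma reduce_rhs_inv: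
  assumes R: "finite R" "oriented C gt R" "left_reduced R" and T: "finite T" "T \<subseteq> Mon \<times> Mon" and p: "peaks C gt (R \<union> T) R"
  shows "completion_inv C gt (reduce_rhs nf R) T"
  unfolding completion_inv_def
proof (intro conjI)
  let ?R = "reduce_rhs nf R"
  show "finite ?R" using R by (simp add: reduce_rhs_def)
  show "oriented C gt ?R" using reduce_rhs_oriented R by blast
  show "left_reduced ?R" using R(3) unfolding left_reduced_def reduce_rhs_def by fastforce
  show "right_reduced ?R" unfolding right_reduced_def reduce_rhs_def
    using nf_props(4)[OF R(1,2)] R(2) by (fastforce simp: oriented_def)
  show "peaks C gt (?R \<union> T) ?R"
    unfolding peaks_def
  proof (intro ballI, clarify)
    fix A1 A2' B1 B2' assume "(A1, A2') \<in> ?R" "(B1, B2') \<in> ?R"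
    then obtain A2 B2 where AB: "(A1, A2) \<in> R" "A2' = nf R A2" "(B1, B2) \<in> R" "B2' = nf R B2"
      by (auto simp: reduce_rhs_def)
    let ?M = "A1 + (B1 - A1)"
    have m: "A1 \<in> Mon" "B1 \<in> Mon" using AB R(2) by (auto simp: oriented_def)
    then have M: "?M \<in> Mon" by (intro monomials_add monomials_diff)
    have "((B1 - A1) + A2, (A1 - B1) + B2) \<in> conn C gt (R \<union> T) ?M"
      using p AB unfolding peaks_def critical_pair_eq by blast
    moreover have "((B1 - A1) + A2, (B1 - A1) + A2') \<in> conn C gt (R \<union> T) ?M"
      using conn_critical_left[OF R(1,2) AB(1,3)] AB conn_mono[of R "R \<union> T" C C] by blast
    moreover have "((A1 - B1) + B2, (A1 - B1) + B2') \<in> conn C gt (R \<union> T) ?M"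
      using conn_critical_left[OF R(1,2) AB(3,1)] AB conn_mono[of R "R \<union> T" C C] lcm_commute[of A1 B1] by fastforce
    ultimately have "((B1 - A1) + A2', (A1 - B1) + B2') \<in> conn C gt (R \<union> T) ?M"
      using conn_sym conn_trans by metis
    moreover have "simulates C gt (?R \<union> T) (R \<union> T)"
      using simulates_mono[OF reduce_rhs_simulates[OF R(1,2)], of "?R \<union> T"] simulates_refl[of T "?R \<union> T"]
      by (intro simulates_Un) auto
    ultimately show "critical_pair (A1, A2') (B1, B2') \<in> conn C gt (?R \<union> T) ?M"
      unfolding critical_pair_eq using simulates_conn[OF _ M] by blast
  qed
qed (use T in auto)

lemma reduce_rhs_mcongr:
  assumes "finite R" "oriented C gt R" "mcongr C r"
  shows "reduce_rhs nf R \<subseteq> r \<longleftrightarrow> R \<subseteq> r"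
proof
  assume "reduce_rhs nf R \<subseteq> r"
  then show "R \<subseteq> r"
    using simulates_mcongr[OF reduce_rhs_simulates[OF assms(1,2)] assms(3)] oriented_Mon assms reduce_rhs_oriented
    by blast
next
  assume R: "R \<subseteq> r"
  show "reduce_rhs nf R \<subseteq> r"
  proof (rule subrelI)
    fix A B' assume "(A, B') \<in> reduce_rhs nf R"
    then obtain B where AB: "(A, B) \<in> R" "B' = nf R B" by (auto simp: reduce_rhs_def)
    then have B: "B \<in> Mon" using assms(2) by (auto simp: oriented_def)
    have "(B, B') \<in> r" using mcongr_step[OF assms(3,2) R B] nf_props(1)[OF assms(1,2) B] AB by auto
    moreover have "(A, B) \<in> r" using AB R by auto
    ultimately show "(A, B') \<in> r" using assms(3) unfolding mcongr_def by (meson transD)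
  qed
qed

lemma covered_reduce_rhs: "covered C (reduce_rhs nf R) = covered C R"
  unfolding covered_def reduce_rhs_def by fastforce

text \<open>A joinable equation is dropped and the rules stay literally the same; otherwise the
  ideal of left sides grows. The last conjunct says that no consequence is gained or lost.\<close>

lemma completion_step_correct:
  assumes inv: "completion_inv C gt R T" and T: "T \<noteq> {}" and pick: "selection pick"
    and st: "completion_step gt pick nf R T = (R', T')"
  shows "completion_inv C gt R' T' \<and>
    (covered C R \<subset> covered C R' \<or> R' = R \<and> card T' < card T) \<and>
    (\<forall>r. mcongr C r \<longrightarrow> (R' \<union> T' \<subseteq> r \<longleftrightarrow> R \<union> T \<subseteq> r))"
proof -
  have R: "finite R" "oriented C gt R" "left_reduced R" "right_reduced R" "peaks C gt (R \<union> T) R"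
    and finT: "finite T" and TM: "T \<subseteq> Mon \<times> Mon" using inv by (auto simp: completion_inv_def)
  define e where "e = pick R T"
  obtain s t where e: "e = (s, t)" by (cases e)
  have eT: "(s, t) \<in> T" using pick T e unfolding selection_def e_def by metis
  then have sm: "s \<in> Mon" and tm: "t \<in> Mon" using TM by auto
  define P where "P = nf R s"
  define Q where "Q = nf R t"
  note P = nf_props[OF R(1,2) sm, folded P_def] and Q = nf_props[OF R(1,2) tm, folded Q_def]
  have TmM: "T - {e} \<subseteq> Mon \<times> Mon" using TM by auto
  \<comment> \<open>The treated equation is recovered as a chain from \<open>s\<close> down to
    \<open>P\<close>, across to \<open>Q\<close> and up to \<open>t\<close>, all of it below any
    bound on \<open>s + D\<close> and \<open>t + D\<close>.\<close>
  have simT: "simulates C gt X T" if X: "R \<subseteq> X" "P = Q \<or> (P, Q) \<in> X \<or> (Q, P) \<in> X" "T - {e} \<subseteq> X" for X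
    unfolding simulates_def
  proof (intro ballI, clarify)
    fix U V D M assume UV: "(U, V) \<in> T" and D: "set_mset D \<subseteq> C" and M: "M \<in> Mon" "gt M (U + D)" "gt M (V + D)"
    show "(U + D, V + D) \<in> conn C gt X M"
    proof (cases "(U, V) = e")
      case False
      then show ?thesis using UV X D M by (intro conn_step) auto
    next
      case True
      then have [simp]: "U = s" "V = t" using e by auto
      have 1: "(s + D, P + D) \<in> conn C gt X M" "(t + D, Q + D) \<in> conn C gt X M"
        using steps_conn[OF R(2) M(1) sm D _ P(1)] steps_conn[OF R(2) M(1) tm D _ Q(1)] M
          conn_mono[OF X(1), of C C gt M] by auto
      have "gt M (P + D)" "gt M (Q + D)"
        using M P(2,3) Q(2,3) gt_add[OF sm P(2) _ D] gt_add[OF tm Q(2) _ D] D sm tm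
          gt_trans[OF M(1), of "s + D" "P + D"] gt_trans[OF M(1), of "t + D" "Q + D"] monomials_add by auto
      then have "(P + D, Q + D) \<in> conn C gt X M"
        using X(2) D conn_step[of P Q X D C gt M] conn_step[of Q P X D C gt M] conn_sym by fastforce
      then show ?thesis using 1 conn_sym conn_trans by (metis \<open>U = s\<close> \<open>V = t\<close>)
    qed
  qed
  have TR: "(P, Q) \<in> r" if r: "mcongr C r" "R \<union> T \<subseteq> r" for r
  proof -
    have "(s, P) \<in> r" "(t, Q) \<in> r"
      using mcongr_step[OF r(1) R(2) _ sm P(1)] mcongr_step[OF r(1) R(2) _ tm Q(1)] r by auto
    moreover have "(s, t) \<in> r" using eT r by auto
    moreover have "sym r" "trans r" using r(1) by (auto simp: mcongr_def)
    ultimately show ?thesis by (meson symD transD)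
  qed
  show ?thesis
  proof (cases "P = Q")
    case True
    then have st': "R' = R" "T' = T - {e}" using st
      unfolding completion_step_def P_def Q_def e_def Let_def using e by (auto simp: e_def)
    have sim: "simulates C gt (R \<union> T') (R \<union> T)"
      using simT[of "R \<union> T'"] True st' simulates_refl[of R "R \<union> T'"] by (intro simulates_Un) auto
    have "peaks C gt (R \<union> T') R"
      unfolding peaks_def
    proof (intro ballI, clarify)
      fix A1 A2 B1 B2 assume AB: "(A1, A2) \<in> R" "(B1, B2) \<in> R"
      then have "A1 + (B1 - A1) \<in> Mon" using R(2) by (auto simp: oriented_def intro!: monomials_add monomials_diff)
      then show "critical_pair (A1, A2) (B1, B2) \<in> conn C gt (R \<union> T') (A1 + (B1 - A1))"
        using simulates_conn[OF sim] AB R(5) unfolding peaks_def by blast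
    qed
    then have "completion_inv C gt R' T'" using st' R finT TmM by (simp add: completion_inv_def)
    moreover have "card T' < card T" using st' eT e finT by (simp add: card_Diff1_less del: card_Diff_insert)
    moreover have "R' \<union> T' \<subseteq> r \<longleftrightarrow> R \<union> T \<subseteq> r" if "mcongr C r" for r
      using simulates_mcongr[OF sim that] st' oriented_Mon[OF R(2)] TM by auto
    ultimately show ?thesis using st' by auto
  next
    case False
    define new where "new = orient gt P Q"
    define coll where "coll = {rl \<in> R. fst new \<subseteq># fst rl}"
    define R1 where "R1 = insert new (R - coll)"
    define T1 where "T1 = (T - {e}) \<union> coll \<union> critical_pair new ` R"
    have st': "R' = reduce_rhs nf R1" "T' = T1" using st False
      unfolding completion_step_def P_def Q_def e_def Let_def new_def coll_def R1_def T1_def using e by (auto simp: e_def)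
    obtain L N where new: "new = (L, N)" by (cases new)
    have LN: "L \<in> Mon" "N \<in> Mon" "gt L N" "(L = P \<and> N = Q) \<or> (L = Q \<and> N = P)"
      using new gt_total[OF P(2) Q(2) False] P(2) Q(2) unfolding new_def orient_def by (auto split: if_splits)
    \<comment> \<open>\<open>L\<close> is one of the two normal forms, so no old rule reduces it.
      Hence the rules stay left-reduced, and \<open>L\<close> is new in the covered set.\<close>
    have Lirr: "\<not> A \<subseteq># L" if "(A, B) \<in> R" for A B using that P(4) Q(4) LN(4) by auto
    have R1: "finite R1" "oriented C gt R1"
      using R(1,2) LN new by (auto simp: R1_def oriented_def)
    have lR1: "left_reduced R1"
      using R(3) Lirr new unfolding left_reduced_def R1_def coll_def by fastforce
    have cpM: "critical_pair new rl \<in> Mon \<times> Mon" if "rl \<in> R" for rl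
      using that R(2) LN unfolding new
      by (cases rl) (auto simp: critical_pair_eq oriented_def simp del: critical_pair.simps intro!: monomials_add2 monomials_diff)
    have "critical_pair new ` R \<subseteq> Mon \<times> Mon" using cpM by blast
    then have T1: "finite T1" "T1 \<subseteq> Mon \<times> Mon"
      using finT R(1) TmM oriented_Mon[OF R(2)] unfolding T1_def coll_def by auto
    \<comment> \<open>Collapsed rules are pending in \<open>T1\<close>, so every old equation of
      \<open>R\<close> remains available.\<close>
    have sim: "simulates C gt (R1 \<union> T1) (R \<union> T)"
    proof (rule simulates_Un)
      have "R \<subseteq> R1 \<union> T1" by (auto simp: R1_def T1_def)
      then show "simulates C gt (R1 \<union> T1) R" by (rule simulates_refl)
      show "simulates C gt (R1 \<union> T1) T"
        using LN(4) new \<open>R \<subseteq> R1 \<union> T1\<close> by (intro simT) (auto simp: R1_def T1_def)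
    qed
    \<comment> \<open>The critical pair is itself pending, so one step connects its sides; both are
      below the overlap because the rules decrease.\<close>
    have pnew: "critical_pair (L, N) (B1, B2) \<in> conn C gt (R1 \<union> T1) (L + (B1 - L))" if "(B1, B2) \<in> R" for B1 B2
    proof -
      have B: "B1 \<in> Mon" "B2 \<in> Mon" "gt B1 B2" using that R(2) by (auto simp: oriented_def)
      have "(B1 - L + N, L - B1 + B2) \<in> T1"
        using that unfolding T1_def new by (metis UnI2 critical_pair_eq imageI)
      moreover have "gt (L + (B1 - L)) (B1 - L + N)" using gt_add[OF LN(1-3) monomials_diff[OF B(1)]] by (simp add: ac_simps)
      moreover have "gt (L + (B1 - L)) (L - B1 + B2)"
        using gt_add[OF B monomials_diff[OF LN(1)]] lcm_commute[of L B1] by (simp add: ac_simps)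
      ultimately show ?thesis unfolding critical_pair_eq
        using conn_step[of "B1 - L + N" "L - B1 + B2" "R1 \<union> T1" "{#}" C gt] by auto
    qed
    have "peaks C gt (R1 \<union> T1) R1"
      unfolding peaks_def
    proof (intro ballI, clarify)
      fix A1 A2 B1 B2 assume AB: "(A1, A2) \<in> R1" "(B1, B2) \<in> R1"
      show "critical_pair (A1, A2) (B1, B2) \<in> conn C gt (R1 \<union> T1) (A1 + (B1 - A1))"
      proof (cases "(A1, A2) = new")
        case A: True
        show ?thesis
        proof (cases "(B1, B2) = new")
          case True
          \<comment> \<open>The critical pair of a rule with itself has equal sides.\<close>
          then show ?thesis using A new by (simp add: critical_pair_eq del: critical_pair.simps)
        next
          case False
          then show ?thesis using A new AB pnew by (auto simp: R1_def)
        qed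
      next
        case A: False
        then have AR: "(A1, A2) \<in> R" using AB by (auto simp: R1_def)
        show ?thesis
        proof (cases "(B1, B2) = new")
          case True
          then show ?thesis using pnew[OF AR] new lcm_commute[of L A1] conn_sym
            unfolding critical_pair_eq by fastforce
        next
          case False
          then have BR: "(B1, B2) \<in> R" using AB by (auto simp: R1_def)
          have "A1 + (B1 - A1) \<in> Mon" using R(2) AR BR by (auto simp: oriented_def intro!: monomials_add monomials_diff)
          then show ?thesis using simulates_conn[OF sim] AR BR R(5) unfolding peaks_def by blast
        qed
      qed
    qed
    then have inv': "completion_inv C gt R' T'"
      unfolding st' using reduce_rhs_inv[OF R1 lR1 T1] by blast
    have "covered C R \<subset> covered C R1"
    proof
      show "covered C R \<subseteq> covered C R1"
        unfolding covered_def R1_def coll_def using new by fastforce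
      have "L \<in> covered C R1" using LN(1) new by (auto simp: covered_def R1_def monomials_def)
      moreover have "L \<notin> covered C R" using Lirr by (auto simp: covered_def)
      ultimately show "covered C R \<noteq> covered C R1" by blast
    qed
    then have "covered C R \<subset> covered C R'" unfolding st' covered_reduce_rhs .
    moreover have "R' \<union> T' \<subseteq> r \<longleftrightarrow> R \<union> T \<subseteq> r" if r: "mcongr C r" for r
    proof -
      have "R' \<union> T' \<subseteq> r \<longleftrightarrow> R1 \<union> T1 \<subseteq> r" unfolding st' using reduce_rhs_mcongr[OF R1 r] by auto
      moreover have "R \<union> T \<subseteq> r" if "R1 \<union> T1 \<subseteq> r"
        using simulates_mcongr[OF sim r _ _ that] oriented_Mon R R1 TM T1 by auto
      moreover have "R1 \<union> T1 \<subseteq> r" if RT: "R \<union> T \<subseteq> r"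
      proof -
        have sym: "sym r" and tr: "trans r" using r by (auto simp: mcongr_def)
        have nr: "(L, N) \<in> r" using TR[OF r RT] LN(4) sym by (auto dest: symD)
        have "critical_pair (L, N) (B1, B2) \<in> r" if B: "(B1, B2) \<in> R" for B1 B2
        proof -
          have Bm: "B1 \<in> Mon" "B2 \<in> Mon" using B R(2) by (auto simp: oriented_def)
          have "(L + (B1 - L), N + (B1 - L)) \<in> r" "(B1 + (L - B1), B2 + (L - B1)) \<in> r"
            using r nr B RT LN Bm monomials_diff unfolding mcongr_def by blast+
          then show ?thesis unfolding critical_pair_eq lcm_commute[of L B1]
            using sym tr by (metis add.commute symD transD)
        qed
        then show ?thesis using RT nr new unfolding R1_def T1_def coll_def by auto
      qed
      ultimately show ?thesis by blast
    qed
    ultimately show ?thesis using inv' by blast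
  qed
qed

lemma complete_correct:
  assumes "completion_inv C gt R T" and pick: "selection pick"
  shows "\<exists>R'. complete gt pick nf R T = Some R' \<and> completion_inv C gt R' {} \<and>
    (\<forall>r. mcongr C r \<longrightarrow> (R' \<subseteq> r \<longleftrightarrow> R \<union> T \<subseteq> r))"
proof -
  \<comment> \<open>The lexicographic product compares \<open>R\<close> itself for equality. This
    fits because a step that does not enlarge the covered set leaves \<open>R\<close>
    untouched.\<close>
  let ?m = "inv_image ({(R', R). covered C R \<subset> covered C R'} <*lex*> less_than) (\<lambda>(R, T). (R, card T))"
  have wf: "wf ?m" using wf_covered[OF finC] by blast
  show ?thesis using assms(1)
  proof (induction "(R, T)" arbitrary: R T rule: wf_induct_rule[OF wf])
    case (1 R T)
    show ?case
    proof (cases "T = {}")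
      case True
      then show ?thesis using 1 by (subst complete.simps) auto
    next
      case False
      obtain R' T' where st: "completion_step gt pick nf R T = (R', T')" by (cases "completion_step gt pick nf R T")
      note c = completion_step_correct[OF 1(2) False pick st]
      then have "((R', T'), (R, T)) \<in> ?m" by auto
      from 1(1)[OF this] c obtain R'' where "complete gt pick nf R' T' = Some R''" "completion_inv C gt R'' {}"
        "\<forall>r. mcongr C r \<longrightarrow> (R'' \<subseteq> r \<longleftrightarrow> R' \<union> T' \<subseteq> r)" by auto
      then show ?thesis using c False st by (subst complete.simps) auto
    qed
  qed
qed

end

section \<open>Unique normal forms of monomials\<close>

lemma nfm:
  assumes "oriented C gt R" "M \<in> Mon"
  shows "(M, nfm R M) \<in> (mono_rew R)\<^sup>* \<and> nfm R M \<notin> Domain (mono_rew R)"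
  unfolding nfm_def
proof (rule someI_ex)
  show "\<exists>N. (M, N) \<in> (mono_rew R)\<^sup>* \<and> N \<notin> Domain (mono_rew R)"
    using assms(2)
  proof (induction rule: gt_induct)
    case (less M)
    show ?case
    proof (cases "M \<in> Domain (mono_rew R)")
      case True
      then obtain N where N: "(M, N) \<in> mono_rew R" by auto
      then show ?thesis using less(2) mono_rew_gt[OF assms(1) less(1) N] by (meson converse_rtrancl_into_rtrancl)
    qed auto
  qed
qed

text \<open>Newman's lemma with connectedness in place of joinability: in the induction on
  \<open>M\<close>, equational steps between monomials below \<open>M\<close> preserve the normal
  form, so a chain below \<open>M\<close> between two reducts of \<open>M\<close> shows that these
  have the same one.\<close>

lemma nf_unique:
  assumes R: "oriented C gt R" "peaks C gt R R" and M: "M \<in> Mon"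
  shows "(M, N) \<in> (mono_rew R)\<^sup>* \<Longrightarrow> N \<notin> Domain (mono_rew R) \<Longrightarrow> N = nfm R M"
  using M
proof (induction arbitrary: N rule: gt_induct)
  case (less M)
  have below: "nfm R U = nfm R V" if "(U, V) \<in> mono_rew R" "U \<in> Mon" "gt M U" for U V
  proof -
    have V: "V \<in> Mon" "gt U V" using mono_rew_gt[OF R(1) that(2,1)] by auto
    then have "gt M V" using gt_trans less(1) that by blast
    have "(U, nfm R V) \<in> (mono_rew R)\<^sup>*" "nfm R V \<notin> Domain (mono_rew R)"
      using nfm[OF R(1) V(1)] that(1) by (auto intro: converse_rtrancl_into_rtrancl)
    then show ?thesis using less(2)[OF that(2,3)] by simp
  qed
  have conn_nf: "nfm R U = nfm R V" if "(U, V) \<in> conn C gt R M" for U V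
    using that unfolding conn_def
  proof (induction rule: rtrancl_induct)
    case (step V W)
    then obtain P Q D where *: "(P, Q) \<in> R \<or> (Q, P) \<in> R" "V = P + D" "W = Q + D" "set_mset D \<subseteq> C" "gt M V" "gt M W"
      by (auto simp: estep_def)
    then have VW: "V \<in> Mon" "W \<in> Mon" using R(1) by (auto simp: oriented_def intro!: monomials_add)
    have "(V, W) \<in> mono_rew R \<or> (W, V) \<in> mono_rew R" using * mono_rew_iff by metis
    then have "nfm R V = nfm R W" using below VW * by metis
    then show ?case using step by simp
  qed simp
  have step: "nfm R U = nfm R V" if UV: "(M, U) \<in> mono_rew R" "(M, V) \<in> mono_rew R" for U V
  proof -
    obtain A1 A2 D1 where A: "(A1, A2) \<in> R" "M = A1 + D1" "U = A2 + D1" using UV mono_rew_iff by metis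
    obtain B1 B2 D2 where B: "(B1, B2) \<in> R" "M = B1 + D2" "V = B2 + D2" using UV mono_rew_iff by metis
    \<comment> \<open>\<open>D\<close> is what \<open>M\<close> has beyond the least common multiple
      of the two left sides. Disjoint redexes are no special case, as \<open>peaks\<close> speaks of
      all pairs of rules.\<close>
    define D where "D = M - (A1 + (B1 - A1))"
    have le: "A1 + (B1 - A1) \<subseteq># M"
    proof (rule mset_subset_eqI)
      fix a
      have "count A1 a \<le> count M a" using A(2) by simp
      moreover have "count B1 a \<le> count M a" using B(2) by simp
      ultimately show "count (A1 + (B1 - A1)) a \<le> count M a" by simp
    qed
    then have M: "M = A1 + (B1 - A1) + D" by (simp add: D_def)
    have D1: "D1 = (B1 - A1) + D" using A(2) M by (simp add: add.assoc)
    have D2: "D2 = (A1 - B1) + D" using B(2) M lcm_commute[of A1 B1] by (simp add: add.assoc)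
    have D: "set_mset D \<subseteq> C" using less(1) by (auto simp: D_def monomials_def dest: in_diffD)
    have LM: "A1 + (B1 - A1) \<in> Mon" using R(1) A(1) B(1) by (auto simp: oriented_def intro!: monomials_add monomials_diff)
    have "((B1 - A1) + A2, (A1 - B1) + B2) \<in> conn C gt R (A1 + (B1 - A1))"
      using R(2) A(1) B(1) unfolding peaks_def critical_pair_eq by blast
    from conn_add[OF oriented_Mon[OF R(1)] LM D this] have "(U, V) \<in> conn C gt R M"
      using A(3) B(3) D1 D2 M by (simp add: ac_simps)
    then show ?thesis using conn_nf by blast
  qed
  have main: "N' = nfm R U" if "(M, U) \<in> mono_rew R" "(U, N') \<in> (mono_rew R)\<^sup>*" "N' \<notin> Domain (mono_rew R)" for N' U
    using less(2)[of U N'] mono_rew_gt[OF R(1) less(1)] that by auto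
  note nM = nfm[OF R(1) less(1)]
  show ?case
  proof (cases "M \<in> Domain (mono_rew R)")
    case False
    then have "K = M" if "(M, K) \<in> (mono_rew R)\<^sup>*" for K
      using that by (auto elim: converse_rtranclE)
    then have "N = M" "nfm R M = M" using less(3) nM by auto
    then show ?thesis by simp
  next
    case True
    then have "N \<noteq> M" "nfm R M \<noteq> M" using less(4) nM by auto
    then obtain U V where "(M, U) \<in> mono_rew R" "(U, N) \<in> (mono_rew R)\<^sup>*" "(M, V) \<in> mono_rew R" "(V, nfm R M) \<in> (mono_rew R)\<^sup>*"
      using less(3) nM by (metis converse_rtranclE)
    then show ?thesis using main[of U N] main[of V "nfm R M"] step[of U V] less(4) nM by simp
  qed
qed

lemma nfm_steps:
  assumes R: "oriented C gt R" "peaks C gt R R" and M: "M \<in> Mon" and MN: "(M, N) \<in> (mono_rew R)\<^sup>*"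
  shows "nfm R N = nfm R M"
proof -
  have "N \<in> Mon" using mono_steps_ge[OF R(1) M MN] by simp
  then show ?thesis using nf_unique[OF R M, of "nfm R N"] nfm[OF R(1), of N] rtrancl_trans[OF MN] by blast
qed

end

text \<open>Mapping a whole equational proof by \<open>n\<close> does not increase its monomials, so critical pairs of
  rules with canonical left sides stay connected.\<close>

locale constant_normalization = monomial_order C gtC gt
  for C :: "'c set" and gtC :: "'c \<Rightarrow> 'c \<Rightarrow> bool" and gt :: "'c multiset \<Rightarrow> 'c multiset \<Rightarrow> bool" +
  fixes D :: "'c set" and n :: "'c \<Rightarrow> 'c"
  assumes DC: "D \<subseteq> C" and nD: "\<And>c. c \<in> C \<Longrightarrow> n c \<in> D" and nid: "\<And>c. c \<in> D \<Longrightarrow> n c = c"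
    and ngt: "\<And>c. c \<in> C \<Longrightarrow> n c \<noteq> c \<Longrightarrow> gtC c (n c)"
begin

lemma n_mon: "A \<in> Mon \<Longrightarrow> image_mset n A \<in> monomials D"
  using nD by (auto simp: monomials_def)

text \<open>One constant at a time: first the rest \<open>A\<close> is replaced, then
  \<open>x\<close>, each time by an instance of \<open>gt_add\<close>.\<close>

lemma n_le: "A \<in> Mon \<Longrightarrow> image_mset n A = A \<or> gt A (image_mset n A)"
proof (induction A)
  case (add x A)
  have x: "x \<in> C" "n x \<in> C" using add.prems nD DC by (auto simp: monomials_def)
  have 1: "n x = x \<or> gt {#x#} {#n x#}" using ngt gt_const x by blast
  show ?case
  proof (cases "A = {#}")
    case True
    then show ?thesis using 1 by auto
  next
    case False
    then have A: "A \<in> Mon" using add.prems by (auto simp: monomials_def)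
    have nA: "image_mset n A \<in> Mon" using n_mon[OF A] DC monomials_mono by blast
    have "A + {#x#} = image_mset n A + {#x#} \<or> gt (A + {#x#}) (image_mset n A + {#x#})"
      using add.IH[OF A] gt_add[OF A nA, of "{#x#}"] x by auto
    moreover have "{#x#} + image_mset n A = {#n x#} + image_mset n A \<or> gt ({#x#} + image_mset n A) ({#n x#} + image_mset n A)"
      using 1 gt_add[of "{#x#}" "{#n x#}" "image_mset n A"] x nA by (auto simp: monomials_def)
    moreover have "A + {#x#} \<in> Mon" "image_mset n A + {#x#} \<in> Mon" "{#n x#} + image_mset n A \<in> Mon"
      using A nA x by (auto simp: monomials_def)
    ultimately show ?thesis using gt_trans[of "A + {#x#}" "image_mset n A + {#x#}" "{#n x#} + image_mset n A"]
      by (auto simp: ac_simps)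
  qed
qed (simp add: monomials_def)

text \<open>The kept rules need not be turned into equations: their mutual critical pairs are
  connected with the help of the changed ones, which become pending.\<close>

lemma update_inv:
  assumes norm: "normalizer C gt nf" and inv: "completion_inv C gt R {}"
    and kept: "kept = {(A, image_mset n B) | A B. (A, B) \<in> R \<and> image_mset n A = A}"
    and changed: "changed = {(image_mset n A, image_mset n B) | A B. (A, B) \<in> R \<and> image_mset n A \<noteq> A}"
  shows "completion_inv D gt (reduce_rhs nf kept) changed"
    and "\<And>r. mcongr D r \<Longrightarrow> reduce_rhs nf kept \<subseteq> r \<longleftrightarrow> kept \<subseteq> r"
proof -
  have R: "finite R" "oriented C gt R" "left_reduced R" "peaks C gt R R"
    using inv by (auto simp: completion_inv_def)
  interpret D: monomial_order D gtC gt
    using admissible_anti[OF DC adm] finite_subset[OF DC finC] by unfold_locales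
  have normD: "normalizer D gt nf" using normalizer_anti[OF DC norm] .
  have "kept = (\<lambda>(A, B). (A, image_mset n B)) ` {(A, B) \<in> R. image_mset n A = A}"
    "changed = (\<lambda>(A, B). (image_mset n A, image_mset n B)) ` {(A, B) \<in> R. image_mset n A \<noteq> A}"
    using kept changed by auto
  moreover have "finite {(A, B) \<in> R. image_mset n A = A}" "finite {(A, B) \<in> R. image_mset n A \<noteq> A}"
    using R(1) by (auto intro: finite_subset[OF _ R(1)])
  ultimately have fin: "finite kept" "finite changed" by auto
  have ch: "changed \<subseteq> monomials D \<times> monomials D"
    using changed R(2) n_mon by (auto simp: oriented_def)
  have ori: "oriented D gt kept"
    unfolding oriented_def kept
  proof clarify
    fix A B assume AB: "(A, B) \<in> R" "image_mset n A = A"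
    then have m: "A \<in> Mon" "B \<in> Mon" "gt A B" using R(2) by (auto simp: oriented_def)
    have "gt A (image_mset n B)"
      using n_le[OF m(2)] m gt_trans[OF m(1,2) _ m(3)] n_mon[OF m(2)] monomials_mono[OF DC] by metis
    then show "A \<in> monomials D \<and> image_mset n B \<in> monomials D \<and> gt A (image_mset n B)"
      using n_mon m AB(2) by metis
  qed
  have left: "left_reduced kept"
    unfolding left_reduced_def
  proof (intro ballI, clarify)
    fix A B A' B' assume "(A, B) \<in> kept" "(A', B') \<in> kept" "A' \<subseteq># A"
    then show "A' = A \<and> B' = B" using R(3) unfolding left_reduced_def kept by fastforce
  qed
  \<comment> \<open>Only the chain is mapped; the bound \<open>M\<close> stays as it is. Each
    equation goes to its image in \<open>kept\<close> or \<open>changed\<close>.\<close>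
  have sim: "(image_mset n U, image_mset n V) \<in> conn D gt (kept \<union> changed) M"
    if "(U, V) \<in> conn C gt R M" "M \<in> monomials D" for U V M
    using that(1) unfolding conn_def[of C]
  proof (induction rule: rtrancl_induct)
    case (step V W)
    then obtain P Q E where *: "(P, Q) \<in> R \<or> (Q, P) \<in> R" "V = P + E" "W = Q + E" "set_mset E \<subseteq> C" "gt M V" "gt M W"
      by (auto simp: estep_def)
    then have VW: "V \<in> Mon" "W \<in> Mon" using R(2) by (auto simp: oriented_def intro!: monomials_add)
    have M: "M \<in> Mon" using that(2) DC monomials_mono by blast
    have g: "gt M (image_mset n V)" "gt M (image_mset n W)"
      using n_le[OF VW(1)] n_le[OF VW(2)] * gt_trans[OF M VW(1)] gt_trans[OF M VW(2)]
        n_mon[OF VW(1)] n_mon[OF VW(2)] monomials_mono[OF DC] by metis+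
    have K: "(image_mset n P, image_mset n Q) \<in> kept \<union> changed" if "(P, Q) \<in> R" for P Q
      using that unfolding kept changed by (cases "image_mset n P = P") force+
    have "set_mset (image_mset n E) \<subseteq> D" using *(4) nD by auto
    then have "(image_mset n V, image_mset n W) \<in> conn D gt (kept \<union> changed) M"
      using *(1) g conn_step[of "image_mset n P" "image_mset n Q" "kept \<union> changed" "image_mset n E" D gt M]
        conn_step[of "image_mset n Q" "image_mset n P" "kept \<union> changed" "image_mset n E" D gt M] K conn_sym
      by (auto simp: *(2,3))
    then show ?case using step(3) conn_trans by metis
  qed simp
  have "peaks D gt (kept \<union> changed) kept"
    unfolding peaks_def
  proof (intro ballI, clarify)
    fix A1 A2' B1 B2' assume "(A1, A2') \<in> kept" "(B1, B2') \<in> kept"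
    then obtain A2 B2 where AB: "(A1, A2) \<in> R" "image_mset n A1 = A1" "A2' = image_mset n A2"
      "(B1, B2) \<in> R" "image_mset n B1 = B1" "B2' = image_mset n B2" unfolding kept by auto
    have m: "A1 \<in> monomials D" "B1 \<in> monomials D" using AB n_mon[of A1] n_mon[of B1] R(2) by (auto simp: oriented_def)
    then have M: "A1 + (B1 - A1) \<in> monomials D" by (intro monomials_add monomials_diff)
    \<comment> \<open>The left sides of kept rules consist of canonical constants, so in the
      critical pair \<open>n\<close> affects only the right sides.\<close>
    have diff: "image_mset n (B1 - A1) = B1 - A1" "image_mset n (A1 - B1) = A1 - B1"
      using m nid by (auto simp: monomials_def intro!: image_mset_cong[where g = id, simplified] dest: in_diffD)
    have "((B1 - A1) + A2, (A1 - B1) + B2) \<in> conn C gt R (A1 + (B1 - A1))"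
      using R(4) AB unfolding peaks_def critical_pair_eq by blast
    from sim[OF this M] show "critical_pair (A1, A2') (B1, B2') \<in> conn D gt (kept \<union> changed) (A1 + (B1 - A1))"
      unfolding critical_pair_eq using AB diff by simp
  qed
  then show "completion_inv D gt (reduce_rhs nf kept) changed"
    using D.reduce_rhs_inv[OF normD fin(1) ori left fin(2) ch] by blast
  show "\<And>r. mcongr D r \<Longrightarrow> reduce_rhs nf kept \<subseteq> r \<longleftrightarrow> kept \<subseteq> r"
    using D.reduce_rhs_mcongr[OF normD fin(1) ori] .
qed

end

section \<open>Constant and flat rules\<close>

abbreviation cl :: "('c \<times> 'c) set \<Rightarrow> ('c \<times> 'c) set" where
  "cl E \<equiv> (E \<union> E\<inverse>)\<^sup>*"

lemma cl_sym: "(c, d) \<in> cl E \<Longrightarrow> (d, c) \<in> cl E"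
  by (meson sym_Un_converse sym_rtrancl symD)

lemma cl_subset: "E \<subseteq> cl E' \<Longrightarrow> cl E \<subseteq> cl E'"
proof -
  assume E: "E \<subseteq> cl E'"
  then have "E \<union> E\<inverse> \<subseteq> cl E'" using cl_sym[of _ _ E'] by auto
  then show ?thesis by (metis rtrancl_idemp rtrancl_mono)
qed

text \<open>\<open>q\<close> stands for a congruence restricted to constants, and \<open>u\<close>
  for its pairs of a flat term and a constant. A flat term need not be congruent to any constant, so
  \<open>u\<close> is a partial function modulo \<open>q\<close>.\<close>

definition ucongr :: "'c set \<Rightarrow> ('c \<times> 'c) set \<Rightarrow> (('u \<times> 'c list) \<times> 'c) set \<Rightarrow> bool" where
  "ucongr C q u \<longleftrightarrow> (\<forall>c \<in> C. (c, c) \<in> q) \<and> sym q \<and> trans q \<and>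
     (\<forall>h cs cs' d d'. ((h, cs), d) \<in> u \<longrightarrow> list_all2 (\<lambda>c c'. (c, c') \<in> q) cs cs' \<longrightarrow> (d, d') \<in> q
        \<longrightarrow> ((h, cs'), d') \<in> u) \<and>
     (\<forall>l d d'. (l, d) \<in> u \<longrightarrow> (l, d') \<in> u \<longrightarrow> (d, d') \<in> q)"

text \<open>\<open>W\<close> abstracts from the condition on symbol and arity, which the procedures
  on flat rules merely carry along.\<close>

definition U_over :: "'c set \<Rightarrow> ('u \<Rightarrow> nat \<Rightarrow> bool) \<Rightarrow> (('u \<times> 'c list) \<times> 'c) set \<Rightarrow> bool" where
  "U_over D W RU \<longleftrightarrow> (\<forall>((h, cs), d) \<in> RU. set cs \<subseteq> D \<and> d \<in> D \<and> W h (length cs))"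

lemma U_over_mono: "D \<subseteq> C \<Longrightarrow> U_over D W RU \<Longrightarrow> U_over C W RU"
  unfolding U_over_def by fastforce

locale constant_order =
  fixes C :: "'c set" and gtC :: "'c \<Rightarrow> 'c \<Rightarrow> bool"
  assumes tot: "strict_total_on C gtC" and finC: "finite C"
begin

lemma gtC_irrefl: "c \<in> C \<Longrightarrow> \<not> gtC c c"
  using tot by (auto simp: strict_total_on_def irreflp_on_def)

lemma gtC_trans: "c \<in> C \<Longrightarrow> d \<in> C \<Longrightarrow> e \<in> C \<Longrightarrow> gtC c d \<Longrightarrow> gtC d e \<Longrightarrow> gtC c e"
  using tot unfolding strict_total_on_def transp_on_def by blast

lemma gtC_total: "c \<in> C \<Longrightarrow> d \<in> C \<Longrightarrow> c \<noteq> d \<Longrightarrow> gtC c d \<or> gtC d c"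
  using tot unfolding strict_total_on_def totalp_on_def by blast

lemma least_exists:
  assumes "X \<subseteq> C" "X \<noteq> {}"
  shows "\<exists>d \<in> X. \<forall>e \<in> X. e \<noteq> d \<longrightarrow> gtC e d"
proof -
  have "finite X" using assms finC finite_subset by blast
  then show ?thesis using assms(2,1)
  proof (induction X rule: finite_ne_induct)
    case (insert x X)
    then obtain d where d: "d \<in> X" "\<forall>e \<in> X. e \<noteq> d \<longrightarrow> gtC e d" by auto
    have xd: "x \<in> C" "d \<in> C" "X \<subseteq> C" "x \<noteq> d" using insert d by auto
    show ?case
    proof (cases "gtC x d")
      case True
      then show ?thesis using d by blast
    next
      case False
      then have "gtC d x" using gtC_total xd by blast
      then have "\<forall>e \<in> insert x X. e \<noteq> x \<longrightarrow> gtC e x"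
        using d xd gtC_trans by (metis insert_iff subsetD)
      then show ?thesis by blast
    qed
  qed simp
qed

lemma cl_in_C: "E \<subseteq> C \<times> C \<Longrightarrow> c \<in> C \<Longrightarrow> (c, d) \<in> cl E \<Longrightarrow> d \<in> C"
  by (erule rtranclE) auto

lemma rep_props:
  assumes E: "E \<subseteq> C \<times> C" and c: "c \<in> C"
  shows "rep gtC E c \<in> C" "(c, rep gtC E c) \<in> cl E" "(c, e) \<in> cl E \<Longrightarrow> e \<noteq> rep gtC E c \<Longrightarrow> gtC e (rep gtC E c)"
proof -
  let ?P = "\<lambda>d. (c, d) \<in> cl E \<and> (\<forall>e. (c, e) \<in> cl E \<longrightarrow> e \<noteq> d \<longrightarrow> gtC e d)"
  have "\<exists>d \<in> {d. (c, d) \<in> cl E}. \<forall>e \<in> {d. (c, d) \<in> cl E}. e \<noteq> d \<longrightarrow> gtC e d"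
    using cl_in_C[OF E c] by (intro least_exists) auto
  then obtain d where d: "?P d" by blast
  moreover have "d' = d" if "?P d'" for d'
    using that d gtC_trans[of d d' d] gtC_irrefl[of d] cl_in_C[OF E c] by metis
  ultimately have "?P (THE d. ?P d)" by (rule theI)
  then have "?P (rep gtC E c)" unfolding rep_def .
  then show "rep gtC E c \<in> C" "(c, rep gtC E c) \<in> cl E" "(c, e) \<in> cl E \<Longrightarrow> e \<noteq> rep gtC E c \<Longrightarrow> gtC e (rep gtC E c)"
    using cl_in_C[OF E c] by auto
qed

lemma rep_unique:
  assumes E: "E \<subseteq> C \<times> C" "c \<in> C" "(c, d) \<in> cl E" "\<And>e. (c, e) \<in> cl E \<Longrightarrow> e \<noteq> d \<Longrightarrow> gtC e d"
  shows "rep gtC E c = d"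
proof (rule ccontr)
  assume "rep gtC E c \<noteq> d"
  then have "gtC d (rep gtC E c)" "gtC (rep gtC E c) d" using rep_props[OF E(1,2)] E(3,4) by metis+
  moreover have "d \<in> C" "rep gtC E c \<in> C" using cl_in_C[OF E(1,2,3)] rep_props[OF E(1,2)] by auto
  ultimately show False using gtC_trans gtC_irrefl by blast
qed

lemma rep_cl: "E \<subseteq> C \<times> C \<Longrightarrow> c \<in> C \<Longrightarrow> (c, d) \<in> cl E \<Longrightarrow> rep gtC E d = rep gtC E c"
proof -
  assume E: "E \<subseteq> C \<times> C" "c \<in> C" "(c, d) \<in> cl E"
  note r = rep_props[OF E(1,2)]
  have "(d, e) \<in> cl E \<longleftrightarrow> (c, e) \<in> cl E" for e using E(3) cl_sym rtrancl_trans by metis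
  then show ?thesis using r cl_in_C[OF E] E(1) by (intro rep_unique) auto
qed

lemma rep_cong: "cl E = cl E' \<Longrightarrow> rep gtC E = rep gtC E'"
  by (rule ext) (simp add: rep_def)

lemma rep_rep: "E \<subseteq> C \<times> C \<Longrightarrow> c \<in> C \<Longrightarrow> rep gtC E (rep gtC E c) = rep gtC E c"
  using rep_cl rep_props(2) by blast

definition canon :: "('c \<times> 'c) set \<Rightarrow> 'c set" where
  "canon E = {c \<in> C. rep gtC E c = c}"

text \<open>The constant rules are the graph of \<open>rep\<close> without its fixed points: the
  left sides are exactly the noncanonical constants, and the right sides are canonical.\<close>

definition normalized :: "('c \<times> 'c) set \<Rightarrow> bool" where
  "normalized E \<longleftrightarrow> E = {(c, rep gtC E c) | c. c \<in> C \<and> rep gtC E c \<noteq> c}"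

lemma canon_C: "canon E \<subseteq> C"
  by (auto simp: canon_def)

lemma rep_canon: "E \<subseteq> C \<times> C \<Longrightarrow> c \<in> C \<Longrightarrow> rep gtC E c \<in> canon E"
  using rep_rep rep_props(1) by (simp add: canon_def)

text \<open>The measure behind the loops over constants. Two distinct canonical constants that fall
  into a common class cannot both stay canonical, and a larger equivalence makes no constant
  canonical that was not so before.\<close>

lemma canon_less:
  assumes E: "E \<subseteq> C \<times> C" and E': "E' \<subseteq> C \<times> C" and sub: "cl E \<subseteq> cl E'"
    and cd: "(c, d) \<in> cl E'" "c \<noteq> d" "c \<in> canon E" "d \<in> canon E"
  shows "card (canon E') < card (canon E)"
proof (rule psubset_card_mono)
  show "finite (canon E)" using finC by (simp add: canon_def)
  have "canon E' \<subseteq> canon E"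
  proof
    fix x assume "x \<in> canon E'"
    then have x: "x \<in> C" "rep gtC E' x = x" by (auto simp: canon_def)
    have "rep gtC E x = x"
      using rep_props(3)[OF E' x(1)] x sub by (intro rep_unique[OF E x(1)]) auto
    then show "x \<in> canon E" using x by (simp add: canon_def)
  qed
  moreover have "c \<notin> canon E' \<or> d \<notin> canon E'"
    using rep_cl[OF E' _ cd(1)] cd by (auto simp: canon_def)
  ultimately show "canon E' \<subset> canon E" using cd by blast
qed

text \<open>Constants outside the field are alone in their class, so ranging over all of
  \<open>C\<close> adds no rule.\<close>

lemma update_C_eq:
  assumes "RC \<subseteq> C \<times> C" "N \<subseteq> C \<times> C"
  shows "update_C gtC RC N = {(c, rep gtC (RC \<union> N) c) | c. c \<in> C \<and> rep gtC (RC \<union> N) c \<noteq> c}"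
proof -
  have E: "RC \<union> N \<subseteq> C \<times> C" using assms by auto
  have "c \<in> Field (RC \<union> N)" if "c \<in> C" "rep gtC (RC \<union> N) c \<noteq> c" for c
    using rep_props(2)[OF E that(1)] that(2) by (auto simp: Field_def elim: converse_rtranclE)
  moreover have "c \<in> C" if "c \<in> Field (RC \<union> N)" for c using that E by (auto simp: Field_def)
  ultimately show ?thesis unfolding update_C_def by blast
qed

lemma update_C:
  assumes "RC \<subseteq> C \<times> C" "N \<subseteq> C \<times> C"
  shows "update_C gtC RC N \<subseteq> C \<times> C" "cl (update_C gtC RC N) = cl (RC \<union> N)" "normalized (update_C gtC RC N)"
proof -
  let ?U = "update_C gtC RC N"
  have E: "RC \<union> N \<subseteq> C \<times> C" using assms by auto
  note eq = update_C_eq[OF assms]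
  show U: "?U \<subseteq> C \<times> C" using rep_props(1)[OF E] unfolding eq by auto
  have "?U \<subseteq> cl (RC \<union> N)" using rep_props(2)[OF E] unfolding eq by auto
  moreover have "RC \<union> N \<subseteq> cl ?U"
  proof (rule subrelI)
    fix c d assume cd: "(c, d) \<in> RC \<union> N"
    then have c: "c \<in> C" and d: "d \<in> C" using E by auto
    have "(c, d) \<in> cl (RC \<union> N)" using cd by blast
    then have same: "rep gtC (RC \<union> N) d = rep gtC (RC \<union> N) c" using rep_cl[OF E c] by blast
    have r: "(x, rep gtC (RC \<union> N) x) \<in> cl ?U" if "x \<in> C" for x
      using that unfolding eq by (cases "rep gtC (RC \<union> N) x = x") (auto intro!: r_into_rtrancl)
    show "(c, d) \<in> cl ?U" using r[OF c] cl_sym[OF r[OF d]] same by (metis rtrancl_trans)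
  qed
  ultimately show clU: "cl ?U = cl (RC \<union> N)" using cl_subset[of ?U "RC \<union> N"] cl_subset[of "RC \<union> N" ?U] by blast
  show "normalized ?U" unfolding normalized_def rep_cong[OF clU] by (rule eq)
qed

lemma normalized_gt:
  assumes "normalized RC" "RC \<subseteq> C \<times> C" "(c, d) \<in> RC"
  shows "gtC c d" "d \<in> canon RC" "c \<in> C" "c \<notin> canon RC" "d = rep gtC RC c"
proof -
  have cd: "c \<in> C" "d = rep gtC RC c" "rep gtC RC c \<noteq> c" using assms unfolding normalized_def by auto
  then show "gtC c d" using rep_props(3)[OF assms(2) cd(1), of c] by auto
  show "d \<in> canon RC" "c \<in> C" "c \<notin> canon RC" "d = rep gtC RC c" using cd rep_canon[OF assms(2)] by (auto simp: canon_def)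
qed

section \<open>Consequences of constant and flat rules under updates\<close>

lemma ucongr_cl:
  assumes q: "ucongr C q u" and E: "E \<subseteq> q" and c: "c \<in> C" and cd: "(c, d) \<in> cl E"
  shows "(c, d) \<in> q"
  using cd
proof (induction rule: rtrancl_induct)
  case base
  then show ?case using q c by (simp add: ucongr_def)
next
  case (step d e)
  then have "(d, e) \<in> q" using E q unfolding ucongr_def by (meson UnE converseD subsetD symD)
  then show ?case using step(3) q unfolding ucongr_def by (meson transD)
qed

lemma ucongr_same_cl:
  assumes "ucongr C q u" "E \<subseteq> C \<times> C" "E' \<subseteq> C \<times> C" "cl E = cl E'"
  shows "E \<subseteq> q \<longleftrightarrow> E' \<subseteq> q"
proof -
  have "E \<subseteq> q" if "E' \<subseteq> q" "E \<subseteq> C \<times> C" "cl E = cl E'" for E E'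
  proof (rule subrelI)
    fix c d assume cd: "(c, d) \<in> E"
    then have "(c, d) \<in> cl E'" using that(3) by (metis UnI1 r_into_rtrancl)
    then show "(c, d) \<in> q" using ucongr_cl[OF assms(1) that(1)] cd that(2) by blast
  qed
  then show ?thesis using assms by metis
qed

lemma ucongr_rep:
  assumes "ucongr C q u" "E \<subseteq> q" "E \<subseteq> C \<times> C" "c \<in> C"
  shows "(c, rep gtC E c) \<in> q"
  using ucongr_cl[OF assms(1,2,4)] rep_props(2)[OF assms(3,4)] by blast

lemma norm_U_over:
  assumes "E \<subseteq> C \<times> C" "U_over C W RU"
  shows "U_over (canon E) W (norm_U gtC E RU)"
  using assms(2) rep_canon[OF assms(1)] unfolding U_over_def norm_U_def by fastforce

text \<open>Both directions hold because \<open>u\<close> is closed under replacing arguments and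
  value by \<open>q\<close>-related constants.\<close>

lemma norm_U_congr:
  assumes q: "ucongr C q u" and E: "E \<subseteq> q" "E \<subseteq> C \<times> C" and RU: "U_over C W RU"
  shows "norm_U gtC E RU \<subseteq> u \<longleftrightarrow> RU \<subseteq> u"
proof -
  have "((h, map (rep gtC E) cs), rep gtC E d) \<in> u \<longleftrightarrow> ((h, cs), d) \<in> u" if "((h, cs), d) \<in> RU" for h cs d
  proof -
    have cs: "set cs \<subseteq> C" "d \<in> C" using RU that by (auto simp: U_over_def)
    note r = ucongr_rep[OF q E]
    have sym: "(c, c') \<in> q \<Longrightarrow> (c', c) \<in> q" for c c' using q by (auto simp: ucongr_def dest: symD)
    have 1: "list_all2 (\<lambda>c c'. (c, c') \<in> q) cs (map (rep gtC E) cs)"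
      using r subsetD[OF cs(1)] by (auto simp: list_all2_conv_all_nth)
    have 2: "list_all2 (\<lambda>c c'. (c, c') \<in> q) (map (rep gtC E) cs) cs"
      using r subsetD[OF cs(1)] sym by (auto simp: list_all2_conv_all_nth)
    show ?thesis using q 1 2 r[OF cs(2)] sym unfolding ucongr_def by blast
  qed
  then show ?thesis unfolding norm_U_def by fastforce
qed

text \<open>A dropped equation is recovered from the kept one with the same left side and the new
  constant equation between the two right sides.\<close>

lemma merge_U_congr:
  assumes q: "ucongr C q u" and F: "U_over C W F"
  shows "merge_U gtC F \<subseteq> u \<and> new_eqs F \<subseteq> q \<longleftrightarrow> F \<subseteq> u"
proof
  assume "F \<subseteq> u"
  then show "merge_U gtC F \<subseteq> u \<and> new_eqs F \<subseteq> q"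
    using q unfolding merge_U_def new_eqs_def ucongr_def by blast
next
  assume a: "merge_U gtC F \<subseteq> u \<and> new_eqs F \<subseteq> q"
  show "F \<subseteq> u"
  proof (clarify)
    fix h cs d assume hd: "((h, cs), d) \<in> F"
    let ?X = "{d. ((h, cs), d) \<in> F}"
    have cs: "set cs \<subseteq> C" "?X \<subseteq> C" using F hd unfolding U_over_def by auto
    obtain d0 where d0: "((h, cs), d0) \<in> F" "\<forall>e \<in> ?X. e \<noteq> d0 \<longrightarrow> gtC e d0"
      using least_exists[OF cs(2)] hd by blast
    then have "((h, cs), d0) \<in> u" using a unfolding merge_U_def by blast
    moreover have "(d0, d) \<in> q"
    proof (cases "d = d0")
      case True
      then show ?thesis using q cs hd unfolding ucongr_def by blast
    next
      case False
      then have "(d0, d) \<in> new_eqs F" using d0 hd unfolding new_eqs_def by blast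
      then show ?thesis using a by blast
    qed
    moreover have "list_all2 (\<lambda>c c'. (c, c') \<in> q) cs cs"
      using cs q by (auto simp: list_all2_same ucongr_def)
    ultimately show "((h, cs), d) \<in> u" using q unfolding ucongr_def by blast
  qed
qed

text \<open>After normalization only canonical constants occur in the flat rules. A further
  iteration is therefore caused by an equation between distinct canonical constants, and
  \<open>canon_less\<close> makes the measure drop.\<close>

lemma update_U_correct:
  assumes "RC \<subseteq> C \<times> C" "N \<subseteq> C \<times> C" "finite RU" "U_over C W RU"
  shows "\<exists>RC' RU'. update_U gtC RC RU N = Some (RC', RU') \<and> RC' \<subseteq> C \<times> C \<and> normalized RC' \<and>
    cl (RC \<union> N) \<subseteq> cl RC' \<and> finite RU' \<and> U_over (canon RC') W RU' \<and> new_eqs RU' = {} \<and>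
    (\<forall>q u. ucongr C q u \<longrightarrow> (RC' \<subseteq> q \<and> RU' \<subseteq> u \<longleftrightarrow> RC \<union> N \<subseteq> q \<and> RU \<subseteq> u))"
  using assms
proof (induction "card (canon (RC \<union> N))" arbitrary: RC RU N rule: less_induct)
  case less
  define RC1 where "RC1 = update_C gtC RC N"
  define F where "F = norm_U gtC RC1 RU"
  note U = update_C[OF less(2,3), folded RC1_def]
  have E: "RC \<union> N \<subseteq> C \<times> C" using less by auto
  have F: "finite F" "U_over (canon RC1) W F"
    using less(4) norm_U_over[OF U(1) less(5)] by (auto simp: F_def norm_U_def)
  have FC: "U_over C W F" using U_over_mono[OF canon_C F(2)] .
  have m1: "RC1 \<subseteq> q \<and> F \<subseteq> u \<longleftrightarrow> RC \<union> N \<subseteq> q \<and> RU \<subseteq> u" if "ucongr C q u" for q u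
    using ucongr_same_cl[OF that U(1) E U(2)] norm_U_congr[OF that _ U(1) less(5)] by (auto simp: F_def)
  show ?case
  proof (cases "new_eqs F = {}")
    case True
    have "update_U gtC RC RU N = Some (RC1, F)"
      by (subst update_U.simps) (simp add: Let_def RC1_def[symmetric] F_def[symmetric] True)
    then show ?thesis using U F True m1 by auto
  next
    case False
    have up: "update_U gtC RC RU N = update_U gtC RC1 (merge_U gtC F) (new_eqs F)"
      by (subst update_U.simps) (simp add: Let_def RC1_def[symmetric] F_def[symmetric] False)
    have nC: "new_eqs F \<subseteq> canon RC1 \<times> canon RC1" using F(2) unfolding new_eqs_def U_over_def by blast
    then have nCC: "new_eqs F \<subseteq> C \<times> C" using canon_C by blast
    obtain c d where cd: "(c, d) \<in> new_eqs F" using False by auto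
    have "card (canon (RC1 \<union> new_eqs F)) < card (canon RC1)"
    proof (rule canon_less[OF U(1)])
      show "RC1 \<union> new_eqs F \<subseteq> C \<times> C" using U(1) nCC by auto
      show "cl RC1 \<subseteq> cl (RC1 \<union> new_eqs F)" by (rule cl_subset) auto
      show "(c, d) \<in> cl (RC1 \<union> new_eqs F)" using cd by auto
    qed (use cd nC in \<open>auto simp: new_eqs_def\<close>)
    also have "canon RC1 = canon (RC \<union> N)" using rep_cong[OF U(2)] by (simp add: canon_def)
    finally have dec: "card (canon (RC1 \<union> new_eqs F)) < card (canon (RC \<union> N))" .
    have "merge_U gtC F \<subseteq> F" by (auto simp: merge_U_def)
    then have M: "finite (merge_U gtC F)" "U_over C W (merge_U gtC F)"
      using F(1) FC finite_subset[of _ F] subsetD[of _ F] by (auto simp: U_over_def)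
    from less(1)[OF dec U(1) nCC M] obtain RC' RU' where
      *: "update_U gtC RC1 (merge_U gtC F) (new_eqs F) = Some (RC', RU')" "RC' \<subseteq> C \<times> C" "normalized RC'"
      "cl (RC1 \<union> new_eqs F) \<subseteq> cl RC'" "finite RU'" "U_over (canon RC') W RU'" "new_eqs RU' = {}"
      "\<forall>q u. ucongr C q u \<longrightarrow> (RC' \<subseteq> q \<and> RU' \<subseteq> u \<longleftrightarrow> RC1 \<union> new_eqs F \<subseteq> q \<and> merge_U gtC F \<subseteq> u)"
      by auto
    have "RC1 \<union> new_eqs F \<subseteq> q \<and> merge_U gtC F \<subseteq> u \<longleftrightarrow> RC1 \<subseteq> q \<and> F \<subseteq> u" if "ucongr C q u" for q u
      using merge_U_congr[OF that FC] by auto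
    moreover have "cl (RC \<union> N) \<subseteq> cl RC'" using *(4) U(2) cl_subset[of RC1 "RC1 \<union> new_eqs F"] by auto
    ultimately show ?thesis using * m1 up by (intro exI[of _ RC'] exI[of _ RU']) auto
  qed
qed

end

section \<open>The combined algorithm\<close>

lemma mcongr_add:
  "mcongr C r \<Longrightarrow> A \<in> monomials C \<Longrightarrow> B \<in> monomials C \<Longrightarrow> (A, B) \<in> r \<Longrightarrow> set_mset D \<subseteq> C \<Longrightarrow> (A + D, B + D) \<in> r"
  unfolding mcongr_def by blast

locale combined = constant_order C gtC for C :: "'c set" and gtC :: "'c \<Rightarrow> 'c \<Rightarrow> bool" +
  fixes F :: "'f set" and gt :: "'f \<Rightarrow> 'c multiset \<Rightarrow> 'c multiset \<Rightarrow> bool"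
    and pick :: "'f \<Rightarrow> 'c mrules \<Rightarrow> 'c mrules \<Rightarrow> 'c multiset \<times> 'c multiset"
    and nf :: "'f \<Rightarrow> 'c mrules \<Rightarrow> 'c multiset \<Rightarrow> 'c multiset"
  assumes adm: "\<And>f. f \<in> F \<Longrightarrow> admissible C gtC (gt f)"
    and sel: "\<And>f. f \<in> F \<Longrightarrow> selection (pick f)"
    and norm: "\<And>f. f \<in> F \<Longrightarrow> normalizer C (gt f) (nf f)"
begin

text \<open>The components are tied together on constants only, where \<open>q\<close> agrees with
  every \<open>r f\<close>. This is all the interaction between different symbols that the algorithm
  has to propagate.\<close>

definition model :: "('c \<times> 'c) set \<Rightarrow> (('u \<times> 'c list) \<times> 'c) set \<Rightarrow> ('f \<Rightarrow> 'c mrules) \<Rightarrow> bool" where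
  "model q u r \<longleftrightarrow> ucongr C q u \<and> (\<forall>f \<in> F. mcongr C (r f) \<and> (\<forall>c d. (c, d) \<in> q \<longleftrightarrow> ({#c#}, {#d#}) \<in> r f))"

lemma order: "f \<in> F \<Longrightarrow> monomial_order C gtC (gt f)"
  using adm finC by (simp add: monomial_order_def)

lemma normalization:
  assumes "f \<in> F" "RC \<subseteq> C \<times> C"
  shows "constant_normalization C gtC (gt f) (canon RC) (rep gtC RC)"
proof -
  interpret monomial_order C gtC "gt f" using order assms by blast
  show ?thesis
  proof
    show "canon RC \<subseteq> C" by (rule canon_C)
    show "\<And>c. c \<in> C \<Longrightarrow> rep gtC RC c \<in> canon RC" using rep_canon[OF assms(2)] .
    show "\<And>c. c \<in> canon RC \<Longrightarrow> rep gtC RC c = c" by (simp add: canon_def)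
    show "\<And>c. c \<in> C \<Longrightarrow> rep gtC RC c \<noteq> c \<Longrightarrow> gtC c (rep gtC RC c)"
      using rep_props(3)[OF assms(2)] by (metis rtrancl.rtrancl_refl)
  qed
qed

lemma norm_mono_congr:
  assumes m: "model q u r" and f: "f \<in> F" and RC: "RC \<subseteq> q" "RC \<subseteq> C \<times> C" and A: "A \<in> monomials C"
  shows "(A, norm_mono gtC RC A) \<in> r f"
proof -
  have q: "ucongr C q u" and r: "mcongr C (r f)" and qr: "\<And>c d. (c, d) \<in> q \<Longrightarrow> ({#c#}, {#d#}) \<in> r f"
    using m f by (auto simp: model_def)
  show ?thesis using A unfolding norm_mono_def
  proof (induction A)
    case (add x A)
    have x: "x \<in> C" "rep gtC RC x \<in> C" using add.prems rep_props(1)[OF RC(2)] by (auto simp: monomials_def)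
    have 1: "({#x#}, {#rep gtC RC x#}) \<in> r f" using qr ucongr_rep[OF q RC x(1)] by blast
    show ?case
    proof (cases "A = {#}")
      case True
      then show ?thesis using 1 by simp
    next
      case False
      then have A: "A \<in> monomials C" using add.prems by (auto simp: monomials_def)
      let ?A = "image_mset (rep gtC RC) A"
      have nA: "?A \<in> monomials C" using A rep_props(1)[OF RC(2)] by (auto simp: monomials_def)
      have "(A + {#x#}, ?A + {#x#}) \<in> r f" 
        using r add.IH[OF A] A nA x unfolding mcongr_def by (metis empty_subsetI insert_subset set_mset_single)
      moreover have "({#x#} + ?A, {#rep gtC RC x#} + ?A) \<in> r f"
        using x nA by (intro mcongr_add[OF r _ _ 1]) (auto simp: monomials_def)
      ultimately show ?thesis using r unfolding mcongr_def by (auto simp: ac_simps dest: transD)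
    qed
  qed (simp add: monomials_def)
qed

lemma norm_mono_pair:
  assumes m: "model q u r" and f: "f \<in> F" and RC: "RC \<subseteq> q" "RC \<subseteq> C \<times> C" and A: "A \<in> monomials C" "B \<in> monomials C"
  shows "(norm_mono gtC RC A, norm_mono gtC RC B) \<in> r f \<longleftrightarrow> (A, B) \<in> r f"
    and "(A, norm_mono gtC RC B) \<in> r f \<longleftrightarrow> (A, B) \<in> r f"
proof -
  note 1 = norm_mono_congr[OF m f RC A(1)] and 2 = norm_mono_congr[OF m f RC A(2)]
  have s: "sym (r f)" "trans (r f)" using m f by (auto simp: model_def mcongr_def)
  show "(norm_mono gtC RC A, norm_mono gtC RC B) \<in> r f \<longleftrightarrow> (A, B) \<in> r f"
    "(A, norm_mono gtC RC B) \<in> r f \<longleftrightarrow> (A, B) \<in> r f"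
    using 1 2 s by (meson symD transD)+
qed

lemma const_rules_no_self:
  assumes "f \<in> F" "oriented C (gt f) R" "(c, d) \<in> const_rules R"
  shows "c \<noteq> d"
proof -
  interpret monomial_order C gtC "gt f" using order assms by blast
  show ?thesis using assms(2,3) gt_irrefl unfolding const_rules_def oriented_def by auto
qed

text \<open>The hypothesis on \<open>const_rules\<close> justifies the empty answer when nothing has
  to be done: all constants are canonical then, and a constant rule would relate two distinct
  canonical constants of one class.\<close>

lemma update_AC_if_needed_correct:
  assumes f: "f \<in> F" and inv: "completion_inv C (gt f) R {}" and RC: "RC \<subseteq> C \<times> C" and cr: "const_rules R \<subseteq> cl RC"
  shows "\<exists>R' N. update_AC_if_needed gtC (gt f) (pick f) (nf f) R RC = Some (R', N) \<and> N = const_rules R' \<and>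
    completion_inv C (gt f) R' {} \<and> R' \<subseteq> monomials (canon RC) \<times> monomials (canon RC) \<and>
    (\<forall>q u r. model q u r \<longrightarrow> RC \<subseteq> q \<longrightarrow> (R' \<subseteq> r f \<longleftrightarrow> R \<subseteq> r f))"
proof -
  let ?n = "norm_mono gtC RC"
  note admD = admissible_anti[OF canon_C adm[OF f]]
  interpret constant_normalization C gtC "gt f" "canon RC" "rep gtC RC" using normalization[OF f RC] .
  have R: "oriented C (gt f) R" using inv by (simp add: completion_inv_def)
  show ?thesis
  proof (cases "\<exists>(A, B) \<in> R. ?n A \<noteq> A \<or> ?n B \<noteq> B")
    case False
    have sub: "R \<subseteq> monomials (canon RC) \<times> monomials (canon RC)"
    proof (rule subrelI)
      fix A B assume AB: "(A, B) \<in> R"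
      then have "A \<in> monomials C" "B \<in> monomials C" using R by (auto simp: oriented_def)
      moreover have "?n A = A" "?n B = B" using False AB by auto
      ultimately show "(A, B) \<in> monomials (canon RC) \<times> monomials (canon RC)"
        using n_mon[of A] n_mon[of B] by (simp add: norm_mono_def)
    qed
    have "const_rules R = {}"
    proof (rule ccontr)
      assume "const_rules R \<noteq> {}"
      then obtain c d where cd: "(c, d) \<in> const_rules R" by auto
      then have "c \<in> canon RC" "d \<in> canon RC" "(c, d) \<in> cl RC" "c \<noteq> d"
        using sub cr const_rules_no_self[OF f R] by (auto simp: const_rules_def monomials_def)
      then show False using rep_cl[OF RC, of c d] by (auto simp: canon_def)
    qed
    then show ?thesis using False inv sub unfolding update_AC_if_needed_def by auto
  next
    case True
    define kept where "kept = {(A, image_mset (rep gtC RC) B) | A B. (A, B) \<in> R \<and> image_mset (rep gtC RC) A = A}"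
    define changed where "changed = {(image_mset (rep gtC RC) A, image_mset (rep gtC RC) B) | A B. (A, B) \<in> R \<and> image_mset (rep gtC RC) A \<noteq> A}"
    note ui = update_inv[OF norm[OF f] inv kept_def changed_def]
    \<comment> \<open>Completion runs over the canonical constants, so a merged constant cannot come
      back; its invariant is lifted to all constants afterwards.\<close>
    interpret D: monomial_order "canon RC" gtC "gt f"
      using admD finite_subset[OF canon_C finC] by unfold_locales
    have normD: "normalizer (canon RC) (gt f) (nf f)" using normalizer_anti[OF canon_C norm[OF f]] .
    obtain R' where R': "complete (gt f) (pick f) (nf f) (reduce_rhs (nf f) kept) changed = Some R'"
      "completion_inv (canon RC) (gt f) R' {}"
      "\<forall>r. mcongr (canon RC) r \<longrightarrow> (R' \<subseteq> r \<longleftrightarrow> reduce_rhs (nf f) kept \<union> changed \<subseteq> r)"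
      using D.complete_correct[OF normD ui(1) sel[OF f]] by blast
    have up: "update_AC_if_needed gtC (gt f) (pick f) (nf f) R RC = Some (R', const_rules R')"
      using True R'(1) unfolding update_AC_if_needed_def update_AC_def Let_def kept_def changed_def norm_mono_def by simp
    have "R' \<subseteq> monomials (canon RC) \<times> monomials (canon RC)"
      using R'(2) by (auto simp: completion_inv_def oriented_def)
    moreover have "completion_inv C (gt f) R' {}" using completion_inv_mono[OF canon_C R'(2)] .
    moreover have "R' \<subseteq> r f \<longleftrightarrow> R \<subseteq> r f" if m: "model q u r" and q: "RC \<subseteq> q" for q u r
    proof -
      have "mcongr (canon RC) (r f)" using m f mcongr_anti[OF canon_C] by (auto simp: model_def)
      then have "R' \<subseteq> r f \<longleftrightarrow> kept \<union> changed \<subseteq> r f" using R'(3) ui(2) by auto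
      also have "\<dots> \<longleftrightarrow> R \<subseteq> r f"
      proof -
        have *: "(A, B) \<in> r f \<longleftrightarrow> (if ?n A = A then (A, ?n B) \<in> r f else (?n A, ?n B) \<in> r f)" if "(A, B) \<in> R" for A B
          using norm_mono_pair[OF m f q RC, of A B] that R by (auto simp: oriented_def)
        show ?thesis
        proof
          assume kc: "kept \<union> changed \<subseteq> r f"
          show "R \<subseteq> r f"
          proof (rule subrelI)
            fix A B assume AB: "(A, B) \<in> R"
            then have "(if ?n A = A then (A, ?n B) \<in> kept else (?n A, ?n B) \<in> changed)"
              unfolding kept_def changed_def norm_mono_def by auto
            then show "(A, B) \<in> r f" using *[OF AB] kc by (auto split: if_splits)
          qed
        next
          assume Rr: "R \<subseteq> r f"
          show "kept \<union> changed \<subseteq> r f"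
            unfolding kept_def changed_def using * Rr unfolding norm_mono_def by fastforce
        qed
      qed
      finally show ?thesis .
    qed
    ultimately show ?thesis using up by blast
  qed
qed

definition result :: "('u \<Rightarrow> nat \<Rightarrow> bool) \<Rightarrow> ('c \<times> 'c) set \<Rightarrow> (('u \<times> 'c list) \<times> 'c) set \<Rightarrow> ('f \<Rightarrow> 'c mrules) \<Rightarrow> bool" where
  "result W RC RU RF \<longleftrightarrow> RC \<subseteq> C \<times> C \<and> normalized RC \<and> finite RU \<and> U_over (canon RC) W RU \<and> new_eqs RU = {} \<and>
     (\<forall>f \<in> F. completion_inv C (gt f) (RF f) {} \<and> RF f \<subseteq> monomials (canon RC) \<times> monomials (canon RC) \<and>
        const_rules (RF f) = {})"

definition sat where
  "sat q u r RC RU RF \<longleftrightarrow> RC \<subseteq> q \<and> RU \<subseteq> u \<and> (\<forall>f \<in> F. RF f \<subseteq> r f)"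

lemma model_const_rules:
  "model q u r \<Longrightarrow> f \<in> F \<Longrightarrow> R \<subseteq> r f \<Longrightarrow> const_rules R \<subseteq> q"
  unfolding model_def const_rules_def by blast

text \<open>Constant rules found in a round relate distinct canonical constants, so merging them
  lowers the number of canonical ones. A round that finds none ends with all systems over canonical
  constants.\<close>

lemma GCC_loop_correct:
  fixes RU :: "(('u \<times> 'c list) \<times> 'c) set"
  assumes "RC \<subseteq> C \<times> C" "normalized RC" "finite RU" "U_over (canon RC) W RU" "new_eqs RU = {}"
    "\<forall>f \<in> F. completion_inv C (gt f) (RF f) {} \<and> const_rules (RF f) \<subseteq> cl RC"
  shows "\<exists>RC' RU' RF'. GCC_loop F gtC gt pick nf RC RU RF = Some (RC', RU', RF') \<and> result W RC' RU' RF' \<and>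
    (\<forall>q u r. model q u r \<longrightarrow> (sat q u r RC' RU' RF' \<longleftrightarrow> sat q u r RC RU RF))"
  using assms
proof (induction "card (canon RC)" arbitrary: RC RU RF rule: less_induct)
  case less
  let ?up = "\<lambda>f. update_AC_if_needed gtC (gt f) (pick f) (nf f) (RF f) RC"
  have "\<forall>f \<in> F. \<exists>R'. ?up f = Some (R', const_rules R') \<and>
    completion_inv C (gt f) R' {} \<and> R' \<subseteq> monomials (canon RC) \<times> monomials (canon RC) \<and>
    (\<forall>q (u :: (('u \<times> 'c list) \<times> 'c) set) r. model q u r \<longrightarrow> RC \<subseteq> q \<longrightarrow> (R' \<subseteq> r f \<longleftrightarrow> RF f \<subseteq> r f))"
  proof
    fix f assume f: "f \<in> F"
    then have "completion_inv C (gt f) (RF f) {}" "const_rules (RF f) \<subseteq> cl RC" using less(7) by auto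
    from update_AC_if_needed_correct[OF f this(1) less(2) this(2)]
    show "\<exists>R'. ?up f = Some (R', const_rules R') \<and>
      completion_inv C (gt f) R' {} \<and> R' \<subseteq> monomials (canon RC) \<times> monomials (canon RC) \<and>
      (\<forall>q (u :: (('u \<times> 'c list) \<times> 'c) set) r. model q u r \<longrightarrow> RC \<subseteq> q \<longrightarrow> (R' \<subseteq> r f \<longleftrightarrow> RF f \<subseteq> r f))" by auto
  qed
  then obtain RF1 where RF1: "\<And>f. f \<in> F \<Longrightarrow> ?up f = Some (RF1 f, const_rules (RF1 f)) \<and>
    completion_inv C (gt f) (RF1 f) {} \<and> RF1 f \<subseteq> monomials (canon RC) \<times> monomials (canon RC) \<and>
    (\<forall>q (u :: (('u \<times> 'c list) \<times> 'c) set) r. model q u r \<longrightarrow> RC \<subseteq> q \<longrightarrow> (RF1 f \<subseteq> r f \<longleftrightarrow> RF f \<subseteq> r f))"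
    by metis
  define RF' where "RF' = (\<lambda>f. fst (the (?up f)))"
  have RF': "f \<in> F \<Longrightarrow> RF' f = RF1 f" for f using RF1 by (simp add: RF'_def)
  define NN where "NN = (\<Union>f \<in> F. const_rules (RF1 f))"
  have fe: "for_each F ?up = Some (\<lambda>f. the (?up f))" using RF1 by (simp add: for_each_def)
  have NN': "(\<Union>f \<in> F. snd (the (?up f))) = NN" using RF1 by (simp add: NN_def)
  have satRF: "sat q u r RC RU RF' \<longleftrightarrow> sat q u r RC RU RF" if "model q u r" for q u r
    using RF1 RF' that unfolding sat_def by metis
  have loop: "GCC_loop F gtC gt pick nf RC RU RF = (if NN = {} then Some (RC, RU, RF')
           else Option.bind (update_U gtC RC RU (RC \<union> NN)) (\<lambda>p. GCC_loop F gtC gt pick nf (fst p) (snd p) RF'))"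
    by (subst GCC_loop.simps) (simp only: fe NN' RF'_def Let_def Option.bind.simps)
  show ?case
  proof (cases "NN = {}")
    case True
    then have "result W RC RU RF'" using less RF1 RF' unfolding result_def NN_def by auto
    then show ?thesis using loop True satRF by auto
  next
    case False
    have NNc: "NN \<subseteq> canon RC \<times> canon RC" using RF1 unfolding NN_def const_rules_def monomials_def by fastforce
    then have NNC: "RC \<union> NN \<subseteq> C \<times> C" using canon_C less(2) by blast
    obtain RC' RU' where U: "update_U gtC RC RU (RC \<union> NN) = Some (RC', RU')" "RC' \<subseteq> C \<times> C" "normalized RC'"
      "cl (RC \<union> (RC \<union> NN)) \<subseteq> cl RC'" "finite RU'" "U_over (canon RC') W RU'" "new_eqs RU' = {}"
      "\<forall>q u. ucongr C q u \<longrightarrow> (RC' \<subseteq> q \<and> RU' \<subseteq> u \<longleftrightarrow> RC \<union> (RC \<union> NN) \<subseteq> q \<and> RU \<subseteq> u)"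
      using update_U_correct[OF less(2) NNC less(4) U_over_mono[OF canon_C less(5)]] by auto
    have cl: "cl RC \<subseteq> cl RC'" "NN \<subseteq> cl RC'"
      using U(4) cl_subset[of RC "RC \<union> (RC \<union> NN)"] by auto
    obtain f c d where fcd: "f \<in> F" "(c, d) \<in> const_rules (RF1 f)" using False unfolding NN_def by auto
    have cdNN: "(c, d) \<in> NN" using fcd by (auto simp: NN_def)
    have "c \<noteq> d" using const_rules_no_self[OF fcd(1) _ fcd(2)] RF1[OF fcd(1)] by (simp add: completion_inv_def)
    then have dec: "card (canon RC') < card (canon RC)"
      using canon_less[OF less(2) U(2) cl(1), of c d] cdNN NNc cl(2) by auto
    have inv': "\<forall>f \<in> F. completion_inv C (gt f) (RF' f) {} \<and> const_rules (RF' f) \<subseteq> cl RC'"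
      using RF1 RF' cl(2) unfolding NN_def by auto
    obtain RC2 RU2 RF2 where *: "GCC_loop F gtC gt pick nf RC' RU' RF' = Some (RC2, RU2, RF2)" "result W RC2 RU2 RF2"
      "\<forall>q u r. model q u r \<longrightarrow> (sat q u r RC2 RU2 RF2 \<longleftrightarrow> sat q u r RC' RU' RF')"
      using less(1)[OF dec U(2,3,5,6,7) inv'] by auto
    \<comment> \<open>The additional equations handed to \<open>update_U\<close> come from rules of
      \<open>RF'\<close>, so they exclude no model that satisfies these.\<close>
    have "sat q u r RC' RU' RF' \<longleftrightarrow> sat q u r RC RU RF'" if m: "model q u r" for q u r
    proof -
      have "NN \<subseteq> q" if "\<forall>f \<in> F. RF' f \<subseteq> r f"
        using that model_const_rules[OF m] RF' unfolding NN_def by (metis UN_least)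
      moreover have "ucongr C q u" using m by (simp add: model_def)
      ultimately show ?thesis using U(8)[rule_format, of q u] unfolding sat_def by blast
    qed
    then show ?thesis using * satRF loop False U(1) by auto
  qed
qed

lemma GCC_correct:
  fixes SU :: "(('u \<times> 'c list) \<times> 'c) set"
  assumes SC: "SC \<subseteq> C \<times> C" and SU: "finite SU" "U_over C W SU"
    and SF: "\<And>f. f \<in> F \<Longrightarrow> finite (SF f)" "\<And>f. f \<in> F \<Longrightarrow> SF f \<subseteq> monomials C \<times> monomials C"
  shows "\<exists>RC RU RF. GeneralCongruenceClosure F gtC gt pick nf SC SU SF = Some (RC, RU, RF) \<and> result W RC RU RF \<and>
    (\<forall>q u r. model q u r \<longrightarrow> (sat q u r RC RU RF \<longleftrightarrow> sat q u r SC SU SF))"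
proof -
  obtain RC RU where U: "CC gtC SC SU = Some (RC, RU)" "RC \<subseteq> C \<times> C" "normalized RC"
    "finite RU" "U_over (canon RC) W RU" "new_eqs RU = {}"
    "\<forall>q u. ucongr C q u \<longrightarrow> (RC \<subseteq> q \<and> RU \<subseteq> u \<longleftrightarrow> SC \<subseteq> q \<and> SU \<subseteq> u)"
    using update_U_correct[of "{}" SC SU W] SC SU unfolding CC_def by auto
  let ?n = "norm_mono gtC RC"
  let ?S = "\<lambda>f. map_prod ?n ?n ` SF f"
  let ?up = "\<lambda>f. SingleACCompletion (gt f) (pick f) (nf f) (?S f)"
  have "\<exists>R'. ?up f = Some R' \<and> completion_inv C (gt f) R' {} \<and> R' \<subseteq> monomials (canon RC) \<times> monomials (canon RC) \<and>
    (\<forall>q (u :: (('u \<times> 'c list) \<times> 'c) set) r. model q u r \<longrightarrow> RC \<subseteq> q \<longrightarrow> (R' \<subseteq> r f \<longleftrightarrow> SF f \<subseteq> r f))" if f: "f \<in> F" for f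
  proof -
    note admD = admissible_anti[OF canon_C adm[OF f]]
    interpret constant_normalization C gtC "gt f" "canon RC" "rep gtC RC" using normalization[OF f U(2)] .
    interpret D: monomial_order "canon RC" gtC "gt f"
      using admD finite_subset[OF canon_C finC] by unfold_locales
    have normD: "normalizer (canon RC) (gt f) (nf f)" using normalizer_anti[OF canon_C norm[OF f]] .
    have "?S f \<subseteq> monomials (canon RC) \<times> monomials (canon RC)"
      using SF(2)[OF f] n_mon unfolding norm_mono_def by auto
    \<comment> \<open>Without rules there are no peaks to connect.\<close>
    then have "completion_inv (canon RC) (gt f) {} (?S f)"
      using SF(1)[OF f] by (simp add: completion_inv_def oriented_def left_reduced_def right_reduced_def peaks_def)
    from D.complete_correct[OF normD this sel[OF f]]
    obtain R' where R': "?up f = Some R'" "completion_inv (canon RC) (gt f) R' {}"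
      "\<forall>r. mcongr (canon RC) r \<longrightarrow> (R' \<subseteq> r \<longleftrightarrow> ?S f \<subseteq> r)"
      unfolding SingleACCompletion_def by auto
    have "R' \<subseteq> r f \<longleftrightarrow> SF f \<subseteq> r f" if m: "model q u r" and q: "RC \<subseteq> q" for q u r
    proof -
      have "mcongr (canon RC) (r f)" using m f mcongr_anti[OF canon_C] by (auto simp: model_def)
      then have "R' \<subseteq> r f \<longleftrightarrow> ?S f \<subseteq> r f" using R'(3) by blast
      also have "\<dots> \<longleftrightarrow> (\<forall>e \<in> SF f. map_prod ?n ?n e \<in> r f)" by (rule image_subset_iff)
      also have "\<dots> \<longleftrightarrow> (\<forall>e \<in> SF f. e \<in> r f)"
      proof (rule ball_cong[OF HOL.refl])
        fix e assume "e \<in> SF f"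
        then show "map_prod ?n ?n e \<in> r f \<longleftrightarrow> e \<in> r f"
          using norm_mono_pair(1)[OF m f q U(2), of "fst e" "snd e"] SF(2)[OF f] by (cases e) auto
      qed
      finally show ?thesis by blast
    qed
    moreover have "R' \<subseteq> monomials (canon RC) \<times> monomials (canon RC)"
      using R'(2) by (auto simp: completion_inv_def oriented_def)
    ultimately show ?thesis using R'(1) completion_inv_mono[OF canon_C R'(2)] by blast
  qed
  then obtain RF1 where RF1: "\<And>f. f \<in> F \<Longrightarrow> ?up f = Some (RF1 f) \<and> completion_inv C (gt f) (RF1 f) {} \<and>
    RF1 f \<subseteq> monomials (canon RC) \<times> monomials (canon RC) \<and>
    (\<forall>q (u :: (('u \<times> 'c list) \<times> 'c) set) r. model q u r \<longrightarrow> RC \<subseteq> q \<longrightarrow> (RF1 f \<subseteq> r f \<longleftrightarrow> SF f \<subseteq> r f))"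
    by metis
  define RF where "RF = (\<lambda>f. the (?up f))"
  have RF: "f \<in> F \<Longrightarrow> RF f = RF1 f" for f using RF1 by (simp add: RF_def)
  define NN where "NN = (\<Union>f \<in> F. const_rules (RF f))"
  have fe: "for_each F ?up = Some RF" using RF1 by (simp add: for_each_def RF_def)
  have gcc: "GeneralCongruenceClosure F gtC gt pick nf SC SU SF =
     (if update_C gtC RC NN = RC then Some (RC, RU, RF)
      else Option.bind (update_U gtC RC RU NN) (\<lambda>(RC', RU'). GCC_loop F gtC gt pick nf RC' RU' RF))"
    unfolding GeneralCongruenceClosure_def by (simp add: U(1) fe NN_def Let_def)
  have sat1: "sat q u r RC RU RF \<longleftrightarrow> sat q u r SC SU SF" if m: "model q u r" for q u r
  proof -
    have "RC \<subseteq> q \<and> RU \<subseteq> u \<longleftrightarrow> SC \<subseteq> q \<and> SU \<subseteq> u" using U(7) m unfolding model_def by blast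
    moreover have "RF f \<subseteq> r f \<longleftrightarrow> SF f \<subseteq> r f" if "f \<in> F" "RC \<subseteq> q" for f
      using RF1[OF that(1)] RF[OF that(1)] m that(2) by metis
    ultimately show ?thesis unfolding sat_def by blast
  qed
  have NNc: "NN \<subseteq> canon RC \<times> canon RC" using RF1 RF unfolding NN_def const_rules_def monomials_def by fastforce
  then have NNC: "NN \<subseteq> C \<times> C" using canon_C by blast
  show ?thesis
  proof (cases "update_C gtC RC NN = RC")
    case True
    \<comment> \<open>An unchanged \<open>RC\<close> already implies the equations in
      \<open>NN\<close>, yet each of these would relate two distinct canonical constants.\<close>
    have "NN = {}"
    proof (rule ccontr)
      assume "NN \<noteq> {}"
      then obtain f c d where fcd: "f \<in> F" "(c, d) \<in> const_rules (RF f)" unfolding NN_def by auto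
      have "c \<noteq> d" using const_rules_no_self[OF fcd(1) _ fcd(2)] RF1[OF fcd(1)] RF[OF fcd(1)] by (simp add: completion_inv_def)
      have cd: "(c, d) \<in> NN" using fcd by (auto simp: NN_def)
      have "(c, d) \<in> cl RC" using update_C(2)[OF U(2) NNC] True cd by auto
      then have "rep gtC RC d = rep gtC RC c" using rep_cl[OF U(2)] cd NNC by blast
      then show False using cd NNc \<open>c \<noteq> d\<close> by (auto simp: canon_def)
    qed
    then have "result W RC RU RF" using U RF1 RF unfolding result_def NN_def by auto
    then show ?thesis using gcc True sat1 by auto
  next
    case False
    obtain RC' RU' where U': "update_U gtC RC RU NN = Some (RC', RU')" "RC' \<subseteq> C \<times> C" "normalized RC'"
      "cl (RC \<union> NN) \<subseteq> cl RC'" "finite RU'" "U_over (canon RC') W RU'" "new_eqs RU' = {}"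
      "\<forall>q u. ucongr C q u \<longrightarrow> (RC' \<subseteq> q \<and> RU' \<subseteq> u \<longleftrightarrow> RC \<union> NN \<subseteq> q \<and> RU \<subseteq> u)"
      using update_U_correct[OF U(2) NNC U(4) U_over_mono[OF canon_C U(5)]] by auto
    have "NN \<subseteq> cl RC'" using U'(4) by auto
    then have "\<forall>f \<in> F. completion_inv C (gt f) (RF f) {} \<and> const_rules (RF f) \<subseteq> cl RC'"
      using RF1 RF unfolding NN_def by auto
    from GCC_loop_correct[OF U'(2,3,5,6,7) this] obtain RC2 RU2 RF2 where
      *: "GCC_loop F gtC gt pick nf RC' RU' RF = Some (RC2, RU2, RF2)" "result W RC2 RU2 RF2"
      "\<forall>q u r. model q u r \<longrightarrow> (sat q u r RC2 RU2 RF2 \<longleftrightarrow> sat q u r RC' RU' RF)" by auto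
    have "sat q u r RC' RU' RF \<longleftrightarrow> sat q u r RC RU RF" if m: "model q u r" for q u r
    proof -
      have "NN \<subseteq> q" if "\<forall>f \<in> F. RF f \<subseteq> r f"
        using that model_const_rules[OF m] unfolding NN_def by (metis UN_least)
      moreover have "ucongr C q u" using m by (simp add: model_def)
      ultimately show ?thesis using U'(8)[rule_format, of q u] unfolding sat_def by blast
    qed
    then show ?thesis using gcc False U'(1) * sat1 by auto
  qed
qed

end

section \<open>Flat rewrite systems\<close>

text \<open>The demand \<open>2 \<le> size A\<close> makes the kind of a rule visible from its left
  side; a rule between constants falls under the first kind only.\<close>

definition flat_system ::
  "('c, 'u, 'f) signature \<Rightarrow> (('c, 'u, 'f) fterm \<times> ('c, 'u, 'f) fterm) set \<Rightarrow> bool" where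
  "flat_system \<Sigma> R \<longleftrightarrow> (\<forall>(l, r) \<in> R. l \<in> fterms \<Sigma> \<and> r \<in> fterms \<Sigma> \<and>
     ((\<exists>c d. l = FCst c \<and> r = FCst d) \<or>
      (\<exists>h cs d. l = FFun h (map FCst cs) \<and> r = FCst d) \<or>
      (\<exists>f A B. f \<in> ACsyms \<Sigma> \<and> 2 \<le> size A \<and> l = monom f A \<and> r = monom f B)))"

text \<open>Because of \<open>monom f {#c#} = FCst c\<close>, the second clause also makes constant
  rules decrease in every \<open>gt f\<close>.\<close>

definition decreasing ::
  "('c, 'u, 'f) signature \<Rightarrow> ('c \<Rightarrow> 'c \<Rightarrow> bool) \<Rightarrow> ('f \<Rightarrow> 'c multiset \<Rightarrow> 'c multiset \<Rightarrow> bool)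
    \<Rightarrow> (('c, 'u, 'f) fterm \<times> ('c, 'u, 'f) fterm) set \<Rightarrow> bool" where
  "decreasing \<Sigma> gtC gt R \<longleftrightarrow> (\<forall>c d. (FCst c, FCst d) \<in> R \<longrightarrow> gtC c d) \<and>
     (\<forall>f \<in> ACsyms \<Sigma>. \<forall>A B. (monom f A, monom f B) \<in> R \<longrightarrow> gt f A B)"

lemma flat_system_rules: "flat_system \<Sigma> R \<Longrightarrow> flat_rules \<Sigma> R"
  unfolding flat_rules_def
proof (intro ballI, clarify, intro conjI allI impI)
  fix l r assume R: "flat_system \<Sigma> R" and lr: "(l, r) \<in> R"
  show "l \<in> fterms \<Sigma>" "r \<in> fterms \<Sigma>" using R lr by (auto simp: flat_system_def)
  fix f M assume l: "l = FAC f M"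
  then obtain g A B where "2 \<le> size A" "l = monom g A" "r = monom g B"
    using R lr unfolding flat_system_def by fastforce
  moreover from this have "g = f" using l by (simp add: monom_big)
  ultimately show "\<exists>A B. l = monom f A \<and> r = monom f B" by blast
qed

lemma flat_system_fterms:
  "flat_system \<Sigma> R \<Longrightarrow> (l, r) \<in> R \<Longrightarrow> l \<in> fterms \<Sigma> \<and> r \<in> fterms \<Sigma>"
  unfolding flat_system_def by auto

lemma map_FCst_inject: "map FCst cs = map FCst cs' \<longleftrightarrow> cs = cs'"
  by (simp add: inj_map_eq_map inj_def)

lemma flat_system_mono: "R' \<subseteq> R \<Longrightarrow> flat_system \<Sigma> R \<Longrightarrow> flat_system \<Sigma> R'"
  unfolding flat_system_def by (rule ballI) (drule bspec, erule subsetD)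

lemma flat_system_FCst:
  assumes "flat_system \<Sigma> R" "(FCst c, r) \<in> R"
  shows "\<exists>d. r = FCst d"
proof -
  have "(\<exists>d. r = FCst d) \<or> (\<exists>f A. 2 \<le> size A \<and> FCst c = (monom f A :: ('a, 'b, 'c) fterm))"
    using assms unfolding flat_system_def by fastforce
  then show ?thesis by (auto simp: monom_big)
qed

lemma flat_system_FFun:
  assumes "flat_system \<Sigma> R" "(FFun h xs, r) \<in> R"
  shows "\<exists>cs d. xs = map FCst cs \<and> r = FCst d"
proof -
  have "(\<exists>cs d. xs = map FCst cs \<and> r = FCst d) \<or> (\<exists>f A. 2 \<le> size A \<and> FFun h xs = (monom f A :: ('a, 'b, 'c) fterm))"
    using assms unfolding flat_system_def by fastforce
  then show ?thesis by (auto simp: monom_big)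
qed

lemma flat_system_FAC:
  assumes "flat_system \<Sigma> R" "(FAC f M, r) \<in> R"
  shows "\<exists>A B. M = image_mset FCst A \<and> 2 \<le> size A \<and> FAC f M = monom f A \<and> r = monom f B"
proof -
  obtain g A B where *: "2 \<le> size A" "FAC f M = monom g A" "r = monom g B"
    using assms unfolding flat_system_def by fastforce
  then show ?thesis by (auto simp: monom_big)
qed

lemma rew_FCst:
  assumes "flat_system \<Sigma> R" "rew R (FCst c) t"
  shows "(FCst c, t) \<in> R \<and> (\<exists>d. t = FCst d)"
  using assms(2) by cases (use flat_system_FCst[OF assms(1)] in auto)

lemma rew_FFun_flat:
  assumes "flat_system \<Sigma> R" "rew R (FFun h (map FCst cs)) t"
  shows "(FFun h (map FCst cs), t) \<in> R \<or> (\<exists>c \<in> set cs. \<exists>d. (FCst c, FCst d) \<in> R)"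
  using assms(2)
proof cases
  case (fun_arg s t' us vs)
  then have "s \<in> set (map FCst cs)" by (metis in_set_conv_decomp)
  then obtain c where "c \<in> set cs" "s = FCst c" by auto
  then show ?thesis using fun_arg rew_FCst[OF assms(1)] by blast
qed auto

lemma image_FCst_subseteq: "image_mset FCst A \<subseteq># image_mset FCst B \<longleftrightarrow> A \<subseteq># B"
proof
  have i: "image_mset (\<lambda>x. case x of FCst c \<Rightarrow> c | _ \<Rightarrow> undefined) (image_mset FCst X) = X" for X
    by (simp add: multiset.map_comp comp_def)
  assume "image_mset FCst A \<subseteq># image_mset FCst B"
  from image_mset_subseteq_mono[OF this, of "\<lambda>x. case x of FCst c \<Rightarrow> c | _ \<Rightarrow> undefined"]
  show "A \<subseteq># B" by (simp only: i)
qed (rule image_mset_subseteq_mono)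

lemma mkAC_FCst: "mkAC f (image_mset FCst A) = monom f A"
  by (simp add: monom_def)

lemma FAC_eq_monom: "FAC g M = monom f A \<Longrightarrow> g = f \<and> M = image_mset FCst A"
proof -
  assume *: "FAC g M = monom f A"
  have "size A \<noteq> 1"
  proof
    assume "size A = 1"
    then obtain c where "A = {#c#}" using size_1_singleton_mset by blast
    then show False using * by simp
  qed
  then show ?thesis using * by (simp add: monom_big)
qed

text \<open>On monomials, term rewriting is multiset rewriting: a step inside an argument uses a
  constant rule, which is a monomial rule with singleton sides.\<close>

lemma rew_monom:
  assumes R: "flat_system \<Sigma> R" and st: "rew R (monom f A) t"
  shows "\<exists>A' B'. (monom f A', monom f B') \<in> R \<and> A' \<subseteq># A \<and> t = monom f (A - A' + B')"
proof (cases "size A = 1")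
  case True
  then obtain c where A: "A = {#c#}" using size_1_singleton_mset by blast
  then obtain d where "(FCst c, t) \<in> R" "t = FCst d" using rew_FCst[OF R] st by auto
  then show ?thesis using A by (intro exI[of _ "{#c#}"] exI[of _ "{#d#}"]) auto
next
  case False
  have acI: ?thesis if "(monom f A', monom f B') \<in> R" "image_mset FCst A' \<subseteq># image_mset FCst A"
    "t = mkAC f (image_mset FCst A - image_mset FCst A' + image_mset FCst B')" for A' B'
  proof -
    have sub: "A' \<subseteq># A" using that(2) by (simp only: image_FCst_subseteq)
    then have "t = monom f (A - A' + B')"
      using that(3) by (simp only: image_mset_union[symmetric] image_mset_Diff[OF sub, symmetric] mkAC_FCst)
    then show ?thesis using that(1) sub by blast
  qed
  from st show ?thesis
  proof cases
    case root
    then have "(FAC f (image_mset FCst A), t) \<in> R" using False by (simp add: monom_big)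
    from flat_system_FAC[OF R this] obtain B where "t = monom f B" by auto
    then show ?thesis using root by (intro exI[of _ A] exI[of _ B]) auto
  next
    case (ac g A' B' M)
    then show ?thesis using FAC_eq_monom[of g M f A] acI[of A' B'] by metis
  next
    case (fun_arg s t h us vs)
    then show ?thesis using False by (simp add: monom_big)
  next
    case (ac_arg s t' g M)
    then have M: "g = f" "add_mset s M = image_mset FCst A" using FAC_eq_monom[of g "add_mset s M" f A] by auto
    then have "s \<in># image_mset FCst A" by (metis union_single_eq_member)
    then obtain c where c: "c \<in># A" "s = FCst c" by auto
    then obtain d where d: "(FCst c, FCst d) \<in> R" "t' = FCst d" using rew_FCst[OF R] ac_arg(3) by blast
    show ?thesis
    proof (rule acI[of "{#c#}" "{#d#}"])
      show "(monom f {#c#}, monom f {#d#}) \<in> R" using d by simp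
      show "image_mset FCst {#c#} \<subseteq># image_mset FCst A" using c by simp
      have "M = image_mset FCst A - {#FCst c#}" using M(2) c(2) by (metis add_mset_remove_trivial)
      then show "t = mkAC f (image_mset FCst A - image_mset FCst {#c#} + image_mset FCst {#d#})"
        using ac_arg(2) M d by simp
    qed
  qed
qed

text \<open>If \<open>A'\<close> is nonempty and properly contained in \<open>A\<close>, there are
  at least two arguments, so \<open>f(A)\<close> is a genuine \<open>FAC\<close> term to which
  \<open>rew.ac\<close> applies.\<close>

lemma rew_monom_reducible:
  assumes "(monom f A', monom f B') \<in> R" "A' \<subseteq># A" "A' \<noteq> {#}"
  shows "\<exists>t. rew R (monom f A) t"
proof (cases "A' = A")
  case True
  then show ?thesis using assms rew.root by blast
next
  case False
  then have "size A' < size A" using assms(2) by (simp add: mset_subset_size subset_mset.less_le)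
  moreover have "size A' \<noteq> 0" using assms(3) by simp
  ultimately have "size A \<noteq> 1" by linarith
  then show ?thesis using rew.ac[OF assms(1) image_mset_subseteq_mono[OF assms(2)]] monom_big[of A f] by metis
qed

section \<open>Termination\<close>

text \<open>Rules of uninterpreted symbols end in constants, and a \<open>g\<close>-term rewrites to
  a \<open>g\<close>-term or collapses to a constant. Hence an argument step in an
  \<open>f\<close>-term exchanges one argument for one argument, and nothing is merged.\<close>

lemma rew_not_AC_rooted:
  assumes R: "flat_system \<Sigma> R" and st: "rew R s t" and s: "s \<in> fterms \<Sigma>" "ac_args f s = {#s#}"
  shows "ac_args f t = {#t#}"
proof -
  have fR: "flat_rules \<Sigma> R" using R flat_system_rules by blast
  show ?thesis
  proof (cases s)
    case (FCst c)
    then show ?thesis using rew_FCst[OF R] st by force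
  next
    case (FFun h xs)
    from st show ?thesis
    proof cases
      case root
      then show ?thesis using flat_system_FFun[OF R, of h xs t] FFun by auto
    qed (use FFun in auto)
  next
    case (FAC g M)
    have g: "g \<noteq> f" using s FAC fterms_FAC[of g M \<Sigma>] by auto
    have mkg: "ac_args f (mk g N) = {#mk g N#}" if "size N \<noteq> 1" for N
      using that g by (simp add: mk_big)
    have single: "ac_args f (monom g B) = {#monom g B#}" for B
    proof (cases "size B = 1")
      case True
      then obtain c where "B = {#c#}" using size_1_singleton_mset by blast
      then show ?thesis by simp
    qed (use g in \<open>simp add: monom_big\<close>)
    note M = fterms_FAC[OF s(1)[unfolded FAC]]
    from st show ?thesis
    proof cases
      case root
      then show ?thesis using flat_system_FAC[OF R, of g M t] FAC single by auto
    next
      case (ac g' A B M')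
      then have [simp]: "g' = g" "M' = M" using FAC by auto
      let ?N = "M - image_mset FCst A + image_mset FCst B"
      have "\<And>y. y \<in># ?N \<Longrightarrow> ac_args g y = {#y#}" using M by (auto dest: in_diffD)
      then have "mkAC g ?N = mk g ?N" by (rule mkAC_trivial)
      moreover have "t = mkAC g ?N" using ac \<open>g' = g\<close> \<open>M' = M\<close> by metis
      ultimately have t: "t = mk g ?N" by metis
      show ?thesis
      proof (cases "size ?N = 1")
        case True
        \<comment> \<open>As \<open>B\<close> is nonempty, a single remaining argument comes from
          \<open>B\<close> and is a constant.\<close>
        have "monom g B \<in> fterms \<Sigma>" using flat_rules_D(2)[OF fR] ac by simp
        then have "B \<noteq> {#}" by (rule monom_nonempty)
        then obtain b B' where "B = add_mset b B'" by (metis multiset_cases)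
        then have "?N = {#FCst b#}" using True by (auto simp: size_eq_0_iff_empty)
        then show ?thesis using t by simp
      next
        case False
        then show ?thesis using mkg[OF False] t by (simp only:)
      qed
    next
      case (ac_arg u v g' N)
      then have [simp]: "g' = g" "M = add_mset u N" using FAC by auto
      have "u \<in> fterms \<Sigma>" using M by auto
      then have "v \<in> fterms \<Sigma>" using rew_fterms[OF ac_arg(3) fR] by blast
      then have "ac_args g v \<noteq> {#}" by (rule ac_args_nonempty[OF fterms_flat_ac])
      then have v: "size (ac_args g v) \<noteq> 0" by simp
      have N: "ac_args g z = {#z#}" if "z \<in># N" for z using M that by simp
      have "\<Sum>\<^sub># (image_mset (ac_args g) N) = N" by (rule sum_ac_args_trivial) (rule N)
      then have "t = mk g (ac_args g v + N)" using ac_arg by (simp add: mkAC_mk)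
      moreover have "size N \<noteq> 0" using M by auto
      then have "size (ac_args g v + N) \<noteq> 1" using v unfolding size_union by linarith
      ultimately show ?thesis using mkg[of "ac_args g v + N"] by (simp only:) simp
    qed (use FAC in auto)
  qed
qed

text \<open>Provides a well-founded multiset extension of rewriting before rewriting itself is known
  to terminate.\<close>

lemma wf_restrict_acc: "wf {(y, x). (y, x) \<in> r \<and> x \<in> Wellfounded.acc r}"
proof (rule wfUNIVI)
  fix P x
  assume IH: "\<forall>x. (\<forall>y. (y, x) \<in> {(y, x). (y, x) \<in> r \<and> x \<in> Wellfounded.acc r} \<longrightarrow> P y) \<longrightarrow> P x"
  show "P x"
  proof (cases "x \<in> Wellfounded.acc r")
    case True
    then show ?thesis by (induction rule: acc_induct_rule) (use IH in blast)
  next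
    case False
    then show ?thesis using IH by blast
  qed
qed

lemma acc_listrel1_lists:
  "set xs \<subseteq> Wellfounded.acc r \<Longrightarrow> xs \<in> Wellfounded.acc (listrel1 r)"
proof (induction xs)
  case Nil
  show ?case by (rule Wellfounded.accI) simp
qed auto

abbreviation is_cst :: "('c, 'u, 'f) fterm \<Rightarrow> bool" where
  "is_cst x \<equiv> \<exists>c. x = FCst c"

text \<open>Arguments are split into constants and others because AC rules match constants only,
  whereas the others change only by rewriting inside them.\<close>

definition csts :: "('c, 'u, 'f) fterm multiset \<Rightarrow> 'c multiset" where
  "csts Z = image_mset (\<lambda>x. case x of FCst c \<Rightarrow> c | _ \<Rightarrow> undefined) (filter_mset is_cst Z)"

definition others :: "('c, 'u, 'f) fterm multiset \<Rightarrow> ('c, 'u, 'f) fterm multiset" where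
  "others Z = filter_mset (\<lambda>x. \<not> is_cst x) Z"

lemma csts_simps [simp]:
  "csts {#} = {#}" "csts (X + Y) = csts X + csts Y" "csts (image_mset FCst K) = K"
  "csts (add_mset (FCst c) X) = add_mset c (csts X)" "csts (others X) = {#}"
  by (auto simp: csts_def others_def multiset.map_comp comp_def filter_mset_image_mset)

lemma others_simps [simp]:
  "others {#} = {#}" "others (X + Y) = others X + others Y" "others (image_mset FCst K) = {#}"
  "others (add_mset (FCst c) X) = others X" "others (others X) = others X"
  by (auto simp: others_def filter_mset_image_mset intro!: multiset_eqI)

lemma add_nonconst [simp]:
  "\<not> is_cst x \<Longrightarrow> csts (add_mset x X) = csts X" "\<not> is_cst x \<Longrightarrow> others (add_mset x X) = add_mset x (others X)"
  by (auto simp: csts_def others_def)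

lemma csts_others: "Z = others Z + image_mset FCst (csts Z)"
proof (induction Z)
  case (add x Z)
  then show ?case
  proof (cases "is_cst x")
    case True
    then obtain c where "x = FCst c" by auto
    then show ?thesis using add by simp
  next
    case False
    then show ?thesis using add by simp
  qed
qed simp

lemma set_csts: "c \<in># csts Z \<longleftrightarrow> FCst c \<in># Z"
  by (auto simp: csts_def image_iff)

lemma set_others: "x \<in># others Z \<longleftrightarrow> x \<in># Z \<and> \<not> is_cst x"
  by (auto simp: others_def)

locale ordered_signature =
  fixes \<Sigma> :: "('c, 'u, 'f) signature" and gtC :: "'c \<Rightarrow> 'c \<Rightarrow> bool"
    and gt :: "'f \<Rightarrow> 'c multiset \<Rightarrow> 'c multiset \<Rightarrow> bool"
  assumes finC: "finite (Consts \<Sigma>)" and totC: "strict_total_on (Consts \<Sigma>) gtC"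
    and admF: "\<And>f. f \<in> ACsyms \<Sigma> \<Longrightarrow> admissible (Consts \<Sigma>) gtC (gt f)"
begin

lemma orderF: "f \<in> ACsyms \<Sigma> \<Longrightarrow> monomial_order (Consts \<Sigma>) gtC (gt f)"
  using admF finC by (simp add: monomial_order_def)

lemma orderC: "constant_order (Consts \<Sigma>) gtC"
  using totC finC by (simp add: constant_order_def)

text \<open>Arguments of an \<open>f\<close>-term are compared lexicographically: the nonconstant
  ones by the multiset extension of rewriting, then the constants by \<open>gt f\<close>. A step in
  a nonconstant argument may create a constant and so enlarge the second component, but it lowers
  the first; rules for \<open>f\<close> and constant rules lower the second and leave the
  first.\<close>

lemma terminating:
  assumes R: "flat_system \<Sigma> R" and dec: "decreasing \<Sigma> gtC gt R"
  shows "wfp ((rew_on \<Sigma> R)\<inverse>\<inverse>)"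
proof -
  interpret constant_order "Consts \<Sigma>" gtC by (rule orderC)
  have fR: "flat_rules \<Sigma> R" using R flat_system_rules by blast
  define S where "S = {(y, x). rew_on \<Sigma> R x y}"
  have notin: "x \<in> Wellfounded.acc S" if "x \<notin> fterms \<Sigma>" for x
    by (rule Wellfounded.accI) (use that in \<open>auto simp: S_def rew_on_def\<close>)
  have cst: "FCst c \<in> Wellfounded.acc S" for c
  \<comment> \<open>The number of smaller constants decreases along constant rules.\<close>
  proof (induction "card {e \<in> Consts \<Sigma>. gtC c e}" arbitrary: c rule: less_induct)
    case less
    show ?case
    proof (rule Wellfounded.accI)
      fix y assume "(y, FCst c) \<in> S"
      then have c: "c \<in> Consts \<Sigma>" and "rew R (FCst c) y" by (auto simp: S_def rew_on_def fterms_FCst_iff)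
      then obtain d where d: "y = FCst d" "(FCst c, FCst d) \<in> R" using rew_FCst[OF R] by blast
      then have cd: "gtC c d" "d \<in> Consts \<Sigma>"
        using dec flat_rules_D(2)[OF fR d(2)] by (auto simp: decreasing_def fterms_FCst_iff)
      have "{e \<in> Consts \<Sigma>. gtC d e} \<subset> {e \<in> Consts \<Sigma>. gtC c e}"
        using cd c gtC_trans[OF c cd(2)] gtC_irrefl[OF cd(2)] by auto
      then have "card {e \<in> Consts \<Sigma>. gtC d e} < card {e \<in> Consts \<Sigma>. gtC c e}"
        using finC by (intro psubset_card_mono) auto
      then show "y \<in> Wellfounded.acc S" using less d by blast
    qed
  qed
  have acc_step: "y \<in> Wellfounded.acc S" if "x \<in> Wellfounded.acc S" "(y, x) \<in> S" for x y
    using that by (meson Wellfounded.acc_downward)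
  have func: "FFun h xs \<in> Wellfounded.acc S" if "set xs \<subseteq> Wellfounded.acc S" for h xs
    using acc_listrel1_lists[OF that]
  proof (induction rule: acc_induct_rule)
    case (1 xs)
    show ?case
    proof (rule Wellfounded.accI)
      fix y assume "(y, FFun h xs) \<in> S"
      then have x: "FFun h xs \<in> fterms \<Sigma>" and st: "rew R (FFun h xs) y" by (auto simp: S_def rew_on_def)
      from st show "y \<in> Wellfounded.acc S"
      proof cases
        case root
        then show ?thesis using flat_system_FFun[OF R] cst by blast
      next
        case (fun_arg s t us vs)
        then have "s \<in> fterms \<Sigma>" using x by (auto simp: fterms_FFun_iff)
        then have "(t, s) \<in> S" using fun_arg by (auto simp: S_def rew_on_def)
        then have "(us @ t # vs, xs) \<in> listrel1 S" using fun_arg by (auto simp: listrel1_def)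
        then show ?thesis using 1(2) fun_arg by blast
      qed
    qed
  qed
  define S' where "S' = {(y, x). (y, x) \<in> S \<and> x \<in> Wellfounded.acc S}"
  have wfS': "wf S'" unfolding S'_def by (rule wf_restrict_acc)
  have fac: "FAC f Z \<in> Wellfounded.acc S" if "set_mset Z \<subseteq> Wellfounded.acc S" for f Z
  proof (cases "f \<in> ACsyms \<Sigma>")
    case False
    then have "FAC f Z \<notin> fterms \<Sigma>" using fterms_FAC[of f Z \<Sigma>] by auto
    then show ?thesis using notin by blast
  next
    case f: True
    interpret M: monomial_order "Consts \<Sigma>" gtC "gt f" using orderF[OF f] .
    let ?lt = "{(B, A). A \<in> monomials (Consts \<Sigma>) \<and> B \<in> monomials (Consts \<Sigma>) \<and> gt f A B}"
    let ?r = "inv_image (mult1 S' <*lex*> ?lt) (\<lambda>Z. (others Z, csts Z))"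
    have wf: "wf ?r" using wf_mult1[OF wfS'] M.wf_gt by blast
    show ?thesis using that
    proof (induction Z rule: wf_induct_rule[OF wf])
      case (1 Z)
      show ?case
      proof (rule Wellfounded.accI)
        fix y assume "(y, FAC f Z) \<in> S"
        then have x: "FAC f Z \<in> fterms \<Sigma>" and st: "rew R (FAC f Z) y" by (auto simp: S_def rew_on_def)
        note Z = fterms_FAC[OF x]
        have csC: "set_mset (csts Z) \<subseteq> Consts \<Sigma>" using Z by (auto simp: set_csts fterms_FCst_iff[symmetric])
        \<comment> \<open>Used for AC rules and for a constant rule applied to an argument, the
          latter read as a rule between singletons.\<close>
        have mono: "mk f (others Z + image_mset FCst (csts Z - A + B)) \<in> Wellfounded.acc S"
          if AB: "(monom f A, monom f B) \<in> R" "A \<subseteq># csts Z" for A B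
        proof -
          let ?Z = "others Z + image_mset FCst (csts Z - A + B)"
          have mons: "A \<in> monomials (Consts \<Sigma>)" "B \<in> monomials (Consts \<Sigma>)" "gt f A B"
            using flat_rules_D[OF fR AB(1)] fterms_monom_iff[OF f] dec AB(1) f by (auto simp: decreasing_def)
          have eq: "csts Z = A + (csts Z - A)" using AB(2) by simp
          have D: "set_mset (csts Z - A) \<subseteq> Consts \<Sigma>" using csC by (auto dest: in_diffD)
          have "gt f (csts Z) (csts Z - A + B)" using M.gt_add[OF mons D] eq by (simp add: add.commute)
          moreover have "csts Z \<in> monomials (Consts \<Sigma>)" using monomials_add[OF mons(1) D] eq by simp
          moreover have "csts Z - A + B \<in> monomials (Consts \<Sigma>)" using monomials_add2[OF mons(2) D] .
          ultimately have "(csts Z - A + B, csts Z) \<in> ?lt" by blast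
          then have "(?Z, Z) \<in> ?r" by auto
          moreover have "set_mset ?Z \<subseteq> Wellfounded.acc S" using 1(2) cst by (auto simp: set_others)
          ultimately have "FAC f ?Z \<in> Wellfounded.acc S" using 1(1) by blast
          moreover have "mk f ?Z \<in> Wellfounded.acc S" if sz: "size ?Z = 1"
          proof -
            have "B \<noteq> {#}" using mons(2) by (simp add: monomials_def)
            then obtain b B' where "B = add_mset b B'" by (metis multiset_cases)
            then have "?Z = {#FCst b#}" using sz by (auto simp: size_eq_0_iff_empty)
            then show ?thesis using cst by simp
          qed
          ultimately show ?thesis by (cases "size ?Z = 1") (auto simp: mk_big)
        qed
        from st show "y \<in> Wellfounded.acc S"
        proof cases
          case root
          from flat_system_FAC[OF R this] obtain A B where *: "Z = image_mset FCst A" "FAC f Z = monom f A" "y = monom f B" by blast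
          then have "csts Z = A" "others Z = {#}" by simp_all
          then show ?thesis using mono[of A B] root * by (simp add: monom_mk)
        next
          case (ac A B)
          have sub: "A \<subseteq># csts Z"
          proof (rule mset_subset_eqI)
            fix c
            have cnt: "count (csts X) c = count X (FCst c)" for X :: "('c, 'u, 'f) fterm multiset"
            proof (induction X)
              case (add x X)
              then show ?case by (cases x) (auto simp: csts_def)
            qed simp
            show "count A c \<le> count (csts Z) c"
              using mset_subset_eq_count[OF ac(3), of "FCst c"] cnt[of "image_mset FCst A"] cnt[of Z] by simp
          qed
          have "Z - image_mset FCst A = others Z + image_mset FCst (csts Z - A)"
          proof -
            have "Z = others Z + image_mset FCst (csts Z - A) + image_mset FCst A"
              using csts_others[of Z] sub by (simp add: add.assoc flip: image_mset_union)
            then show ?thesis by (metis add_diff_cancel_right')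
          qed
          then have "y = mkAC f (others Z + image_mset FCst (csts Z - A + B))" using ac by (simp add: add.assoc)
          also have "\<dots> = mk f (others Z + image_mset FCst (csts Z - A + B))"
            using Z by (intro mkAC_trivial) (auto simp: set_others)
          finally show ?thesis using mono[OF ac(2) sub] by simp
        next
          case (ac_arg s t N)
          have Zs: "Z = add_mset s N" using ac_arg by simp
          have s: "s \<in> fterms \<Sigma>" "s \<in> Wellfounded.acc S" "ac_args f s = {#s#}" using Z Zs 1(2) by auto
          have tS: "(t, s) \<in> S" using ac_arg s by (auto simp: S_def rew_on_def)
          show ?thesis
          proof (cases "is_cst s")
            case True
            then obtain c where c: "s = FCst c" by auto
            obtain d where d: "(FCst c, FCst d) \<in> R" "t = FCst d" using rew_FCst[OF R] ac_arg(3) c by blast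
            have "y = mk f (add_mset t N)" using ac_arg d Z Zs by (simp, intro mkAC_trivial) auto
            also have "add_mset t N = others Z + image_mset FCst (csts Z - {#c#} + {#d#})"
              using csts_others[of N] d c Zs by simp
            finally show ?thesis using mono[of "{#c#}" "{#d#}"] d c Zs by simp
          next
            case False
            have t: "ac_args f t = {#t#}" using rew_not_AC_rooted[OF R ac_arg(3) s(1,3)] .
            have "y = mk f (add_mset t N)" using ac_arg t Z Zs by (simp, intro mkAC_trivial) auto
            moreover have "size (add_mset t N) \<noteq> 1" using Z Zs by auto
            ultimately have y: "y = FAC f (add_mset t N)" using mk_big by metis
            have tacc: "t \<in> Wellfounded.acc S" using acc_step[OF s(2) tS] .
            have tS': "(t, s) \<in> S'" using tS s by (simp add: S'_def)
            \<comment> \<open>If \<open>t\<close> is a constant it leaves \<open>others\<close>, so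
              \<open>s\<close> is replaced by the empty multiset; otherwise it is replaced by
              \<open>t\<close> alone.\<close>
            have "(others (add_mset t N), others Z) \<in> mult1 S'"
            proof (cases "is_cst t")
              case True
              then show ?thesis using False Zs by (intro mult1I[of _ s "others N" _ "{#}"]) auto
            next
              case t: False
              then show ?thesis using False Zs tS' by (intro mult1I[of _ s "others N" _ "{#t#}"]) auto
            qed
            then have "(add_mset t N, Z) \<in> ?r" by simp
            moreover have "set_mset (add_mset t N) \<subseteq> Wellfounded.acc S" using 1(2) Zs tacc by auto
            ultimately show ?thesis unfolding y using 1(1) by blast
          qed
        qed
      qed
    qed
  qed
  have "x \<in> Wellfounded.acc S" for x
  proof (induction x)
    case (FFun h xs)
    then show ?case using func by blast
  next
    case (FAC f Z)
    then show ?case using fac by blast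
  qed (rule cst)
  then have "wf S" by (simp add: wf_iff_acc)
  then show ?thesis unfolding S_def wfp_def conversep_iff .
qed

end

section \<open>The final system\<close>

text \<open>\<open>R_C\<close>, \<open>R_U\<close>, each system of an AC symbol and their union are
  all instances, with some components left empty, so one proof serves them all.\<close>

locale final_system = ordered_signature \<Sigma> gtC gt
  for \<Sigma> :: "('c, 'u, 'f) signature" and gtC and gt +
  fixes RC :: "('c \<times> 'c) set" and RU :: "(('u \<times> 'c list) \<times> 'c) set" and RF :: "'f \<Rightarrow> 'c mrules"
  assumes RC: "\<And>c d. (c, d) \<in> RC \<Longrightarrow> c \<in> Consts \<Sigma> \<and> d \<in> Consts \<Sigma> - Domain RC \<and> gtC c d"
    and RC_fun: "single_valued RC"
    and RU: "\<And>h cs d. ((h, cs), d) \<in> RU \<Longrightarrow> h \<in> Usyms \<Sigma> \<and> length cs = arity \<Sigma> h \<and>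
      set cs \<subseteq> Consts \<Sigma> - Domain RC \<and> d \<in> Consts \<Sigma> - Domain RC"
    and RU_fun: "single_valued RU"
    and RF: "\<And>f. f \<in> ACsyms \<Sigma> \<Longrightarrow> completion_inv (Consts \<Sigma>) (gt f) (RF f) {}"
    and RF_normal: "\<And>f A B. f \<in> ACsyms \<Sigma> \<Longrightarrow> (A, B) \<in> RF f \<Longrightarrow>
      2 \<le> size A \<and> set_mset A \<inter> Domain RC = {} \<and> set_mset B \<inter> Domain RC = {}"
begin

definition sys :: "(('c, 'u, 'f) fterm \<times> ('c, 'u, 'f) fterm) set" where
  "sys = C_pairs RC \<union> U_pairs RU \<union> (\<Union>f \<in> ACsyms \<Sigma>. AC_pairs f (RF f))"

lemma RF_props:
  assumes "f \<in> ACsyms \<Sigma>" "(A, B) \<in> RF f"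
  shows "A \<in> monomials (Consts \<Sigma>)" "B \<in> monomials (Consts \<Sigma>)" "gt f A B" "2 \<le> size A"
  using RF[OF assms(1)] RF_normal[OF assms] assms(2) unfolding completion_inv_def oriented_def by auto

lemma sys_cases:
  assumes "(l, r) \<in> sys"
  obtains (C) c d where "l = FCst c" "r = FCst d" "(c, d) \<in> RC"
  | (U) h cs d where "l = FFun h (map FCst cs)" "r = FCst d" "((h, cs), d) \<in> RU"
  | (AC) f A B where "f \<in> ACsyms \<Sigma>" "l = monom f A" "r = monom f B" "(A, B) \<in> RF f"
  using assms unfolding sys_def C_pairs_def U_pairs_def AC_pairs_def by blast

lemma sys_FCst: "(FCst c, r) \<in> sys \<longleftrightarrow> (\<exists>d. r = FCst d \<and> (c, d) \<in> RC)"
proof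
  assume "(FCst c, r) \<in> sys"
  then show "\<exists>d. r = FCst d \<and> (c, d) \<in> RC"
  proof (cases rule: sys_cases)
    case (AC f A B)
    then show ?thesis using RF_props(4)[of f A B] by (auto simp: monom_big)
  qed auto
qed (auto simp: sys_def C_pairs_def)

text \<open>A constant rule reappears as a monomial rule with singleton sides for every AC
  symbol.\<close>

lemma sys_monom: "f \<in> ACsyms \<Sigma> \<Longrightarrow> (monom f A, monom f B) \<in> sys \<Longrightarrow>
    (A, B) \<in> RF f \<or> (\<exists>c d. A = {#c#} \<and> B = {#d#} \<and> (c, d) \<in> RC)"
proof -
  assume f: "f \<in> ACsyms \<Sigma>" and AB: "(monom f A, monom f B) \<in> sys"
  show ?thesis
  proof (cases "size A = 1")
    case True
    then obtain c where c: "A = {#c#}" using size_1_singleton_mset by blast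
    then obtain d where d: "monom f B = (FCst d :: ('c, 'u, 'f) fterm)" "(c, d) \<in> RC"
      using AB sys_FCst[of c "monom f B"] by auto
    then have "monom f B = (monom f {#d#} :: ('c, 'u, 'f) fterm)" by simp
    then have "B = {#d#}" by (simp only: monom_inject)
    then show ?thesis using c d by auto
  next
    case False
    from AB show ?thesis
    proof (cases rule: sys_cases)
      case (AC g A' B')
      have "size A' \<noteq> 1" using AC RF_props(4)[of g A' B'] by auto
      then have "g = f \<and> A' = A" using AC False by (simp add: monom_big)
      then show ?thesis using AC by simp
    qed (use False in \<open>auto simp: monom_big\<close>)
  qed
qed

lemma sys_flat: "flat_system \<Sigma> sys"
  unfolding flat_system_def
proof (intro ballI, clarify)
  fix l r assume "(l, r) \<in> sys"
  then show "l \<in> fterms \<Sigma> \<and> r \<in> fterms \<Sigma> \<and>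
     ((\<exists>c d. l = FCst c \<and> r = FCst d) \<or>
      (\<exists>h cs d. l = FFun h (map FCst cs) \<and> r = FCst d) \<or>
      (\<exists>f A B. f \<in> ACsyms \<Sigma> \<and> 2 \<le> size A \<and> l = monom f A \<and> r = monom f B))"
  proof (cases rule: sys_cases)
    case (C c d)
    then show ?thesis using RC[of c d] by (simp add: fterms_FCst_iff)
  next
    case (U h cs d)
    then show ?thesis using RU[of h cs d] by (auto simp: fterms_FCst_iff fterms_FFun_iff simp del: image_iff)
  next
    case (AC f A B)
    then show ?thesis using RF_props[of f A B] by (auto simp: fterms_monom_iff simp del: image_iff)
  qed
qed

lemma sys_decreasing: "decreasing \<Sigma> gtC gt sys"
  unfolding decreasing_def
proof (intro conjI allI ballI impI)
  fix c d assume "(FCst c, FCst d) \<in> sys"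
  then show "gtC c d" using RC by (auto simp: sys_FCst)
next
  fix f A B assume f: "f \<in> ACsyms \<Sigma>" and AB: "(monom f A, monom f B) \<in> sys"
  interpret monomial_order "Consts \<Sigma>" gtC "gt f" using orderF[OF f] .
  show "gt f A B" using sys_monom[OF f AB] RF_props(3)[OF f] RC gt_const by blast
qed

text \<open>Apart from the left sides of \<open>RC\<close>, no constant in a rule belongs to
  \<open>Domain RC\<close>. So only rules of the same kind could interfere, and these are excluded
  by single-valuedness or by reducedness of \<open>RF f\<close>.\<close>

lemma sys_reduced: "reduced sys"
  unfolding reduced_def
proof (intro ballI, clarify)
  fix l r assume lr: "(l, r) \<in> sys"
  let ?R = "sys - {(l, r)}"
  have flat: "flat_system \<Sigma> ?R" using flat_system_mono[OF _ sys_flat] by blast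
  have noC: "\<not> rew ?R (FCst d) t" if "d \<notin> Domain RC" for d t
    using rew_FCst[OF flat, of d t] that sys_FCst[of d t] by blast
  show "(\<nexists>t. rew ?R l t) \<and> (\<nexists>t. rew ?R r t)"
    using lr
  proof (cases rule: sys_cases)
    case (C c d)
    have "\<not> rew ?R (FCst c) t" for t
    proof
      assume "rew ?R (FCst c) t"
      then have "(FCst c, t) \<in> sys" "t \<noteq> r" using rew_FCst[OF flat, of c t] C by auto
      then show False using C RC_fun by (auto simp: sys_FCst single_valued_def)
    qed
    then show ?thesis using C noC RC by blast
  next
    case (U h cs d)
    have "\<not> rew ?R (FFun h (map FCst cs)) t" for t
    proof
      assume "rew ?R (FFun h (map FCst cs)) t"
      then consider "(FFun h (map FCst cs), t) \<in> ?R" | "\<exists>c \<in> set cs. \<exists>d. (FCst c, FCst d) \<in> ?R"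
        using rew_FFun_flat[OF flat] by blast
      then show False
      proof cases
        case 1
        then have t: "(FFun h (map FCst cs), t) \<in> sys" "t \<noteq> r" using U by auto
        from t(1) show False
        proof (cases rule: sys_cases)
          case (U h' cs' d')
          then have "cs' = cs" by (simp add: map_FCst_inject)
          then show ?thesis using U t(2) \<open>((h, cs), d) \<in> RU\<close> \<open>r = FCst d\<close> RU_fun by (auto simp: single_valued_def)
        next
          case (AC f A B)
          then show ?thesis using RF_props(4)[of f A B] by (auto simp: monom_big)
        qed auto
      next
        case 2
        then show False using RU[OF U(3)] sys_FCst by blast
      qed
    qed
    then show ?thesis using U noC RU by blast
  next
    case (AC f A B)
    have inv: "left_reduced (RF f)" "right_reduced (RF f)" using RF[OF AC(1)] by (auto simp: completion_inv_def)
    have c: "c \<notin># A \<and> c \<notin># B" if "(c, d) \<in> RC" for c d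
      using RF_normal[OF AC(1,4)] that by blast
    have "\<not> rew ?R (monom f A) t" for t
    proof
      assume "rew ?R (monom f A) t"
      then obtain A' B' where *: "(monom f A', monom f B') \<in> ?R" "A' \<subseteq># A"
        using rew_monom[OF flat] by blast
      then have "(A', B') \<in> RF f" using sys_monom[OF AC(1), of A' B'] c by auto
      then have "A' = A \<and> B' = B" using inv(1) AC(4) *(2) unfolding left_reduced_def by blast
      then show False using * AC by simp
    qed
    moreover have "\<not> rew ?R (monom f B) t" for t
    proof
      assume "rew ?R (monom f B) t"
      then obtain A' B' where *: "(monom f A', monom f B') \<in> ?R" "A' \<subseteq># B"
        using rew_monom[OF flat] by blast
      then have "(A', B') \<in> RF f" using sys_monom[OF AC(1), of A' B'] c by auto
      then show False using inv(2) AC(4) *(2) unfolding right_reduced_def by blast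
    qed
    ultimately show ?thesis using AC by blast
  qed
qed

section \<open>Evaluation of terms and confluence of the union\<close>

definition nc :: "'c \<Rightarrow> 'c" where
  "nc c = (if c \<in> Domain RC then THE d. (c, d) \<in> RC else c)"

lemma nc: "(c, d) \<in> RC \<Longrightarrow> nc c = d" "c \<notin> Domain RC \<Longrightarrow> nc c = c"
  using RC_fun by (auto simp: nc_def single_valued_def)

text \<open>The empty case is set apart because \<open>{#}\<close> is not a monomial and the facts
  about \<open>nfm\<close> concern monomials.\<close>

definition nrm :: "'f \<Rightarrow> ('c, 'u, 'f) fterm multiset \<Rightarrow> ('c, 'u, 'f) fterm multiset" where
  "nrm f Z = others Z + (if csts Z = {#} then {#} else image_mset FCst (nfm (RF f) (csts Z)))"

fun flat_lhs :: "'u \<Rightarrow> ('c, 'u, 'f) fterm list \<Rightarrow> 'c \<Rightarrow> bool" where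
  "flat_lhs h xs d \<longleftrightarrow> (\<exists>cs. xs = map FCst cs \<and> ((h, cs), d) \<in> RU)"

text \<open>The normal form of a term is its value in the algebra of irreducible flattened terms.\<close>

primrec eval :: "('c, 'u, 'f) trm \<Rightarrow> ('c, 'u, 'f) fterm" where
  "eval (Cst c) = FCst (nc c)"
| "eval (Fun h ts) = (if \<exists>d. flat_lhs h (map eval ts) d then FCst (THE d. flat_lhs h (map eval ts) d)
     else FFun h (map eval ts))"
| "eval (AC f s t) = mk f (nrm f (ac_args f (eval s) + ac_args f (eval t)))"

lemma flat_lhs_unique:
  assumes "flat_lhs h xs d"
  shows "(THE d. flat_lhs h xs d) = d"
proof (rule the_equality)
  show "flat_lhs h xs d" by fact
  fix d' assume "flat_lhs h xs d'"
  then obtain cs cs' where *: "xs = map FCst cs" "((h, cs), d) \<in> RU" "xs = map FCst cs'" "((h, cs'), d') \<in> RU"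
    using assms by auto
  then have "cs = cs'" by (simp add: map_FCst_inject)
  then show "d' = d" using * RU_fun by (auto simp: single_valued_def)
qed

lemma nrm_set: "y \<in># nrm f Z \<Longrightarrow> is_cst y \<or> y \<in># Z"
  by (auto simp: nrm_def set_others split: if_splits)

lemma ac_args_nrm: "(\<And>y. y \<in># Z \<Longrightarrow> ac_args f y = {#y#}) \<Longrightarrow> ac_args f (mk f (nrm f Z)) = nrm f Z"
  by (rule ac_args_mk) (auto dest!: nrm_set)

lemma mono_rew_add: "(M, N) \<in> (mono_rew X)\<^sup>* \<Longrightarrow> (M + D, N + D) \<in> (mono_rew X)\<^sup>*"
proof (induction rule: rtrancl_induct)
  case (step N N')
  then obtain A B E where "(A, B) \<in> X" "N = A + E" "N' = B + E" using mono_rew_iff by metis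
  then have "(N + D, N' + D) \<in> mono_rew X" unfolding mono_rew_iff
    by (intro exI[of _ A] exI[of _ B] exI[of _ "E + D"]) (simp add: add.assoc)
  then show ?case using step by simp
qed simp

lemma nfm_props:
  assumes f: "f \<in> ACsyms \<Sigma>" and K: "K \<in> monomials (Consts \<Sigma>)"
  shows "(K, nfm (RF f) K) \<in> (mono_rew (RF f))\<^sup>*" "nfm (RF f) K \<in> monomials (Consts \<Sigma>)"
    "(K, K') \<in> (mono_rew (RF f))\<^sup>* \<Longrightarrow> nfm (RF f) K' = nfm (RF f) K"
    "set_mset D \<subseteq> Consts \<Sigma> \<Longrightarrow> nfm (RF f) (nfm (RF f) K + D) = nfm (RF f) (K + D)"
proof -
  interpret monomial_order "Consts \<Sigma>" gtC "gt f" using orderF[OF f] .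
  have R: "oriented (Consts \<Sigma>) (gt f) (RF f)" "peaks (Consts \<Sigma>) (gt f) (RF f) (RF f)"
    using RF[OF f] by (auto simp: completion_inv_def)
  show 1: "(K, nfm (RF f) K) \<in> (mono_rew (RF f))\<^sup>*" using nfm[OF R(1) K] by blast
  then show "nfm (RF f) K \<in> monomials (Consts \<Sigma>)" using mono_steps_ge[OF R(1) K] by blast
  show "(K, K') \<in> (mono_rew (RF f))\<^sup>* \<Longrightarrow> nfm (RF f) K' = nfm (RF f) K" using nfm_steps[OF R K] .
  show "nfm (RF f) (nfm (RF f) K + D) = nfm (RF f) (K + D)" if "set_mset D \<subseteq> Consts \<Sigma>"
    using nfm_steps[OF R monomials_add[OF K that] mono_rew_add[OF 1]] .
qed

lemma csts_monomial: "set_mset Z \<subseteq> fterms \<Sigma> \<Longrightarrow> csts Z \<noteq> {#} \<Longrightarrow> csts Z \<in> monomials (Consts \<Sigma>)"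
  by (auto simp: monomials_def set_csts fterms_FCst_iff[symmetric])

lemma csts_Consts: "set_mset Z \<subseteq> fterms \<Sigma> \<Longrightarrow> set_mset (csts Z) \<subseteq> Consts \<Sigma>"
  by (auto simp: set_csts fterms_FCst_iff[symmetric])

text \<open>Normalizing a part first does not change the final value; this makes the evaluation of
  \<open>f\<close> associative.\<close>

lemma nrm_nrm:
  assumes f: "f \<in> ACsyms \<Sigma>" and X: "set_mset X \<subseteq> fterms \<Sigma>" and Y: "set_mset Y \<subseteq> fterms \<Sigma>"
  shows "nrm f (nrm f X + Y) = nrm f (X + Y)"
proof (cases "csts X = {#}")
  case True
  then show ?thesis by (simp add: nrm_def)
next
  case False
  note K = nfm_props[OF f csts_monomial[OF X False]]
  have "nfm (RF f) (csts X) \<noteq> {#}" using K(2) by (simp add: monomials_def)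
  then show ?thesis using False K(4)[OF csts_Consts[OF Y]] by (simp add: nrm_def)
qed

text \<open>A redex contains at least two constants, so every term that is reduced here is a genuine
  \<open>FAC\<close> and \<open>rew.ac\<close> applies; only the last one may have
  collapsed.\<close>

lemma mk_steps:
  assumes f: "f \<in> ACsyms \<Sigma>" and st: "(K, K') \<in> (mono_rew (RF f))\<^sup>*"
    and N: "\<And>y. y \<in># N \<Longrightarrow> ac_args f y = {#y#}" and m: "mk f (N + image_mset FCst K) \<in> fterms \<Sigma>"
  shows "(rew_on \<Sigma> sys)\<^sup>*\<^sup>* (mk f (N + image_mset FCst K)) (mk f (N + image_mset FCst K'))"
  using st
proof (induction rule: rtrancl_induct)
  case (step L L')
  obtain A B E where AB: "(A, B) \<in> RF f" "L = A + E" "L' = B + E" using step(2) mono_rew_iff by metis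
  have ft: "mk f (N + image_mset FCst L) \<in> fterms \<Sigma>"
    using rew_on_steps_fterms[OF step(3) flat_system_rules[OF sys_flat] m] .
  let ?Z = "N + image_mset FCst L"
  have "size ?Z \<noteq> 1" using RF_props(4)[OF f AB(1)] AB(2) by simp
  then have "mk f ?Z = FAC f ?Z" by (rule mk_big)
  moreover have "(monom f A, monom f B) \<in> sys" using AB f by (auto simp: sys_def AC_pairs_def)
  then have "rew sys (FAC f ?Z) (mkAC f (?Z - image_mset FCst A + image_mset FCst B))"
    using AB by (intro rew.ac) auto
  moreover have "?Z - image_mset FCst A + image_mset FCst B = N + image_mset FCst L'"
    using AB by (simp add: ac_simps)
  moreover have "mkAC f (N + image_mset FCst L') = mk f (N + image_mset FCst L')"
    using N by (intro mkAC_trivial) auto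
  ultimately have "rew_on \<Sigma> sys (mk f ?Z) (mk f (N + image_mset FCst L'))"
    using ft by (simp add: rew_on_def)
  then show ?case using step(3) by simp
qed simp

lemma mk_nrm_steps:
  assumes f: "f \<in> ACsyms \<Sigma>" and Z: "\<And>y. y \<in># Z \<Longrightarrow> ac_args f y = {#y#}" "mk f Z \<in> fterms \<Sigma>" "set_mset Z \<subseteq> fterms \<Sigma>"
  shows "(rew_on \<Sigma> sys)\<^sup>*\<^sup>* (mk f Z) (mk f (nrm f Z))"
proof (cases "csts Z = {#}")
  case True
  then show ?thesis using csts_others[of Z] by (simp add: nrm_def)
next
  case False
  have eq: "others Z + image_mset FCst (csts Z) = Z" using csts_others[of Z] by simp
  have "(rew_on \<Sigma> sys)\<^sup>*\<^sup>* (mk f (others Z + image_mset FCst (csts Z)))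
      (mk f (others Z + image_mset FCst (nfm (RF f) (csts Z))))"
    using nfm_props(1)[OF f csts_monomial[OF Z(3) False]] Z(1,2) eq
    by (intro mk_steps[OF f]) (auto simp: set_others)
  then show ?thesis using False eq by (simp add: nrm_def)
qed

text \<open>Links the algebra to rewriting: the arguments are rewritten to their values first, then
  the root is normalized.\<close>

lemma eval_steps: "t \<in> terms \<Sigma> \<Longrightarrow> (rew_on \<Sigma> sys)\<^sup>*\<^sup>* (flatten t) (eval t)"
proof (induction t)
  case (Cst c)
  show ?case
  proof (cases "c \<in> Domain RC")
    case True
    then obtain d where d: "(c, d) \<in> RC" by auto
    then have "rew_on \<Sigma> sys (FCst c) (FCst d)"
      using Cst by (auto simp: rew_on_def sys_FCst terms_iff fterms_FCst_iff simp del: image_iff intro!: rew.root)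
    then show ?thesis using nc d by simp
  qed (simp add: nc)
next
  case (Fun h ts)
  have sub: "set ts \<subseteq> terms \<Sigma>" "Fun h ts \<in> terms \<Sigma>" using Fun by (auto simp: terms_iff)
  then have "FFun h ([] @ map flatten ts) \<in> fterms \<Sigma>" by (metis append_Nil flatten.simps(2) imageI)
  then have st: "(rew_on \<Sigma> sys)\<^sup>*\<^sup>* (FFun h ([] @ map flatten ts)) (FFun h ([] @ map eval ts))"
    using Fun(1) subsetD[OF sub(1)]
    by (intro rew_on_steps_FFun flat_system_rules[OF sys_flat]) (auto simp: list_all2_conv_all_nth)
  show ?case
  proof (cases "\<exists>d. flat_lhs h (map eval ts) d")
    case False
    then show ?thesis using st by (simp del: flat_lhs.simps)
  next
    case True
    then obtain d where d: "flat_lhs h (map eval ts) d" by blast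
    then obtain cs where cs: "map eval ts = map FCst cs" "((h, cs), d) \<in> RU" by auto
    then have "(FFun h (map eval ts), FCst d) \<in> sys" by (auto simp: sys_def U_pairs_def)
    then have "rew_on \<Sigma> sys (FFun h (map eval ts)) (FCst d)"
      using flat_system_fterms[OF sys_flat] by (auto simp: rew_on_def intro: rew.root)
    then have "(rew_on \<Sigma> sys)\<^sup>*\<^sup>* (FFun h (map flatten ts)) (FCst d)" using st by simp
    moreover have "eval (Fun h ts) = FCst d" using d flat_lhs_unique[OF d] by (simp only: eval.simps) auto
    ultimately show ?thesis by simp
  qed
next
  case (AC f s t)
  have st: "s \<in> terms \<Sigma>" "t \<in> terms \<Sigma>" "f \<in> ACsyms \<Sigma>" using AC by (auto simp: terms_iff)
  have fR: "flat_rules \<Sigma> sys" using flat_system_rules[OF sys_flat] .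
  have 1: "(rew_on \<Sigma> sys)\<^sup>*\<^sup>* (mkAC f {#flatten s, flatten t#}) (mkAC f {#eval s, eval t#})"
    using AC st fR by (intro rew_on_steps_mkAC2) auto
  have ev: "eval s \<in> fterms \<Sigma>" "eval t \<in> fterms \<Sigma>"
    using rew_on_steps_fterms[OF _ fR, of "flatten s" "eval s"] rew_on_steps_fterms[OF _ fR, of "flatten t" "eval t"] AC st by simp_all
  let ?Z = "ac_args f (eval s) + ac_args f (eval t)"
  have eq: "mkAC f {#eval s, eval t#} = mk f ?Z" by (simp add: mkAC_mk)
  have Zft: "mk f ?Z \<in> fterms \<Sigma>" using fterms_mkAC_pair[OF st(3) ev] eq by simp
  have Z1: "ac_args f y = {#y#}" if "y \<in># ?Z" for y
    using that[unfolded union_iff]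
    by (elim disjE) (erule ac_args_ac_args[OF fterms_flat_ac[OF ev(1)]] ac_args_ac_args[OF fterms_flat_ac[OF ev(2)]])+
  have "mk f ?Z = FAC f ?Z" using mkAC_pair_FAC[OF fterms_flat_ac[OF ev(1)] fterms_flat_ac[OF ev(2)], of f] eq by simp
  then have "FAC f ?Z \<in> fterms \<Sigma>" using Zft by (simp only:)
  from conjunct1[OF conjunct2[OF fterms_FAC[OF this]]]
  have "set_mset ?Z \<subseteq> fterms \<Sigma>" .
  from mk_nrm_steps[OF st(3) Z1 Zft this] show ?case using 1 eq by simp
qed

lemma eval_fterms: "t \<in> terms \<Sigma> \<Longrightarrow> eval t \<in> fterms \<Sigma>"
  using rew_on_steps_fterms[OF eval_steps flat_system_rules[OF sys_flat]] by blast

lemma ac_args_fterms: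
  assumes "x \<in> fterms \<Sigma>"
  shows "set_mset (ac_args f x) \<subseteq> fterms \<Sigma>"
proof (cases x)
  case (FAC g M)
  then show ?thesis using assms fterms_FAC[of g M \<Sigma>] by auto
qed (use assms in auto)

text \<open>The algebra satisfies AC and evaluation is compositional, so only the equations
  themselves need checking. For associativity, both nestings equal \<open>nrm\<close> of the sum of
  the three argument multisets.\<close>

lemma eval_ACCC:
  assumes E: "\<And>s t. (s, t) \<in> E \<Longrightarrow> s \<in> terms \<Sigma> \<Longrightarrow> t \<in> terms \<Sigma> \<Longrightarrow> eval s = eval t" and st: "(s, t) \<in> ACCC \<Sigma> E"
  shows "eval s = eval t"
  using st
proof (induction rule: ACCC.induct)
  case (assoc f s t u)
  then have tm: "s \<in> terms \<Sigma>" "t \<in> terms \<Sigma>" "u \<in> terms \<Sigma>" "f \<in> ACsyms \<Sigma>" by (auto simp: terms_iff)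
  let ?a = "\<lambda>t. ac_args f (eval t)"
  have a: "set_mset (?a s) \<subseteq> fterms \<Sigma>" "set_mset (?a t) \<subseteq> fterms \<Sigma>" "set_mset (?a u) \<subseteq> fterms \<Sigma>"
    using tm ac_args_fterms[OF eval_fterms] by simp_all
  have triv: "ac_args f y = {#y#}" if "y \<in># ?a v" "v \<in> terms \<Sigma>" for y v
    using ac_args_ac_args[OF fterms_flat_ac[OF eval_fterms[OF that(2)]] that(1)] .
  have 1: "ac_args f (mk f (nrm f (?a s + ?a t))) = nrm f (?a s + ?a t)"
    "ac_args f (mk f (nrm f (?a t + ?a u))) = nrm f (?a t + ?a u)"
    using triv tm by (auto intro!: ac_args_nrm)
  have "nrm f (nrm f (?a s + ?a t) + ?a u) = nrm f (?a s + ?a t + ?a u)"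
    using a tm by (intro nrm_nrm) auto
  moreover have "nrm f (nrm f (?a t + ?a u) + ?a s) = nrm f (?a t + ?a u + ?a s)"
    using a tm by (intro nrm_nrm) auto
  ultimately show ?case using 1 by (simp add: ac_simps)
next
  case (cong_Fun h ss ts)
  then have "map eval ss = map eval ts" by (auto intro!: nth_equalityI)
  then show ?case by (simp del: flat_lhs.simps)
qed (auto simp: add.commute E)

lemma eval_flatten_cong:
  "s \<in> terms \<Sigma> \<Longrightarrow> t \<in> terms \<Sigma> \<Longrightarrow> flatten s = flatten t \<Longrightarrow> eval s = eval t"
  using eval_ACCC[of "{}"] flatten_eq_ACCC[of s \<Sigma> t "{}"] by blast

lemma nfm_single:
  assumes "f \<in> ACsyms \<Sigma>" "c \<in> Consts \<Sigma>"
  shows "nfm (RF f) {#c#} = {#c#}"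
proof -
  have "{#c#} \<notin> Domain (mono_rew (RF f))"
  proof
    assume "{#c#} \<in> Domain (mono_rew (RF f))"
    then obtain A B where "(A, B) \<in> RF f" "A \<subseteq># {#c#}" by (auto simp: Domain_mono_rew)
    then show False using RF_props(4)[OF assms(1)] size_mset_mono[of A "{#c#}"] by fastforce
  qed
  moreover have "({#c#}, nfm (RF f) {#c#}) \<in> (mono_rew (RF f))\<^sup>*"
    using assms by (intro nfm_props(1)) (auto simp: monomials_def)
  ultimately show ?thesis by (metis DomainI converse_rtranclE)
qed

lemma comb_Cst:
  assumes f: "f \<in> ACsyms \<Sigma>" and xs: "xs \<noteq> []" "set xs \<subseteq> Consts \<Sigma>"
  shows "comb f (map Cst xs) \<in> terms \<Sigma>" "flatten (comb f (map Cst xs) :: ('c, 'u, 'f) trm) = monom f (mset xs)"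
proof -
  show "comb f (map Cst xs) \<in> terms \<Sigma>" using assms by (intro comb_terms) (auto simp: terms_iff)
  show "flatten (comb f (map Cst xs) :: ('c, 'u, 'f) trm) = monom f (mset xs)"
    using xs(1)
  proof (induction xs)
    case (Cons x xs)
    show ?case
    proof (cases "xs = []")
      case False
      then have "monom f ({#x#} + mset xs) = (mkAC f {#monom f {#x#}, monom f (mset xs)#} :: ('c, 'u, 'f) fterm)" by (intro monom_plus) auto
      then show ?thesis using False Cons by (simp add: comb_Cons)
    qed simp
  qed simp
qed

text \<open>Evaluates a monomial through one concrete term; by \<open>eval_flatten_cong\<close> any
  other term of the signature with the same flattening has the same value.\<close>

lemma eval_comb:
  assumes f: "f \<in> ACsyms \<Sigma>" and xs: "xs \<noteq> []" "set xs \<subseteq> Consts \<Sigma>" "set xs \<inter> Domain RC = {}"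
  shows "eval (comb f (map Cst xs)) = mk f (image_mset FCst (nfm (RF f) (mset xs)))"
  using xs
proof (induction xs)
  case (Cons x xs)
  have x: "x \<in> Consts \<Sigma>" "nc x = x" using Cons nc(2) by auto
  show ?case
  proof (cases "xs = []")
    case True
    then show ?thesis using x nfm_single[OF f] by simp
  next
    case False
    then have IH: "eval (comb f (map Cst xs)) = mk f (image_mset FCst (nfm (RF f) (mset xs)))" using Cons by simp
    have m: "mset xs \<in> monomials (Consts \<Sigma>)" using False Cons by (auto simp: monomials_def)
    have "ac_args f (mk f (image_mset FCst (nfm (RF f) (mset xs))) :: ('c, 'u, 'f) fterm) = image_mset FCst (nfm (RF f) (mset xs))"
      by (rule ac_args_mk) auto
    moreover have "nfm (RF f) (add_mset x (nfm (RF f) (mset xs))) = nfm (RF f) (add_mset x (mset xs))"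
      using nfm_props(4)[OF f m, of "{#x#}"] x by simp
    ultimately show ?thesis using False x IH by (simp add: comb_Cons nrm_def)
  qed
qed simp

text \<open>Outside the left sides of \<open>RC\<close> all constants are their own values. A flat
  left side is then looked up in \<open>RU\<close>, and the two sides of a monomial rule have the
  same normal form.\<close>

lemma eval_sys:
  assumes "(s, t) \<in> ACCC \<Sigma> (as_equations sys)"
  shows "eval s = eval t"
proof (rule eval_ACCC[OF _ assms])
  fix s t assume st: "(s, t) \<in> as_equations sys" "s \<in> terms \<Sigma>" "t \<in> terms \<Sigma>"
  then have "(flatten s, flatten t) \<in> sys" by (simp add: as_equations_def)
  then show "eval s = eval t"
  proof (cases rule: sys_cases)
    case (C c d)
    have "Cst c \<in> terms \<Sigma>" "Cst d \<in> terms \<Sigma>" using RC[OF C(3)] by (auto simp: terms_iff)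
    then have "eval s = eval (Cst c)" "eval t = eval (Cst d)"
      using st C eval_flatten_cong[of s "Cst c"] eval_flatten_cong[of t "Cst d"] by simp_all
    then show ?thesis using nc C RC[OF C(3)] by auto
  next
    case (U h cs d)
    note u = RU[OF U(3)]
    have "Fun h (map Cst cs) \<in> terms \<Sigma>" "Cst d \<in> terms \<Sigma>" using u by (auto simp: terms_iff)
    then have "eval s = eval (Fun h (map Cst cs))" "eval t = eval (Cst d)"
      using st U eval_flatten_cong[of s "Fun h (map Cst cs)"] eval_flatten_cong[of t "Cst d"] by (simp_all add: comp_def)
    moreover have m: "map eval (map Cst cs) = map FCst cs" using u nc(2) by auto
    have lhs: "flat_lhs h (map eval (map Cst cs)) d" unfolding m using U by auto
    then have "eval (Fun h (map Cst cs)) = FCst d" using flat_lhs_unique[OF lhs] by (simp only: eval.simps) auto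
    moreover have "nc d = d" using u nc(2) by blast
    ultimately show ?thesis by simp
  next
    case (AC f A B)
    note AB = RF_props[OF AC(1,4)] RF_normal[OF AC(1,4)]
    have *: "eval v = mk f (image_mset FCst (nfm (RF f) D))" if D: "D \<in> monomials (Consts \<Sigma>)" "set_mset D \<inter> Domain RC = {}"
      and v: "v \<in> terms \<Sigma>" "flatten v = monom f D" for v D
    proof -
      obtain xs where xs: "mset xs = D" using ex_mset by blast
      then have p: "xs \<noteq> []" "set xs \<subseteq> Consts \<Sigma>" "set xs \<inter> Domain RC = {}" using D by (auto simp: monomials_def)
      have "eval v = eval (comb f (map Cst xs))"
        using comb_Cst[OF AC(1) p(1,2)] v xs by (intro eval_flatten_cong) auto
      then show ?thesis using eval_comb[OF AC(1) p] xs by simp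
    qed
    have "(A, B) \<in> (mono_rew (RF f))\<^sup>*" using AC(4) mono_rew_iff[of A B "RF f"] by (intro r_into_rtrancl) (metis add_0_right)
    then have "nfm (RF f) B = nfm (RF f) A" using nfm_props(3)[OF AC(1) AB(1)] by blast
    then show ?thesis using *[of A s] *[of B t] AB AC st by simp
  qed
qed

lemma sys_canonical: "canonical \<Sigma> sys"
  unfolding canonical_def
proof
  show "wfp (rew_on \<Sigma> sys)\<inverse>\<inverse>" using terminating[OF sys_flat sys_decreasing] .
  show "confluentp (rew_on \<Sigma> sys)"
  proof (rule confluentpI)
    fix x y z assume xy: "(rew_on \<Sigma> sys)\<^sup>*\<^sup>* x y" and xz: "(rew_on \<Sigma> sys)\<^sup>*\<^sup>* x z"
    show "\<exists>w. (rew_on \<Sigma> sys)\<^sup>*\<^sup>* y w \<and> (rew_on \<Sigma> sys)\<^sup>*\<^sup>* z w"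
    proof (cases "x \<in> fterms \<Sigma>")
      case False
      \<comment> \<open>Outside the signature \<open>rew_on\<close> makes no step.\<close>
      then have "y = x" "z = x" using xy xz by (auto elim: converse_rtranclpE simp: rew_on_def)
      then show ?thesis by blast
    next
      case True
      note fR = flat_system_rules[OF sys_flat]
      \<comment> \<open>Being congruent, \<open>y\<close> and \<open>z\<close> have the same value,
        and both rewrite to it.\<close>
      have "(y, z) \<in> fcong \<Sigma> (as_equations sys)"
        using rew_on_steps_fcong[OF xy fR True] rew_on_steps_fcong[OF xz fR True] fcong_sym fcong_trans by metis
      then obtain t u where tu: "(t, u) \<in> ACCC \<Sigma> (as_equations sys)" "y = flatten t" "z = flatten u" by (auto simp: fcong_def)
      then have "eval t = eval u" "t \<in> terms \<Sigma>" "u \<in> terms \<Sigma>" using eval_sys ACCC_terms[OF tu(1)] by auto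
      then show ?thesis using eval_steps tu by metis
    qed
  qed
qed

lemma sys_reduced_canonical: "reduced_canonical \<Sigma> sys"
  using sys_reduced sys_canonical by (simp add: reduced_canonical_def)

end

section \<open>Uniqueness\<close>

definition irreducible :: "(('c, 'u, 'f) fterm \<times> ('c, 'u, 'f) fterm) set \<Rightarrow> ('c, 'u, 'f) fterm \<Rightarrow> bool" where
  "irreducible R x \<longleftrightarrow> (\<nexists>t. rew R x t)"

lemma irreducible_steps: "(rew_on \<Sigma> R)\<^sup>*\<^sup>* x y \<Longrightarrow> irreducible R x \<Longrightarrow> y = x"
  by (erule converse_rtranclpE) (auto simp: irreducible_def rew_on_def)

lemma irreducible_unique:
  assumes R: "flat_system \<Sigma> R" "canonical \<Sigma> R" and xy: "(x, y) \<in> fcong \<Sigma> (as_equations R)"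
    and irr: "irreducible R x" "irreducible R y"
  shows "x = y"
proof -
  have "confluentp (rew_on \<Sigma> R)" using R(2) by (simp add: canonical_def)
  from fcong_joinable[OF flat_system_rules[OF R(1)] this xy] obtain z
    where "(rew_on \<Sigma> R)\<^sup>*\<^sup>* x z" "(rew_on \<Sigma> R)\<^sup>*\<^sup>* y z" by blast
  then show ?thesis using irreducible_steps irr by metis
qed

context ordered_signature
begin

lemma decreasing_monom_steps:
  assumes R: "flat_system \<Sigma> R" "decreasing \<Sigma> gtC gt R" and f: "f \<in> ACsyms \<Sigma>" and A: "A \<in> monomials (Consts \<Sigma>)"
    and st: "(rew_on \<Sigma> R)\<^sup>*\<^sup>* (monom f A) t"
  shows "\<exists>B \<in> monomials (Consts \<Sigma>). t = monom f B \<and> (B = A \<or> gt f A B)"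
  using st
proof (induction rule: rtranclp_induct)
  case base
  then show ?case using A by blast
next
  case (step t t')
  interpret monomial_order "Consts \<Sigma>" gtC "gt f" using orderF[OF f] .
  obtain B where B: "B \<in> Mon" "t = monom f B" "B = A \<or> gt f A B" using step(3) by blast
  have "rew R (monom f B) t'" using step(2) B(2) by (simp add: rew_on_def)
  then obtain A' B' where *: "(monom f A', monom f B') \<in> R" "A' \<subseteq># B" "t' = monom f (B - A' + B')"
    using rew_monom[OF R(1)] by blast
  have m: "A' \<in> Mon" "B' \<in> Mon" "gt f A' B'"
    using flat_system_fterms[OF R(1) *(1)] fterms_monom_iff[OF f] R(2) *(1) f by (auto simp: decreasing_def)
  have D: "set_mset (B - A') \<subseteq> Consts \<Sigma>" using monomials_diff[OF B(1)] .
  have "gt f (A' + (B - A')) (B' + (B - A'))" using gt_add[OF m D] .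
  then have gtB: "gt f B (B - A' + B')" using *(2) by (simp add: add.commute)
  have mem: "B - A' + B' \<in> Mon" using monomials_add2[OF m(2) D] .
  then have "gt f A (B - A' + B')" using gtB B gt_trans[OF A B(1) mem] by blast
  then show ?case using *(3) mem by blast
qed

text \<open>Irreducibility of a monomial depends on the congruence only.\<close>

lemma irreducible_monom_iff:
  assumes R: "flat_system \<Sigma> R" "decreasing \<Sigma> gtC gt R" "canonical \<Sigma> R"
    and f: "f \<in> ACsyms \<Sigma>" and A: "A \<in> monomials (Consts \<Sigma>)"
  shows "irreducible R (monom f A) \<longleftrightarrow>
    (\<forall>B \<in> monomials (Consts \<Sigma>). (monom f A, monom f B) \<in> fcong \<Sigma> (as_equations R) \<longrightarrow> B = A \<or> gt f B A)"
    (is "?L \<longleftrightarrow> ?P")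
proof
  interpret monomial_order "Consts \<Sigma>" gtC "gt f" using orderF[OF f] .
  have Aft: "monom f A \<in> fterms \<Sigma>" using fterms_monom_iff[OF f] A by blast
  note fR = flat_system_rules[OF R(1)]
  show ?P if L: ?L
  proof (intro ballI impI)
    fix B assume B: "B \<in> Mon" and AB: "(monom f A, monom f B) \<in> fcong \<Sigma> (as_equations R)"
    have "confluentp (rew_on \<Sigma> R)" using R(3) by (simp add: canonical_def)
    from fcong_joinable[OF fR this AB] obtain z
      where "(rew_on \<Sigma> R)\<^sup>*\<^sup>* (monom f A) z" "(rew_on \<Sigma> R)\<^sup>*\<^sup>* (monom f B) z" by blast
    then have "(rew_on \<Sigma> R)\<^sup>*\<^sup>* (monom f B) (monom f A)" using irreducible_steps L by metis
    from decreasing_monom_steps[OF R(1,2) f B this] show "B = A \<or> gt f B A" by auto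
  qed
  show ?L if P: ?P
    unfolding irreducible_def
  proof
    assume "\<exists>t. rew R (monom f A) t"
    then obtain t where t: "rew R (monom f A) t" by blast
    then obtain A' B' where *: "(monom f A', monom f B') \<in> R" "A' \<subseteq># A" "t = monom f (A - A' + B')"
      using rew_monom[OF R(1)] by blast
    have m: "A' \<in> Mon" "B' \<in> Mon" "gt f A' B'"
      using flat_system_fterms[OF R(1) *(1)] fterms_monom_iff[OF f] R(2) *(1) f by (auto simp: decreasing_def)
    have D: "set_mset (A - A') \<subseteq> Consts \<Sigma>" using monomials_diff[OF A] .
    have "gt f (A' + (A - A')) (B' + (A - A'))" using gt_add[OF m D] .
    then have g: "gt f A (A - A' + B')" using *(2) by (simp add: add.commute)
    have mem: "A - A' + B' \<in> Mon" using monomials_add2[OF m(2) D] .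
    have "(monom f A, monom f (A - A' + B')) \<in> fcong \<Sigma> (as_equations R)"
      using rew_fcong[OF t fR Aft] *(3) by simp
    then have "A - A' + B' = A \<or> gt f (A - A' + B') A" using P mem by blast
    then show False using g gt_irrefl[OF A] gt_trans[OF A mem A] by auto
  qed
qed

text \<open>The analogue for constants and \<open>gtC\<close>. It is not an instance of the
  statement on monomials, since there may be no AC symbol.\<close>

lemma irreducible_const_iff:
  assumes R: "flat_system \<Sigma> R" "decreasing \<Sigma> gtC gt R" "canonical \<Sigma> R" and c: "c \<in> Consts \<Sigma>"
  shows "irreducible R (FCst c) \<longleftrightarrow>
    (\<forall>d \<in> Consts \<Sigma>. (FCst c, FCst d) \<in> fcong \<Sigma> (as_equations R) \<longrightarrow> d = c \<or> gtC d c)"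
    (is "?L \<longleftrightarrow> ?P")
proof
  interpret constant_order "Consts \<Sigma>" gtC by (rule orderC)
  note fR = flat_system_rules[OF R(1)]
  have step: "\<exists>e \<in> Consts \<Sigma>. t = FCst e \<and> gtC d e" if "rew R (FCst d) t" for d t
  proof -
    have *: "(FCst d, t) \<in> R" "\<exists>e. t = FCst e" using rew_FCst[OF R(1) that] by auto
    then obtain e where "t = FCst e" by blast
    then show ?thesis using * R(2) flat_system_fterms[OF R(1) *(1)] by (auto simp: decreasing_def fterms_FCst_iff simp del: image_iff)
  qed
  have steps: "\<exists>e \<in> Consts \<Sigma>. t = FCst e \<and> (e = d \<or> gtC d e)" if "(rew_on \<Sigma> R)\<^sup>*\<^sup>* (FCst d) t" "d \<in> Consts \<Sigma>" for d t
    using that(1)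
  proof (induction rule: rtranclp_induct)
    case (step u v)
    then obtain e where e: "e \<in> Consts \<Sigma>" "u = FCst e" "e = d \<or> gtC d e" by blast
    then obtain e' where "e' \<in> Consts \<Sigma>" "v = FCst e'" "gtC e e'"
      using \<open>\<And>t d. rew R (FCst d) t \<Longrightarrow> \<exists>e \<in> Consts \<Sigma>. t = FCst e \<and> gtC d e\<close> step(2) by (auto simp: rew_on_def)
    then show ?case using e gtC_trans[OF that(2) e(1)] by blast
  qed (use that in blast)
  show ?P if L: ?L
  proof (intro ballI impI)
    fix d assume d: "d \<in> Consts \<Sigma>" and cd: "(FCst c, FCst d) \<in> fcong \<Sigma> (as_equations R)"
    have "confluentp (rew_on \<Sigma> R)" using R(3) by (simp add: canonical_def)
    from fcong_joinable[OF fR this cd] obtain z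
      where "(rew_on \<Sigma> R)\<^sup>*\<^sup>* (FCst c) z" "(rew_on \<Sigma> R)\<^sup>*\<^sup>* (FCst d) z" by blast
    then have "(rew_on \<Sigma> R)\<^sup>*\<^sup>* (FCst d) (FCst c)" using irreducible_steps L by metis
    from steps[OF this d] show "d = c \<or> gtC d c" by auto
  qed
  show ?L if P: ?P
    unfolding irreducible_def
  proof
    assume "\<exists>t. rew R (FCst c) t"
    then obtain t where t: "rew R (FCst c) t" by blast
    then obtain e where e: "e \<in> Consts \<Sigma>" "t = FCst e" "gtC c e" using step by blast
    have "(FCst c, FCst e) \<in> fcong \<Sigma> (as_equations R)"
      using rew_fcong[OF t fR] c e by (simp add: fterms_FCst_iff)
    then have "e = c \<or> gtC e c" using P e by blast
    then show False using e gtC_irrefl[OF c] gtC_trans[OF c e(1) c] by auto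
  qed
qed

lemma system_cases:
  assumes "flat_system \<Sigma> R" "(l, r) \<in> R"
  obtains (C) c d where "l = FCst c" "r = FCst d" "c \<in> Consts \<Sigma>" "d \<in> Consts \<Sigma>"
  | (U) h cs d where "l = FFun h (map FCst cs)" "r = FCst d" "set cs \<subseteq> Consts \<Sigma>" "d \<in> Consts \<Sigma>"
  | (AC) f A B where "f \<in> ACsyms \<Sigma>" "2 \<le> size A" "l = monom f A" "r = monom f B"
    "A \<in> monomials (Consts \<Sigma>)" "B \<in> monomials (Consts \<Sigma>)"
proof -
  have lr: "l \<in> fterms \<Sigma>" "r \<in> fterms \<Sigma>" using flat_system_fterms[OF assms] by auto
  have "(\<exists>c d. l = FCst c \<and> r = FCst d) \<or> (\<exists>h cs d. l = FFun h (map FCst cs) \<and> r = FCst d) \<or>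
      (\<exists>f A B. f \<in> ACsyms \<Sigma> \<and> 2 \<le> size A \<and> l = monom f A \<and> r = monom f B)"
    using assms(1)[unfolded flat_system_def, rule_format, OF assms(2)] by simp
  then show thesis
  proof (elim disjE exE conjE)
    fix c d assume "l = FCst c" "r = FCst d"
    then show thesis using lr that(1) by (simp add: fterms_FCst_iff)
  next
    fix h cs d assume *: "l = FFun h (map FCst cs)" "r = FCst d"
    have "FCst ` set cs \<subseteq> fterms \<Sigma>" using lr(1) * by (simp add: fterms_FFun_iff)
    then have "set cs \<subseteq> Consts \<Sigma>" by (auto simp flip: fterms_FCst_iff)
    then show thesis using lr(2) * that(2) by (simp add: fterms_FCst_iff)
  next
    fix f A B assume *: "f \<in> ACsyms \<Sigma>" "2 \<le> size A" "l = monom f A" "r = monom f B"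
    then show thesis using lr that(3)[OF *] by (simp add: fterms_monom_iff)
  qed
qed

text \<open>\<open>reduced\<close> only forbids reduction by other rules. A rule does not reduce its
  own right side either: if the left side of a monomial rule were contained in it, the right side
  would not be smaller.\<close>

lemma reduced_rhs_irreducible:
  assumes R: "flat_system \<Sigma> R" "decreasing \<Sigma> gtC gt R" "reduced R" and lr: "(l, r) \<in> R"
  shows "irreducible R r"
proof -
  interpret constant_order "Consts \<Sigma>" gtC by (rule orderC)
  have red: "\<not> rew (R - {(l, r)}) r t" for t using R(3) lr unfolding reduced_def by blast
  have const: "irreducible R (FCst d)" if d: "r = FCst d" "l \<noteq> FCst d" for d
    unfolding irreducible_def
  proof
    assume "\<exists>t. rew R (FCst d) t"
    then obtain t where "(FCst d, t) \<in> R" using rew_FCst[OF R(1)] by blast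
    then have "rew (R - {(l, r)}) r t" using d by (intro rew.root) auto
    then show False using red by blast
  qed
  from R(1) lr show ?thesis
  proof (cases rule: system_cases)
    case (C c d)
    have "gtC c d" using R(2) lr C by (auto simp: decreasing_def)
    then have "c \<noteq> d" using gtC_irrefl C by blast
    then show ?thesis using const C by auto
  next
    case (U h cs d)
    then show ?thesis using const by auto
  next
    case (AC f A B)
    interpret M: monomial_order "Consts \<Sigma>" gtC "gt f" using orderF[OF AC(1)] .
    have gtAB: "gt f A B" using R(2) lr AC by (auto simp: decreasing_def)
    show ?thesis unfolding irreducible_def
    proof
      assume "\<exists>t. rew R r t"
      then obtain A' B' where *: "(monom f A', monom f B') \<in> R" "A' \<subseteq># B"
        using rew_monom[OF R(1)] AC(4) by blast
      have A': "A' \<in> monomials (Consts \<Sigma>)" using flat_system_fterms[OF R(1) *(1)] fterms_monom_iff[OF AC(1)] by blast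
      have "A' \<noteq> A"
      proof
        assume "A' = A"
        then have "B = A \<or> gt f B A" using M.gt_sub[OF AC(6,5)] *(2) by (auto simp: subset_mset.less_le)
        then show False using gtAB M.gt_irrefl[OF AC(5)] M.gt_trans[OF AC(5,6,5)] by auto
      qed
      then have "(monom f A', monom f B') \<in> R - {(l, r)}" using * AC by simp
      from rew_monom_reducible[OF this *(2)] A' AC(4) red show False by (auto simp: monomials_def)
    qed
  qed
qed

text \<open>One inclusion suffices by symmetry. Flat terms are not compared by an ordering here;
  their rules are recovered from joinability and the irreducibility of constants.\<close>

lemma reduced_canonical_subset:
  assumes R: "flat_system \<Sigma> R" "decreasing \<Sigma> gtC gt R" "reduced R" "canonical \<Sigma> R"
    and R': "flat_system \<Sigma> R'" "decreasing \<Sigma> gtC gt R'" "reduced R'" "canonical \<Sigma> R'"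
    and eq: "fcong \<Sigma> (as_equations R) = fcong \<Sigma> (as_equations R')"
  shows "R \<subseteq> R'"
proof (rule subrelI)
  fix l r assume lr: "(l, r) \<in> R"
  have red: "\<not> rew (R - {(l, r)}) l t" for t using R(3) lr unfolding reduced_def by blast
  have rirr: "irreducible R r" using reduced_rhs_irreducible[OF R(1-3) lr] .
  have lr_ft: "l \<in> fterms \<Sigma>" "r \<in> fterms \<Sigma>" using flat_system_fterms[OF R(1) lr] by auto
  have lr_cong: "(l, r) \<in> fcong \<Sigma> (as_equations R')" using fcong_base[OF lr lr_ft] eq by simp
  have mon: "irreducible R (monom f A) \<longleftrightarrow> irreducible R' (monom f A)" if "f \<in> ACsyms \<Sigma>" "A \<in> monomials (Consts \<Sigma>)" for f A
    using irreducible_monom_iff[OF R(1,2,4) that] irreducible_monom_iff[OF R'(1,2,4) that] eq by simp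
  have con: "irreducible R (FCst c) \<longleftrightarrow> irreducible R' (FCst c)" if "c \<in> Consts \<Sigma>" for c
    using irreducible_const_iff[OF R(1,2,4) that] irreducible_const_iff[OF R'(1,2,4) that] eq by simp
  \<comment> \<open>Matching left sides are enough: both right sides are irreducible and congruent,
    hence equal.\<close>
  have finish: "(l, r) \<in> R'" if "(l, t) \<in> R'" "irreducible R' r" for t
  proof -
    have "irreducible R' t" using reduced_rhs_irreducible[OF R'(1-3) that(1)] .
    moreover have "(l, t) \<in> fcong \<Sigma> (as_equations R')"
      using flat_system_fterms[OF R'(1) that(1)] by (intro fcong_base[OF that(1)]) auto
    then have "(r, t) \<in> fcong \<Sigma> (as_equations R')" using lr_cong fcong_sym fcong_trans by metis
    ultimately have "r = t" using irreducible_unique[OF R'(1,4)] that(2) by blast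
    then show ?thesis using that(1) by simp
  qed
  from R(1) lr show "(l, r) \<in> R'"
  proof (cases rule: system_cases)
    case (C c d)
    have "\<not> irreducible R l" using lr rew.root unfolding irreducible_def by blast
    then have "\<not> irreducible R' (FCst c)" using con[OF C(3)] C by simp
    then obtain t where "(l, t) \<in> R'" using rew_FCst[OF R'(1)] C unfolding irreducible_def by blast
    then show ?thesis using finish rirr con[OF C(4)] C by simp
  next
    case (U h cs d)
    have rirr': "irreducible R' r" using rirr con[OF U(4)] U by simp
    \<comment> \<open>As the arguments of \<open>l\<close> are irreducible, a step from
      \<open>l\<close> in \<open>R'\<close> has to be at the root.\<close>
    have cs: "irreducible R' (FCst c)" if c: "c \<in> set cs" for c
    proof -
      have "irreducible R (FCst c)" unfolding irreducible_def
      proof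
        assume "\<exists>t. rew R (FCst c) t"
        then obtain t where t: "(FCst c, t) \<in> R" using rew_FCst[OF R(1)] by blast
        then have st: "rew (R - {(l, r)}) (FCst c) t" using U by (intro rew.root) auto
        obtain us vs where "cs = us @ c # vs" using c by (meson split_list)
        then have "rew (R - {(l, r)}) l (FFun h (map FCst us @ t # map FCst vs))"
          using rew.fun_arg[OF st, of h "map FCst us" "map FCst vs"] U by simp
        then show False using red by blast
      qed
      then show ?thesis using con U(3) c by blast
    qed
    have "confluentp (rew_on \<Sigma> R')" using R'(4) by (simp add: canonical_def)
    from fcong_joinable[OF flat_system_rules[OF R'(1)] this lr_cong] obtain z
      where "(rew_on \<Sigma> R')\<^sup>*\<^sup>* l z" "(rew_on \<Sigma> R')\<^sup>*\<^sup>* r z" by blast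
    then have "(rew_on \<Sigma> R')\<^sup>*\<^sup>* l r" using irreducible_steps rirr' by metis
    then have "l = r \<or> (\<exists>t. rew_on \<Sigma> R' l t)" by (meson converse_rtranclpE)
    then obtain t where "rew R' l t" using U by (auto simp: rew_on_def)
    then have "(l, t) \<in> R' \<or> (\<exists>c \<in> set cs. \<exists>d. (FCst c, FCst d) \<in> R')" using rew_FFun_flat[OF R'(1)] U by blast
    then have "(l, t) \<in> R'" using cs rew.root unfolding irreducible_def by blast
    then show ?thesis using finish rirr' by blast
  next
    case (AC f A B)
    have rirr': "irreducible R' r" using rirr mon[OF AC(1,6)] AC(4) by simp
    \<comment> \<open>Proper submonomials of \<open>A\<close> are irreducible, so a rule of
      \<open>R'\<close> that reduces \<open>A\<close> has \<open>A\<close> itself as left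
      side.\<close>
    have sub: "irreducible R' (monom f X)" if X: "X \<subset># A" "X \<in> monomials (Consts \<Sigma>)" for X
    proof -
      have "irreducible R (monom f X)" unfolding irreducible_def
      proof
        assume "\<exists>t. rew R (monom f X) t"
        then obtain A' B' where *: "(monom f A', monom f B') \<in> R" "A' \<subseteq># X" using rew_monom[OF R(1)] by blast
        have ne: "A' \<noteq> {#}" by (rule monom_nonempty[OF conjunct1[OF flat_system_fterms[OF R(1) *(1)]]])
        have "A' \<subset># A" using *(2) X(1) by (rule subset_mset.le_less_trans)
        then have "(monom f A', monom f B') \<in> R - {(l, r)}" "A' \<subseteq># A" using * AC(3) by auto
        from rew_monom_reducible[OF this ne] show False using red AC(3) by blast
      qed
      then show ?thesis using mon[OF AC(1) X(2)] by blast
    qed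
    have "\<not> irreducible R l" using lr rew.root unfolding irreducible_def by blast
    then have "\<not> irreducible R' (monom f A)" using mon[OF AC(1,5)] AC(3) by simp
    then obtain A' B' where *: "(monom f A', monom f B') \<in> R'" "A' \<subseteq># A"
      using rew_monom[OF R'(1)] unfolding irreducible_def by blast
    have A': "A' \<in> monomials (Consts \<Sigma>)" using flat_system_fterms[OF R'(1) *(1)] fterms_monom_iff[OF AC(1)] by blast
    have "\<not> irreducible R' (monom f A')" using *(1) rew.root unfolding irreducible_def by blast
    then have "A' = A" using sub[of A'] A' *(2) by (auto simp: subset_mset.less_le)
    then show ?thesis using * finish rirr' AC(3) by blast
  qed
qed

text \<open>Competing systems may list a constant rule among the rules of an AC symbol. A singleton
  left side forces a singleton right side, because nonconstant monomials are above constants, and by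
  totality of \<open>gtC\<close> the rule follows \<open>gtC\<close>.\<close>

lemma oriented_rules_system:
  assumes R: "R \<subseteq> U_rules \<Sigma> (gtU (Usyms \<Sigma>) (Consts \<Sigma>) gtC) \<union> (\<Union>f \<in> ACsyms \<Sigma>. AC_rules \<Sigma> (gt f) f)"
  shows "flat_system \<Sigma> R" "decreasing \<Sigma> gtC gt R"
proof -
  interpret constant_order "Consts \<Sigma>" gtC by (rule orderC)
  have cases: "(\<exists>c d. l = FCst c \<and> r = FCst d \<and> c \<in> Consts \<Sigma> \<and> d \<in> Consts \<Sigma> \<and> gtC c d) \<or>
    (\<exists>h cs d. l = FFun h (map FCst cs) \<and> r = FCst d \<and> h \<in> Usyms \<Sigma> \<and> length cs = arity \<Sigma> h \<and> set cs \<subseteq> Consts \<Sigma> \<and> d \<in> Consts \<Sigma>) \<or>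
    (\<exists>f A B. f \<in> ACsyms \<Sigma> \<and> 2 \<le> size A \<and> l = monom f A \<and> r = monom f B \<and>
       A \<in> monomials (Consts \<Sigma>) \<and> B \<in> monomials (Consts \<Sigma>) \<and> gt f A B)" (is "?C \<or> ?U \<or> ?A") if "(l, r) \<in> R" for l r
  proof -
    from that R consider "(l, r) \<in> U_rules \<Sigma> (gtU (Usyms \<Sigma>) (Consts \<Sigma>) gtC)" | f where "f \<in> ACsyms \<Sigma>" "(l, r) \<in> AC_rules \<Sigma> (gt f) f" by blast
    then show ?thesis
    proof cases
      case 1
      then show ?thesis unfolding U_rules_def by auto
    next
      case (2 f)
      then obtain A B where *: "l = monom f A" "r = monom f B" "A \<in> monomials (Consts \<Sigma>)" "B \<in> monomials (Consts \<Sigma>)" "gt f A B"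
        unfolding AC_rules_def by blast
      interpret M: monomial_order "Consts \<Sigma>" gtC "gt f" using orderF[OF 2(1)] .
      have "size A \<noteq> 0" "size B \<noteq> 0" using * by (auto simp: monomials_def)
      then consider "2 \<le> size A" | "size A = 1" "size B = 1" | "size A = 1" "1 < size B" by linarith
      then show ?thesis
      proof cases
        case 1
        then show ?thesis using * 2 by blast
      next
        case 2
        then obtain c d where cd: "A = {#c#}" "B = {#d#}" using size_1_singleton_mset by metis
        then have m: "c \<in> Consts \<Sigma>" "d \<in> Consts \<Sigma>" using * by (auto simp: monomials_def)
        have "c \<noteq> d" using M.gt_irrefl * cd by auto
        moreover have "\<not> gtC d c"
          using M.gt_const[OF m(2,1)] M.gt_trans[OF *(3,4,3) *(5)] M.gt_irrefl[OF *(3)] cd by auto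
        ultimately have "gtC c d" using gtC_total m by blast
        then show ?thesis using * cd m by auto
      next
        case 3
        then obtain c where c: "A = {#c#}" using size_1_singleton_mset by metis
        then have "gt f B A" using M.gt_big[OF *(4) _ 3(2), of c] * by (auto simp: monomials_def)
        then show ?thesis using M.gt_trans[OF *(3,4,3) *(5)] M.gt_irrefl[OF *(3)] by blast
      qed
    qed
  qed
  show flat: "flat_system \<Sigma> R"
    unfolding flat_system_def
  proof (intro ballI, clarify)
    fix l r assume lr: "(l, r) \<in> R"
    have "set (map FCst cs) \<subseteq> fterms \<Sigma>" if "set cs \<subseteq> Consts \<Sigma>" for cs
    proof
      fix y :: "('c, 'u, 'f) fterm" assume "y \<in> set (map FCst cs)"
      then obtain c where "c \<in> set cs" "y = FCst c" by auto
      then show "y \<in> fterms \<Sigma>" using subsetD[OF that] by (simp only: fterms_FCst_iff)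
    qed
    then have ft: "l \<in> fterms \<Sigma> \<and> r \<in> fterms \<Sigma>"
      using cases[OF lr]
      by (elim disjE exE conjE) (simp_all only: fterms_FCst_iff fterms_FFun_iff fterms_monom_iff length_map simp_thms)
    show "l \<in> fterms \<Sigma> \<and> r \<in> fterms \<Sigma> \<and> ((\<exists>c d. l = FCst c \<and> r = FCst d) \<or>
      (\<exists>h cs d. l = FFun h (map FCst cs) \<and> r = FCst d) \<or>
      (\<exists>f A B. f \<in> ACsyms \<Sigma> \<and> 2 \<le> size A \<and> l = monom f A \<and> r = monom f B))"
    proof (intro conjI)
      show "(\<exists>c d. l = FCst c \<and> r = FCst d) \<or> (\<exists>h cs d. l = FFun h (map FCst cs) \<and> r = FCst d) \<or>
        (\<exists>f A B. f \<in> ACsyms \<Sigma> \<and> 2 \<le> size A \<and> l = monom f A \<and> r = monom f B)"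
        using cases[OF lr] by blast
    qed (use ft in simp_all)
  qed
  have C: "gtC c d \<and> c \<in> Consts \<Sigma> \<and> d \<in> Consts \<Sigma>" if "(FCst c, FCst d) \<in> R" for c d
    using cases[OF that] by (auto simp: monom_big)
  show "decreasing \<Sigma> gtC gt R"
    unfolding decreasing_def
  proof (intro conjI allI ballI impI)
    show "(FCst c, FCst d) \<in> R \<Longrightarrow> gtC c d" for c d using C by blast
    fix f A B assume f: "f \<in> ACsyms \<Sigma>" and AB: "(monom f A, monom f B) \<in> R"
    interpret M: monomial_order "Consts \<Sigma>" gtC "gt f" using orderF[OF f] .
    show "gt f A B"
    proof (cases "size A = 1")
      case True
      then obtain c where c: "A = {#c#}" using size_1_singleton_mset by metis
      then obtain d where d: "monom f B = (FCst d :: ('c, 'u, 'f) fterm)" using flat_system_FCst[OF flat, of c "monom f B"] AB by auto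
      then have "monom f B = (monom f {#d#} :: ('c, 'u, 'f) fterm)" by simp
      then have B: "B = {#d#}" by (simp only: monom_inject)
      then show ?thesis using C[of c d] AB c M.gt_const by auto
    next
      case False
      then have *: "g = f \<and> A' = A" if "monom f A = (monom g A' :: ('c, 'u, 'f) fterm)" for g A'
        using FAC_eq_monom[OF monom_big[symmetric, THEN HOL.trans, OF _ that]] by simp
      have "\<exists>g A' B'. monom f A = (monom g A' :: ('c, 'u, 'f) fterm) \<and> monom f B = (monom g B' :: ('c, 'u, 'f) fterm) \<and> gt g A' B'"
        using cases[OF AB] False by (auto simp: monom_big)
      then show ?thesis using * by (metis monom_inject)
    qed
  qed
qed

end

section \<open>Purification\<close>

lemma ext_sig_simps [simp]:
  "Consts (ext_sig \<Sigma> S \<nu>) = Consts \<Sigma> \<union> \<nu> ` named S" "Usyms (ext_sig \<Sigma> S \<nu>) = Usyms \<Sigma>"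
  "arity (ext_sig \<Sigma> S \<nu>) = arity \<Sigma>" "ACsyms (ext_sig \<Sigma> S \<nu>) = ACsyms \<Sigma>"
  by (simp_all add: ext_sig_def)

lemma arg_rel_simps:
  "(u, FCst c) \<in> arg_rel \<longleftrightarrow> False" "(u, FFun h ts) \<in> arg_rel \<longleftrightarrow> u \<in> set ts" "(u, FAC f M) \<in> arg_rel \<longleftrightarrow> u \<in># M"
  by (auto simp: arg_rel_def)

lemma finite_subterms: "finite {u. (u, s) \<in> arg_rel\<^sup>+}"
proof (induction s)
  case (FCst c)
  show ?case by (rule finite_subset[of _ "{}"]) (auto elim: tranclE simp: arg_rel_simps)
next
  case (FFun h ts)
  have "{u. (u, FFun h ts) \<in> arg_rel\<^sup>+} \<subseteq> set ts \<union> (\<Union>t \<in> set ts. {u. (u, t) \<in> arg_rel\<^sup>+})"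
    by (auto elim: tranclE simp: arg_rel_simps)
  then show ?case by (rule finite_subset) (use FFun in auto)
next
  case (FAC f M)
  have "{u. (u, FAC f M) \<in> arg_rel\<^sup>+} \<subseteq> set_mset M \<union> (\<Union>t \<in> set_mset M. {u. (u, t) \<in> arg_rel\<^sup>+})"
    by (auto elim: tranclE simp: arg_rel_simps)
  then show ?case by (rule finite_subset) (use FAC in auto)
qed

lemma subterm_fterms: "(u, s) \<in> arg_rel\<^sup>+ \<Longrightarrow> s \<in> fterms \<Sigma> \<Longrightarrow> u \<in> fterms \<Sigma>"
proof -
  have arg: "u \<in> fterms \<Sigma>" if "(u, s) \<in> arg_rel" "s \<in> fterms \<Sigma>" for u s
  proof (cases s)
    case (FFun h ts)
    then show ?thesis using that by (auto simp: arg_rel_simps fterms_FFun_iff simp del: image_iff)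
  next
    case (FAC f M)
    then show ?thesis using that fterms_FAC[of f M \<Sigma>] by (auto simp: arg_rel_simps simp del: image_iff)
  qed (use that in \<open>auto simp: arg_rel_simps\<close>)
  show "(u, s) \<in> arg_rel\<^sup>+ \<Longrightarrow> s \<in> fterms \<Sigma> \<Longrightarrow> u \<in> fterms \<Sigma>"
    by (induction rule: trancl_induct) (use arg in blast)+
qed

locale purification =
  fixes \<Sigma> :: "('c, 'u, 'f) signature" and S :: "(('c, 'u, 'f) trm \<times> ('c, 'u, 'f) trm) set"
    and \<nu> :: "('c, 'u, 'f) fterm \<Rightarrow> 'c"
  assumes finS: "finite S" and S_terms: "S \<subseteq> terms \<Sigma> \<times> terms \<Sigma>" and fresh: "fresh_naming \<Sigma> S \<nu>"
begin

abbreviation "\<Sigma>' \<equiv> ext_sig \<Sigma> S \<nu>"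

abbreviation "Pure \<equiv> as_equations (pure_form \<Sigma> S \<nu>)"

lemma terms_ext: "t \<in> terms \<Sigma> \<Longrightarrow> t \<in> terms \<Sigma>'"
  by (induction rule: terms.induct) (auto intro: terms.intros)

lemma flat_eqs_fterms: "(x, y) \<in> flat_eqs S \<Longrightarrow> x \<in> fterms \<Sigma> \<and> y \<in> fterms \<Sigma>"
  using S_terms by (auto simp: flat_eqs_def)

lemma flat_eqs_fcong: "(x, y) \<in> flat_eqs S \<Longrightarrow> (x, y) \<in> fcong \<Sigma> S"
  using S_terms by (auto simp: flat_eqs_def fcong_def intro!: ACCC.base)

lemma finite_flat_eqs: "finite (flat_eqs S)"
  using finS by (simp add: flat_eqs_def)

lemma finite_named: "finite (named S)"
proof (rule finite_subset)
  let ?X = "\<Union>(s, t) \<in> flat_eqs S. {u. (u, s) \<in> arg_rel\<^sup>+} \<union> {u. (u, t) \<in> arg_rel\<^sup>+} \<union> {s, t}"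
  show "named S \<subseteq> ?X" unfolding named_def by blast
  show "finite ?X" using finite_flat_eqs finite_subterms by auto
qed

lemma named_fterms: "u \<in> named S \<Longrightarrow> u \<in> fterms \<Sigma>"
  unfolding named_def using flat_eqs_fterms subterm_fterms by blast

text \<open>The terms for which some constant of the extended signature stands, namely the one given
  by \<open>const_of \<nu>\<close>.\<close>

definition abstr :: "('c, 'u, 'f) fterm \<Rightarrow> bool" where
  "abstr u \<longleftrightarrow> u \<in> named S \<or> (\<exists>c \<in> Consts \<Sigma>. u = FCst c)"

text \<open>Nonconstant arguments of named terms are named again, since \<open>named\<close> is
  built on the transitive closure of \<open>arg_rel\<close>.\<close>

lemma abstr_args:
  assumes "x \<in> named S \<or> (\<exists>y. (x, y) \<in> flat_eqs S \<or> (y, x) \<in> flat_eqs S)" "(u, x) \<in> arg_rel"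
  shows "abstr u"
proof -
  have x: "x \<in> fterms \<Sigma>" using assms(1) named_fterms flat_eqs_fterms by blast
  have u: "u \<in> fterms \<Sigma>" using subterm_fterms[OF r_into_trancl[OF assms(2)] x] .
  show ?thesis
  proof (cases "is_cst u")
    case True
    then obtain c where c: "u = FCst c" by blast
    then have "c \<in> Consts \<Sigma>" using u by (simp only: fterms_FCst_iff)
    then show ?thesis using c by (simp add: abstr_def)
  next
    case False
    from assms(1) consider "x \<in> named S" | y where "(x, y) \<in> flat_eqs S" | y where "(y, x) \<in> flat_eqs S" by blast
    then have "u \<in> named S"
    proof cases
      case 1
      then obtain s t where st: "(s, t) \<in> flat_eqs S" "(x, s) \<in> arg_rel\<^sup>+ \<or> (x, t) \<in> arg_rel\<^sup>+ \<or> (x = s \<or> x = t)"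
        unfolding named_def by blast
      then have "(u, s) \<in> arg_rel\<^sup>+ \<or> (u, t) \<in> arg_rel\<^sup>+"
        using assms(2) by (meson r_into_trancl trancl_into_trancl2)
      then show ?thesis using st False unfolding named_def by blast
    next
      case (2 y)
      then show ?thesis using r_into_trancl[OF assms(2)] False unfolding named_def by blast
    next
      case (3 y)
      then show ?thesis using r_into_trancl[OF assms(2)] False unfolding named_def by blast
    qed
    then show ?thesis by (simp add: abstr_def)
  qed
qed

lemma abstr_const: "abstr u \<Longrightarrow> const_of \<nu> u \<in> Consts \<Sigma>'"
  by (cases u) (auto simp: abstr_def named_def)

lemma nonpure_abstr: "(s, t) \<in> flat_eqs S \<Longrightarrow> \<not> pure_eq s t \<Longrightarrow> abstr s \<and> abstr t"
proof -
  assume st: "(s, t) \<in> flat_eqs S" "\<not> pure_eq s t"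
  then have "\<not> is_cst s" "\<not> is_cst t" by (cases s; cases t; auto)+
  then have "s \<in> named S" "t \<in> named S" using st unfolding named_def by blast+
  then show ?thesis by (simp add: abstr_def)
qed

lemma flat_eqs_abstr_const: "(FCst c, y) \<in> flat_eqs S \<or> (y, FCst c) \<in> flat_eqs S \<Longrightarrow> c \<in> Consts \<Sigma>"
  using flat_eqs_fterms[of "FCst c" y] flat_eqs_fterms[of y "FCst c"] fterms_FCst_iff[of c \<Sigma>] by metis

lemma const_of_named: "u \<in> named S \<Longrightarrow> const_of \<nu> u = \<nu> u"
  by (cases u) (auto simp: named_def)

lemma pure_C_Consts: "pure_C S \<nu> \<subseteq> Consts \<Sigma>' \<times> Consts \<Sigma>'"
  unfolding pure_C_def using flat_eqs_abstr_const nonpure_abstr abstr_const by fastforce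

lemma pure_U_over: "U_over (Consts \<Sigma>') (\<lambda>h n. h \<in> Usyms \<Sigma> \<and> n = arity \<Sigma> h) (pure_U S \<nu>)"
proof -
  have F: "set (map (const_of \<nu>) ts) \<subseteq> Consts \<Sigma>' \<and> h \<in> Usyms \<Sigma> \<and> length ts = arity \<Sigma> h"
    if x: "FFun h ts \<in> named S \<or> (\<exists>y. (FFun h ts, y) \<in> flat_eqs S \<or> (y, FFun h ts) \<in> flat_eqs S)" for h ts
  proof -
    have "FFun h ts \<in> fterms \<Sigma>" using x named_fterms flat_eqs_fterms by blast
    moreover have "abstr t" if "t \<in> set ts" for t using abstr_args[OF x] that by (simp add: arg_rel_simps)
    ultimately show ?thesis using abstr_const by (auto simp: fterms_FFun_iff simp del: image_iff ext_sig_simps)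
  qed
  have "set cs \<subseteq> Consts \<Sigma>' \<and> d \<in> Consts \<Sigma>' \<and> h \<in> Usyms \<Sigma> \<and> length cs = arity \<Sigma> h" if "((h, cs), d) \<in> pure_U S \<nu>" for h cs d
  proof -
    from that consider ts where "cs = map (const_of \<nu>) ts" "(FFun h ts, FCst d) \<in> flat_eqs S \<or> (FCst d, FFun h ts) \<in> flat_eqs S"
      | ts where "cs = map (const_of \<nu>) ts" "d = \<nu> (FFun h ts)" "FFun h ts \<in> named S"
      unfolding pure_U_def by blast
    then show ?thesis
    proof cases
      case (1 ts)
      have "d \<in> Consts \<Sigma>" using 1(2) flat_eqs_abstr_const by blast
      then show ?thesis using F[of h ts] 1 by auto
    next
      case (2 ts)
      then show ?thesis using F[of h ts] by auto
    qed
  qed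
  then show ?thesis unfolding U_over_def by blast
qed

lemma finite_pure_U: "finite (pure_U S \<nu>)"
proof (rule finite_subset)
  \<comment> \<open>The set is covered by images of the finitely many flat equations and named
    terms; \<open>undefined\<close> fills the cases that yield no flat equation.\<close>
  let ?g = "\<lambda>x. case x of FFun h ts \<Rightarrow> (h, map (const_of \<nu>) ts) | _ \<Rightarrow> undefined"
  let ?X = "(\<lambda>(x, y). (?g x, const_of \<nu> y)) ` (flat_eqs S \<union> (flat_eqs S)\<inverse>) \<union> (\<lambda>x. (?g x, \<nu> x)) ` named S"
  have "((h, map (const_of \<nu>) ts), d) \<in> ?X" if "(FFun h ts, FCst d) \<in> flat_eqs S \<or> (FCst d, FFun h ts) \<in> flat_eqs S" for h ts d
    using that by (intro rev_image_eqI[of "(FFun h ts, FCst d)", THEN UnI1]) auto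
  moreover have "((h, map (const_of \<nu>) ts), \<nu> (FFun h ts)) \<in> ?X" if "FFun h ts \<in> named S" for h ts
    using that by (intro UnI2 image_eqI[of _ _ "FFun h ts"]) auto
  ultimately show "pure_U S \<nu> \<subseteq> ?X" unfolding pure_U_def by blast
  show "finite ?X" using finite_flat_eqs finite_named by auto
qed

lemma finite_pure_AC: "finite (pure_AC S \<nu> f)"
proof (rule finite_subset)
  let ?g = "\<lambda>x. image_mset (const_of \<nu>) (ac_args f x)"
  let ?X = "(\<lambda>(x, y). (?g x, ?g y)) ` flat_eqs S \<union> (\<lambda>x. (?g x, {#\<nu> x#})) ` named S"
  have "(?g s, ?g t) \<in> ?X" if "(s, t) \<in> flat_eqs S" for s t
    using that by (intro UnI1 image_eqI[of _ _ "(s, t)"]) auto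
  moreover have "(image_mset (const_of \<nu>) M, {#\<nu> (FAC f M)#}) \<in> ?X" if "FAC f M \<in> named S" for M
    using that by (intro UnI2 image_eqI[of _ _ "FAC f M"]) auto
  ultimately show "pure_AC S \<nu> f \<subseteq> ?X" unfolding pure_AC_def by blast
  show "finite ?X" using finite_flat_eqs finite_named by auto
qed

lemma pure_AC_side:
  assumes "(s, t) \<in> flat_eqs S" "pure_eq s t" "\<exists>M. s = FAC f M \<or> t = FAC f M"
  shows "(\<exists>M. s = FAC f M) \<or> (\<exists>c. s = FCst c)" "(\<exists>M. t = FAC f M) \<or> (\<exists>c. t = FCst c)"
  using assms by (cases s; cases t; auto)+

lemma ac_args_abstr:
  assumes "x \<in> named S \<or> (\<exists>y. (x, y) \<in> flat_eqs S \<or> (y, x) \<in> flat_eqs S)" "(\<exists>M. x = FAC f M) \<or> (\<exists>c. x = FCst c)" "u \<in># ac_args f x"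
  shows "abstr u"
proof (cases x)
  case (FCst c)
  have "x \<in> fterms \<Sigma>" using assms(1) named_fterms flat_eqs_fterms by blast
  then show ?thesis using FCst assms(3) by (auto simp: abstr_def fterms_FCst_iff simp del: image_iff)
next
  case (FAC g M)
  then show ?thesis using assms abstr_args[OF assms(1), of u] by (auto simp: arg_rel_simps)
qed (use assms in auto)

lemma pure_AC_monomials: "pure_AC S \<nu> f \<subseteq> monomials (Consts \<Sigma>') \<times> monomials (Consts \<Sigma>')"
proof -
  have m: "image_mset (const_of \<nu>) (ac_args f x) \<in> monomials (Consts \<Sigma>')"
    if x: "x \<in> named S \<or> (\<exists>y. (x, y) \<in> flat_eqs S \<or> (y, x) \<in> flat_eqs S)" "(\<exists>M. x = FAC f M) \<or> (\<exists>c. x = FCst c)" for x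
  proof -
    have "x \<in> fterms \<Sigma>" using x(1) named_fterms flat_eqs_fterms by blast
    then have "ac_args f x \<noteq> {#}" by (rule ac_args_nonempty[OF fterms_flat_ac])
    then show ?thesis using ac_args_abstr[OF x] abstr_const by (auto simp: monomials_def simp del: ext_sig_simps)
  qed
  show ?thesis
  proof (rule subrelI)
    fix A B assume "(A, B) \<in> pure_AC S \<nu> f"
    then consider s t where "A = image_mset (const_of \<nu>) (ac_args f s)" "B = image_mset (const_of \<nu>) (ac_args f t)"
        "(s, t) \<in> flat_eqs S" "pure_eq s t" "\<exists>M. s = FAC f M \<or> t = FAC f M"
      | M where "A = image_mset (const_of \<nu>) M" "B = {#\<nu> (FAC f M)#}" "FAC f M \<in> named S"
      unfolding pure_AC_def by blast
    then show "(A, B) \<in> monomials (Consts \<Sigma>') \<times> monomials (Consts \<Sigma>')"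
    proof cases
      case (1 s t)
      note sd = pure_AC_side[OF 1(3-5)]
      have "A \<in> monomials (Consts \<Sigma>')" unfolding 1(1) using 1(3) by (intro m sd) blast
      moreover have "B \<in> monomials (Consts \<Sigma>')" unfolding 1(2) using 1(3) by (intro m sd) blast
      ultimately show ?thesis by simp
    next
      case (2 M)
      then have "A \<in> monomials (Consts \<Sigma>')" using m[of "FAC f M"] by simp
      moreover have "B \<in> monomials (Consts \<Sigma>')" using 2 by (simp add: monomials_def)
      ultimately show ?thesis by simp
    qed
  qed
qed

lemma pure_form_fterms: "(x, y) \<in> pure_form \<Sigma> S \<nu> \<Longrightarrow> x \<in> fterms \<Sigma>' \<and> y \<in> fterms \<Sigma>'"
proof -
  assume "(x, y) \<in> pure_form \<Sigma> S \<nu>"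
  then consider c d where "(c, d) \<in> pure_C S \<nu>" "x = FCst c" "y = FCst d"
    | h cs d where "((h, cs), d) \<in> pure_U S \<nu>" "x = FFun h (map FCst cs)" "y = FCst d"
    | f A B where "f \<in> ACsyms \<Sigma>" "(A, B) \<in> pure_AC S \<nu> f" "x = monom f A" "y = monom f B"
    unfolding pure_form_def C_pairs_def U_pairs_def AC_pairs_def by blast
  then show ?thesis
  proof cases
    case 1
    then show ?thesis using pure_C_Consts by (auto simp: fterms_FCst_iff simp del: image_iff ext_sig_simps)
  next
    case (2 h cs d)
    have "set cs \<subseteq> Consts \<Sigma>' \<and> d \<in> Consts \<Sigma>' \<and> h \<in> Usyms \<Sigma> \<and> length cs = arity \<Sigma> h"
      using pure_U_over 2(1) unfolding U_over_def by blast
    then show ?thesis using 2 by (auto simp: fterms_FCst_iff fterms_FFun_iff simp del: image_iff ext_sig_simps(1))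
  next
    case (3 f A B)
    then show ?thesis using pure_AC_monomials[of f] fterms_monom_iff[of f \<Sigma>'] by auto
  qed
qed

lemma pure_base: "(x, y) \<in> pure_form \<Sigma> S \<nu> \<Longrightarrow> (x, y) \<in> fcong \<Sigma>' Pure"
  using pure_form_fterms by (intro fcong_base) auto

lemma pure_U_base: "((h, cs), d) \<in> pure_U S \<nu> \<Longrightarrow> (FFun h (map FCst cs), FCst d) \<in> fcong \<Sigma>' Pure"
  by (rule pure_base) (auto simp: pure_form_def U_pairs_def)

lemma pure_C_base: "(c, d) \<in> pure_C S \<nu> \<Longrightarrow> (FCst c, FCst d) \<in> fcong \<Sigma>' Pure"
  by (rule pure_base) (auto simp: pure_form_def C_pairs_def)

lemma pure_AC_base: "f \<in> ACsyms \<Sigma> \<Longrightarrow> (A, B) \<in> pure_AC S \<nu> f \<Longrightarrow> (monom f A, monom f B) \<in> fcong \<Sigma>' Pure"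
  by (rule pure_base) (auto simp: pure_form_def AC_pairs_def)

section \<open>Consequences of \<open>S\<close> follow from the purified equations\<close>

lemma FFun_abstract:
  assumes "FFun h ts \<in> fterms \<Sigma>" "\<And>t. t \<in> set ts \<Longrightarrow> (t, FCst (const_of \<nu> t)) \<in> fcong \<Sigma>' Pure"
  shows "(FFun h ts, FFun h (map FCst (map (const_of \<nu>) ts))) \<in> fcong \<Sigma>' Pure"
proof (rule fcong_FFun)
  show "h \<in> Usyms \<Sigma>'" "length ts = arity \<Sigma>' h" using assms(1) by (auto simp: fterms_FFun_iff simp del: image_iff)
  show "list_all2 (\<lambda>x y. (x, y) \<in> fcong \<Sigma>' Pure) ts (map FCst (map (const_of \<nu>) ts))"
    using assms(2) by (auto simp: list_all2_conv_all_nth)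
qed

lemma ac_abstract:
  assumes x: "x \<in> fterms \<Sigma>" and f: "f \<in> ACsyms \<Sigma>" and args: "\<And>t. t \<in># ac_args f x \<Longrightarrow> (t, FCst (const_of \<nu> t)) \<in> fcong \<Sigma>' Pure"
  shows "(x, monom f (image_mset (const_of \<nu>) (ac_args f x))) \<in> fcong \<Sigma>' Pure"
proof -
  have flat: "flat_ac x" using x fterms_flat_ac by blast
  obtain xs where xs: "mset xs = ac_args f x" using ex_mset by blast
  then have "xs \<noteq> []" using ac_args_nonempty[OF flat, of f] by auto
  moreover have "list_all2 (\<lambda>x y. (x, y) \<in> fcong \<Sigma>' Pure) xs (map (\<lambda>t. FCst (const_of \<nu> t)) xs)"
    using args xs by (auto simp: list_all2_conv_all_nth) (metis nth_mem set_mset_mset)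
  ultimately have 1: "(mkAC f (mset xs), mkAC f (mset (map (\<lambda>t. FCst (const_of \<nu> t)) xs))) \<in> fcong \<Sigma>' Pure"
    using f by (intro fcong_mkAC_list) auto
  have 2: "mkAC f (ac_args f x) = x"
    using mk_ac_args[OF flat, of f] mkAC_trivial[of "ac_args f x" f] ac_args_ac_args[OF flat] by metis
  have 3: "mset (map (\<lambda>t. FCst (const_of \<nu> t)) xs) = image_mset FCst (image_mset (const_of \<nu>) (ac_args f x))"
    using xs[symmetric] by (simp add: multiset.map_comp comp_def)
  show ?thesis using 1 unfolding 3 xs 2 mkAC_FCst .
qed

text \<open>By structural induction: first the arguments are replaced by their constants, then the
  defining equation of the named term applies.\<close>

lemma abstract_fcong: "abstr u \<Longrightarrow> (u, FCst (const_of \<nu> u)) \<in> fcong \<Sigma>' Pure"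
proof (induction u)
  case (FCst c)
  then have "FCst c \<in> fterms \<Sigma>'" by (auto simp: abstr_def fterms_FCst_iff named_def simp del: image_iff)
  then show ?case using fcong_refl by simp
next
  case (FFun h ts)
  then have nm: "FFun h ts \<in> named S" by (auto simp: abstr_def)
  have "abstr t" if "t \<in> set ts" for t using abstr_args[of "FFun h ts" t] nm that by (auto simp: arg_rel_simps)
  then have "(FFun h ts, FFun h (map FCst (map (const_of \<nu>) ts))) \<in> fcong \<Sigma>' Pure"
    using FFun.IH named_fterms[OF nm] by (intro FFun_abstract) auto
  moreover have "((h, map (const_of \<nu>) ts), \<nu> (FFun h ts)) \<in> pure_U S \<nu>" using nm unfolding pure_U_def by blast
  from pure_U_base[OF this] have "(FFun h (map FCst (map (const_of \<nu>) ts)), FCst (const_of \<nu> (FFun h ts))) \<in> fcong \<Sigma>' Pure"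
    by (simp only: const_of.simps)
  ultimately show ?case by (rule fcong_trans)
next
  case (FAC f M)
  then have nm: "FAC f M \<in> named S" by (auto simp: abstr_def)
  have f: "f \<in> ACsyms \<Sigma>" using fterms_FAC[OF named_fterms[OF nm]] by blast
  have "abstr t" if "t \<in># M" for t using abstr_args[of "FAC f M" t] nm that by (auto simp: arg_rel_simps)
  then have "(FAC f M, monom f (image_mset (const_of \<nu>) (ac_args f (FAC f M)))) \<in> fcong \<Sigma>' Pure"
    using FAC.IH named_fterms[OF nm] f by (intro ac_abstract) auto
  moreover have "(image_mset (const_of \<nu>) M, {#\<nu> (FAC f M)#}) \<in> pure_AC S \<nu> f" using nm unfolding pure_AC_def by blast
  then have "(monom f (image_mset (const_of \<nu>) M), FCst (\<nu> (FAC f M))) \<in> fcong \<Sigma>' Pure"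
    using pure_AC_base[OF f] by fastforce
  ultimately show ?case using fcong_trans by simp blast
qed

text \<open>The sides of a mixed equation meet through their names; in the other cases it is enough
  to abstract the arguments of each nonconstant side.\<close>

lemma flat_eqs_Pure: "(x, y) \<in> flat_eqs S \<Longrightarrow> (x, y) \<in> fcong \<Sigma>' Pure"
proof -
  assume xy: "(x, y) \<in> flat_eqs S"
  have ft: "x \<in> fterms \<Sigma>" "y \<in> fterms \<Sigma>" using flat_eqs_fterms[OF xy] by auto
  have U: "(FFun h ts, FCst d) \<in> fcong \<Sigma>' Pure" if "(FFun h ts, FCst d) \<in> flat_eqs S \<or> (FCst d, FFun h ts) \<in> flat_eqs S" for h ts d
  proof -
    have "abstr t" if t: "t \<in> set ts" for t
      using \<open>_ \<or> _\<close> t by (intro abstr_args[of "FFun h ts"]) (auto simp: arg_rel_simps)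
    then have "(FFun h ts, FFun h (map FCst (map (const_of \<nu>) ts))) \<in> fcong \<Sigma>' Pure"
      using that flat_eqs_fterms abstract_fcong by (intro FFun_abstract) blast+
    moreover have "((h, map (const_of \<nu>) ts), d) \<in> pure_U S \<nu>" using that unfolding pure_U_def by blast
    ultimately show ?thesis using pure_U_base fcong_trans by blast
  qed
  have A: ?thesis if p: "pure_eq x y" "\<exists>M. x = FAC f M \<or> y = FAC f M" for f
  proof -
    note sd = pure_AC_side[OF xy p]
    obtain M where "x = FAC f M \<or> y = FAC f M" using p(2) by blast
    then have f: "f \<in> ACsyms \<Sigma>" using ft conjunct1[OF fterms_FAC[of f M \<Sigma>]] by metis
    have "(x, monom f (image_mset (const_of \<nu>) (ac_args f x))) \<in> fcong \<Sigma>' Pure"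
      using xy abstract_fcong ac_args_abstr[OF _ sd(1)] by (intro ac_abstract[OF ft(1) f]) blast
    moreover have "(y, monom f (image_mset (const_of \<nu>) (ac_args f y))) \<in> fcong \<Sigma>' Pure"
      using xy abstract_fcong ac_args_abstr[OF _ sd(2)] by (intro ac_abstract[OF ft(2) f]) blast
    moreover have "(image_mset (const_of \<nu>) (ac_args f x), image_mset (const_of \<nu>) (ac_args f y)) \<in> pure_AC S \<nu> f"
      using xy p unfolding pure_AC_def by blast
    ultimately show ?thesis using pure_AC_base[OF f] fcong_trans fcong_sym by metis
  qed
  show ?thesis
  proof (cases "pure_eq x y")
    case False
    then have "(const_of \<nu> x, const_of \<nu> y) \<in> pure_C S \<nu>" using xy unfolding pure_C_def by blast
    then show ?thesis using pure_C_base nonpure_abstr[OF xy False] abstract_fcong fcong_trans fcong_sym by metis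
  next
    case True
    show ?thesis
    proof (cases "\<exists>f M. x = FAC f M \<or> y = FAC f M")
      case fac: True
      then show ?thesis using A True by blast
    next
      case nfac: False
      then consider c d where "x = FCst c" "y = FCst d" | h ts d where "x = FFun h ts" "y = FCst d"
        | h ts d where "x = FCst d" "y = FFun h ts"
        using True by (cases x; cases y; auto)
      then show ?thesis
      proof cases
        case 1
        then show ?thesis using xy pure_C_base unfolding pure_C_def by blast
      next
        case 2
        then show ?thesis using xy U by blast
      next
        case 3
        then show ?thesis using xy U fcong_sym by blast
      qed
    qed
  qed
qed

lemma ACCC_S_Pure: "(s, t) \<in> ACCC \<Sigma> S \<Longrightarrow> (s, t) \<in> ACCC \<Sigma>' Pure"
proof (induction rule: ACCC.induct)
  case (base s t)
  then have "(flatten s, flatten t) \<in> flat_eqs S" by (auto simp: flat_eqs_def)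
  then show ?case using flat_eqs_Pure fcong_iff terms_ext base by metis
next
  case (cong_Fun h ss ts)
  then show ?case by (intro ACCC.cong_Fun) auto
qed (auto intro: ACCC.intros terms_ext)

text \<open>Conversely, interpreting each fresh constant by the subterm that it names turns every
  purified equation into a consequence of \<open>S\<close>.\<close>

definition unfl :: "('c, 'u, 'f) fterm \<Rightarrow> ('c, 'u, 'f) trm" where
  "unfl x = (SOME t. t \<in> terms \<Sigma> \<and> flatten t = x)"

definition interp :: "'c \<Rightarrow> ('c, 'u, 'f) trm" where
  "interp c = (if c \<in> Consts \<Sigma> then Cst c else unfl (the_inv_into (named S) \<nu> c))"

primrec subst :: "('c, 'u, 'f) trm \<Rightarrow> ('c, 'u, 'f) trm" where
  "subst (Cst c) = interp c"
| "subst (Fun h ts) = Fun h (map subst ts)"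
| "subst (AC f s t) = AC f (subst s) (subst t)"

lemma unfl: "x \<in> fterms \<Sigma> \<Longrightarrow> unfl x \<in> terms \<Sigma> \<and> flatten (unfl x) = x"
  unfolding unfl_def by (rule someI_ex) auto

lemma interp_abstr:
  assumes "abstr u"
  shows "flatten (interp (const_of \<nu> u)) = u"
proof (cases "u \<in> named S")
  case True
  then have "\<nu> u \<notin> Consts \<Sigma>" "the_inv_into (named S) \<nu> (\<nu> u) = u"
    using fresh by (auto simp: fresh_naming_def the_inv_into_f_f)
  then show ?thesis using unfl[OF named_fterms[OF True]] const_of_named[OF True] by (simp add: interp_def)
qed (use assms in \<open>auto simp: abstr_def interp_def\<close>)

lemma interp_terms: "c \<in> Consts \<Sigma>' \<Longrightarrow> interp c \<in> terms \<Sigma>"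
proof (cases "c \<in> Consts \<Sigma>")
  case False
  assume "c \<in> Consts \<Sigma>'"
  then obtain u where "u \<in> named S" "c = \<nu> u" using False by auto
  moreover from this have "the_inv_into (named S) \<nu> (\<nu> u) = u"
    using fresh by (auto simp: fresh_naming_def the_inv_into_f_f)
  ultimately show ?thesis using unfl[OF named_fterms] False by (simp add: interp_def)
qed (simp add: interp_def terms_iff)

lemma subst_terms: "t \<in> terms \<Sigma>' \<Longrightarrow> subst t \<in> terms \<Sigma>"
  by (induction rule: terms.induct) (auto simp: terms_iff interp_terms simp del: ext_sig_simps(1))

lemma subst_id: "t \<in> terms \<Sigma> \<Longrightarrow> subst t = t"
  by (induction rule: terms.induct) (auto simp: interp_def map_idI)

text \<open>A constant may stand for a term headed by \<open>f\<close>, so substituting into an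
  \<open>f\<close>-monomial requires flattening again; \<open>mkAC\<close> does so at once, whatever
  the nesting in \<open>s\<close>.\<close>

lemma flatten_subst_monom:
  "flatten s = monom f A \<Longrightarrow> A \<noteq> {#} \<Longrightarrow> flatten (subst s) = mkAC f (image_mset (\<lambda>c. flatten (interp c)) A)"
proof (induction s arbitrary: A)
  case (Cst c)
  have "size A = 1" using Cst(1) by (cases "size A = 1") (auto simp: monom_big)
  then obtain d where "A = {#d#}" using size_1_singleton_mset by blast
  then show ?case using Cst by (simp add: mkAC_single)
next
  case (Fun h ts)
  have "size A = 1" using Fun(2) by (cases "size A = 1") (auto simp: monom_big)
  then obtain d where "A = {#d#}" using size_1_singleton_mset by blast
  then show ?case using Fun by simp
next
  case (AC g s t)
  have e: "FAC g (ac_args g (flatten s) + ac_args g (flatten t)) = monom f A" using AC(3) flatten_AC[of g s t] by simp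
  then have [simp]: "g = f" and im: "image_mset FCst A = ac_args f (flatten s) + ac_args f (flatten t)"
    using FAC_eq_monom[OF e] by auto
  obtain A1 A2 where A: "A = A1 + A2" "ac_args f (flatten s) = image_mset FCst A1" "ac_args f (flatten t) = image_mset FCst A2"
    using image_mset_eq_plusD[OF im] by auto
  have ne: "A1 \<noteq> {#}" "A2 \<noteq> {#}" using A ac_args_nonempty[of "flatten s" f] ac_args_nonempty[of "flatten t" f] by auto
  have "flatten s = monom f A1" "flatten t = monom f A2"
    using A mk_ac_args[of "flatten s" f] mk_ac_args[of "flatten t" f] by (auto simp: monom_mk)
  then have IH: "flatten (subst s) = mkAC f (image_mset (\<lambda>c. flatten (interp c)) A1)"
    "flatten (subst t) = mkAC f (image_mset (\<lambda>c. flatten (interp c)) A2)" using AC.IH ne by auto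
  have "flatten (subst (AC g s t)) = mkAC f {#flatten (subst s), flatten (subst t)#}" by simp
  also have "\<dots> = mkAC f (image_mset (\<lambda>c. flatten (interp c)) A1 + {#flatten (subst t)#})"
    unfolding IH(1) by (rule mkAC_add_mkAC) auto
  also have "\<dots> = mkAC f (add_mset (flatten (subst t)) (image_mset (\<lambda>c. flatten (interp c)) A1))" by simp
  also have "\<dots> = mkAC f (image_mset (\<lambda>c. flatten (interp c)) A2 + image_mset (\<lambda>c. flatten (interp c)) A1)"
    unfolding IH(2) by (rule mkAC_add_mkAC) auto
  finally show ?case using A(1) by (simp add: add.commute)
qed

lemma interp_args:
  assumes x: "x \<in> named S \<or> (\<exists>y. (x, y) \<in> flat_eqs S \<or> (y, x) \<in> flat_eqs S)" "(\<exists>M. x = FAC f M) \<or> (\<exists>c. x = FCst c)"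
  shows "mkAC f (image_mset (\<lambda>c. flatten (interp c)) (image_mset (const_of \<nu>) (ac_args f x))) = x"
proof -
  have "flat_ac x" using x(1) named_fterms flat_eqs_fterms fterms_flat_ac by metis
  note flat = this
  have "image_mset (\<lambda>c. flatten (interp c)) (image_mset (const_of \<nu>) (ac_args f x)) = image_mset (\<lambda>u. u) (ac_args f x)"
    unfolding multiset.map_comp comp_def by (rule image_mset_cong) (rule interp_abstr[OF ac_args_abstr[OF x]])
  then show ?thesis
    using mk_ac_args[OF flat, of f] mkAC_trivial[of "ac_args f x" f] ac_args_ac_args[OF flat] by simp
qed

text \<open>Under \<open>subst\<close> the defining equations become trivial, and the other purified
  equations turn back into those of \<open>S\<close> from which they came.\<close>

lemma subst_Pure:
  assumes "(s, t) \<in> ACCC \<Sigma>' Pure"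
  shows "(subst s, subst t) \<in> ACCC \<Sigma> S"
  using assms
proof (induction rule: ACCC.induct)
  case (base s t)
  have st: "subst s \<in> terms \<Sigma>" "subst t \<in> terms \<Sigma>" using base subst_terms by auto
  \<comment> \<open>The equations relate unflattened terms. Constants and flat terms have a single
    preimage under \<open>flatten\<close>; a monomial may have many, which
    \<open>flatten_subst_monom\<close> treats together.\<close>
  have inC: "s = Cst c" if "flatten s = FCst c" for s :: "('c, 'u, 'f) trm" and c
    using that by (cases s) (auto simp: mkAC_pair_FAC)
  have inF: "s = Fun h (map Cst cs)" if fl: "flatten s = FFun h (map FCst cs)" for s :: "('c, 'u, 'f) trm" and h cs
  proof -
    obtain ts where ts: "s = Fun h ts" "map flatten ts = map FCst cs" using fl by (cases s) (auto simp: mkAC_pair_FAC)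
    have "ts = map Cst cs" using ts(2) inC
      by (induction ts arbitrary: cs) (auto simp: Cons_eq_map_conv)
    then show ?thesis using ts by simp
  qed
  have "(flatten s, flatten t) \<in> pure_form \<Sigma> S \<nu>" using base by (simp add: as_equations_def)
  then consider c d where "(c, d) \<in> pure_C S \<nu>" "flatten s = FCst c" "flatten t = FCst d"
    | h cs d where "((h, cs), d) \<in> pure_U S \<nu>" "flatten s = FFun h (map FCst cs)" "flatten t = FCst d"
    | f A B where "f \<in> ACsyms \<Sigma>" "(A, B) \<in> pure_AC S \<nu> f" "flatten s = monom f A" "flatten t = monom f B"
    unfolding pure_form_def C_pairs_def U_pairs_def AC_pairs_def by blast
  then have "(flatten (subst s), flatten (subst t)) \<in> fcong \<Sigma> S"
  proof cases
    case (1 c d)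
    then have e: "flatten (subst s) = flatten (interp c)" "flatten (subst t) = flatten (interp d)" using inC[of s c] inC[of t d] by auto
    from 1(1) consider "(FCst c, FCst d) \<in> flat_eqs S"
      | u v where "c = const_of \<nu> u" "d = const_of \<nu> v" "(u, v) \<in> flat_eqs S" "\<not> pure_eq u v"
      unfolding pure_C_def by blast
    then show ?thesis
    proof cases
      case 1
      then have "c \<in> Consts \<Sigma>" "d \<in> Consts \<Sigma>" using flat_eqs_abstr_const by blast+
      then show ?thesis unfolding e using flat_eqs_fcong[OF 1] by (simp add: interp_def)
    next
      case (2 u v)
      then show ?thesis unfolding e using flat_eqs_fcong nonpure_abstr interp_abstr by metis
    qed
  next
    case (2 h cs d)
    then have e: "flatten (subst s) = FFun h (map (\<lambda>c. flatten (interp c)) cs)" "flatten (subst t) = flatten (interp d)"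
      using inF[of s h cs] inC[of t d] by (auto simp: comp_def)
    have args: "map (\<lambda>c. flatten (interp c)) (map (const_of \<nu>) ts) = ts"
      if x: "FFun h ts \<in> named S \<or> (\<exists>y. (FFun h ts, y) \<in> flat_eqs S \<or> (y, FFun h ts) \<in> flat_eqs S)" for ts
      using abstr_args[OF x] interp_abstr by (auto simp: arg_rel_simps intro!: map_idI)
    from 2(1) consider ts where "cs = map (const_of \<nu>) ts" "(FFun h ts, FCst d) \<in> flat_eqs S \<or> (FCst d, FFun h ts) \<in> flat_eqs S"
      | ts where "cs = map (const_of \<nu>) ts" "d = \<nu> (FFun h ts)" "FFun h ts \<in> named S"
      unfolding pure_U_def by blast
    then show ?thesis
    proof cases
      case (1 ts)
      have "d \<in> Consts \<Sigma>" using 1(2) flat_eqs_abstr_const by blast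
      then have "flatten (interp d) = FCst d" by (simp add: interp_def)
      moreover have "map (\<lambda>c. flatten (interp c)) cs = ts" using args[of ts] 1 by blast
      ultimately show ?thesis unfolding e using 1(2) flat_eqs_fcong fcong_sym by metis
    next
      case (2 ts)
      have "flatten (interp d) = FFun h ts" using interp_abstr[of "FFun h ts"] 2 by (simp add: abstr_def)
      moreover have "map (\<lambda>c. flatten (interp c)) cs = ts" using args[of ts] 2 by blast
      ultimately show ?thesis unfolding e using fcong_refl[OF named_fterms[OF 2(3)]] by simp
    qed
  next
    case (3 f A B)
    have ne: "A \<noteq> {#}" "B \<noteq> {#}" using pure_AC_monomials 3(2) by (auto simp: monomials_def)
    have e: "flatten (subst s) = mkAC f (image_mset (\<lambda>c. flatten (interp c)) A)"
      "flatten (subst t) = mkAC f (image_mset (\<lambda>c. flatten (interp c)) B)"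
      using flatten_subst_monom 3 ne by blast+
    from 3(2) consider u v where "A = image_mset (const_of \<nu>) (ac_args f u)" "B = image_mset (const_of \<nu>) (ac_args f v)"
        "(u, v) \<in> flat_eqs S" "pure_eq u v" "\<exists>M. u = FAC f M \<or> v = FAC f M"
      | M where "A = image_mset (const_of \<nu>) M" "B = {#\<nu> (FAC f M)#}" "FAC f M \<in> named S"
      unfolding pure_AC_def by blast
    then show ?thesis
    proof cases
      case (1 u v)
      note sd = pure_AC_side[OF 1(3-5)]
      have "flatten (subst s) = u" unfolding e 1(1) using 1(3) by (intro interp_args sd) blast
      moreover have "flatten (subst t) = v" unfolding e 1(2) using 1(3) by (intro interp_args sd) blast
      ultimately show ?thesis using flat_eqs_fcong 1(3) by simp
    next
      case (2 M)
      have "flatten (subst s) = FAC f M" unfolding e 2(1) using interp_args[of "FAC f M" f] 2(3) by simp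
      moreover have "flatten (interp (\<nu> (FAC f M))) = FAC f M" using interp_abstr[of "FAC f M"] 2(3) by (simp add: abstr_def)
      then have "flatten (subst t) = FAC f M" unfolding e 2(2)
        using mkAC_single[of "FAC f M" f] flat_ac_flatten[of "interp (\<nu> (FAC f M))"] by simp
      ultimately show ?thesis using fcong_refl[OF named_fterms[OF 2(3)]] by simp
    qed
  qed
  then show ?case using fcong_iff[OF st] by blast
next
  case (assoc f s t u)
  from subst_terms[OF assoc] show ?case by (simp add: ACCC.assoc)
next
  case (comm f s t)
  from subst_terms[OF comm] show ?case by (simp add: ACCC.comm)
next
  case (cong_Fun h ss ts)
  then show ?case by (auto intro!: ACCC.cong_Fun)
next
  case (cong_AC f s s' t t')
  then show ?case by (auto intro!: ACCC.cong_AC)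
next
  case (refl t)
  then show ?case using subst_terms ACCC.refl by blast
next
  case (sym s t)
  show ?case by (rule ACCC.sym[OF sym.IH])
next
  case (trans s t u)
  show ?case by (rule ACCC.trans[OF trans.IH])
qed

text \<open>Conservativity rests on \<open>subst\<close> being the identity on terms of the original
  signature.\<close>

lemma ACCC_Pure_conservative: "ACCC \<Sigma>' Pure \<inter> (terms \<Sigma> \<times> terms \<Sigma>) = ACCC \<Sigma> S"
proof
  show "ACCC \<Sigma>' Pure \<inter> (terms \<Sigma> \<times> terms \<Sigma>) \<subseteq> ACCC \<Sigma> S"
    using subst_Pure subst_id by fastforce
  show "ACCC \<Sigma> S \<subseteq> ACCC \<Sigma>' Pure \<inter> (terms \<Sigma> \<times> terms \<Sigma>)"
    using ACCC_S_Pure ACCC_terms by fast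
qed

end

section \<open>Models given by congruences\<close>

definition const_rel where
  "const_rel \<Sigma> E = {(c, d). (FCst c, FCst d) \<in> fcong \<Sigma> E}"

definition flat_rel where
  "flat_rel \<Sigma> E = {((h, cs), d). (FFun h (map FCst cs), FCst d) \<in> fcong \<Sigma> E}"

definition mono_rel where
  "mono_rel \<Sigma> E f = {(A, B). (monom f A, monom f B) \<in> fcong \<Sigma> E}"

text \<open>Every generated congruence is a model, whatever its equations; so the equivalence proved
  for all models can be applied to the congruence of the input and to that of the output.\<close>

lemma (in combined) fcong_model:
  assumes C: "C = Consts \<Sigma>" and F: "F = ACsyms \<Sigma>"
  shows "model (const_rel \<Sigma> E) (flat_rel \<Sigma> E) (mono_rel \<Sigma> E)"
  unfolding model_def
proof (intro conjI ballI allI)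
  show "ucongr C (const_rel \<Sigma> E) (flat_rel \<Sigma> E)"
    unfolding ucongr_def
  proof (intro conjI ballI allI impI)
    show "\<And>c. c \<in> C \<Longrightarrow> (c, c) \<in> const_rel \<Sigma> E"
      using C by (simp add: const_rel_def fcong_refl fterms_FCst_iff)
    show "sym (const_rel \<Sigma> E)" by (auto simp: sym_def const_rel_def intro: fcong_sym)
    show "trans (const_rel \<Sigma> E)" unfolding trans_def const_rel_def using fcong_trans by blast
  next
    fix h cs cs' d d'
    assume u: "((h, cs), d) \<in> flat_rel \<Sigma> E" and l: "list_all2 (\<lambda>c c'. (c, c') \<in> const_rel \<Sigma> E) cs cs'" and d: "(d, d') \<in> const_rel \<Sigma> E"
    have *: "(FFun h (map FCst cs), FCst d) \<in> fcong \<Sigma> E" using u by (simp add: flat_rel_def)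
    have "FFun h (map FCst cs) \<in> fterms \<Sigma>" using fcong_fterms[OF *] by blast
    then have "h \<in> Usyms \<Sigma>" "length cs = arity \<Sigma> h" by (simp_all add: fterms_FFun_iff)
    then have "(FFun h (map FCst cs), FFun h (map FCst cs')) \<in> fcong \<Sigma> E"
      using l by (intro fcong_FFun) (auto simp: list_all2_conv_all_nth const_rel_def)
    moreover have "(FCst d, FCst d') \<in> fcong \<Sigma> E" using d by (simp add: const_rel_def)
    ultimately have "(FFun h (map FCst cs'), FCst d') \<in> fcong \<Sigma> E" using * fcong_sym fcong_trans by metis
    then show "((h, cs'), d') \<in> flat_rel \<Sigma> E" by (simp add: flat_rel_def)
  next
    fix l d d' assume "(l, d) \<in> flat_rel \<Sigma> E" "(l, d') \<in> flat_rel \<Sigma> E"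
    moreover obtain h cs where "l = (h, cs)" by (cases l)
    ultimately have "(FFun h (map FCst cs), FCst d) \<in> fcong \<Sigma> E" "(FFun h (map FCst cs), FCst d') \<in> fcong \<Sigma> E"
      by (simp_all add: flat_rel_def)
    from fcong_trans[OF fcong_sym[OF this(1)] this(2)] show "(d, d') \<in> const_rel \<Sigma> E" by (simp add: const_rel_def)
  qed
next
  fix f c d assume f: "f \<in> F"
  show "(c, d) \<in> const_rel \<Sigma> E \<longleftrightarrow> ({#c#}, {#d#}) \<in> mono_rel \<Sigma> E f" by (simp add: const_rel_def mono_rel_def)
next
  fix f assume f: "f \<in> F"
  then have fS: "f \<in> ACsyms \<Sigma>" using F by simp
  show "mcongr C (mono_rel \<Sigma> E f)"
    unfolding mcongr_def
  proof (intro conjI ballI allI impI)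
    show "\<And>A. A \<in> monomials C \<Longrightarrow> (A, A) \<in> mono_rel \<Sigma> E f"
      using C fterms_monom_iff[OF fS] by (simp add: mono_rel_def fcong_refl)
    show "sym (mono_rel \<Sigma> E f)" by (auto simp: sym_def mono_rel_def intro: fcong_sym)
    show "trans (mono_rel \<Sigma> E f)" unfolding trans_def mono_rel_def using fcong_trans by blast
  next
    fix A B D assume m: "A \<in> monomials C" "B \<in> monomials C" and AB: "(A, B) \<in> mono_rel \<Sigma> E f" and D: "set_mset D \<subseteq> C"
    show "(A + D, B + D) \<in> mono_rel \<Sigma> E f"
    proof (cases "D = {#}")
      case False
      then have "D \<in> monomials (Consts \<Sigma>)" using D C by (simp add: monomials_def)
      then have "(monom f D, monom f D) \<in> fcong \<Sigma> E" using fterms_monom_iff[OF fS] fcong_refl by blast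
      then have "(mkAC f {#monom f A, monom f D#}, mkAC f {#monom f B, monom f D#}) \<in> fcong \<Sigma> E"
        using AB by (intro fcong_mkAC_pair[OF fS]) (auto simp: mono_rel_def)
      then show ?thesis using False m by (simp add: mono_rel_def monom_plus monomials_def)
    qed (use AB in simp)
  qed
qed

lemma finite_pairs:
  "finite N \<Longrightarrow> finite (C_pairs N)" "finite U \<Longrightarrow> finite (U_pairs U)" "finite X \<Longrightarrow> finite (AC_pairs f X)"
proof -
  show "finite (C_pairs N)" if "finite N"
    by (rule finite_surj[OF that, of _ "\<lambda>(c, d). (FCst c, FCst d)"]) (force simp: C_pairs_def)
  show "finite (U_pairs U)" if "finite U"
    by (rule finite_surj[OF that, of _ "\<lambda>((h, cs), d). (FFun h (map FCst cs), FCst d)"]) (force simp: U_pairs_def)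
  show "finite (AC_pairs f X)" if "finite X"
    by (rule finite_surj[OF that, of _ "\<lambda>(A, B). (monom f A, monom f B)"]) (force simp: AC_pairs_def)
qed

lemma sat_fcong_subset:
  assumes "\<And>c d. (c, d) \<in> RC \<Longrightarrow> (c, d) \<in> const_rel \<Sigma> E" "\<And>l d. (l, d) \<in> RU \<Longrightarrow> (l, d) \<in> flat_rel \<Sigma> E"
    "\<And>f A B. f \<in> F \<Longrightarrow> (A, B) \<in> RF f \<Longrightarrow> (A, B) \<in> mono_rel \<Sigma> E f"
  shows "fcong \<Sigma> (as_equations (C_pairs RC \<union> U_pairs RU \<union> (\<Union>f \<in> F. AC_pairs f (RF f)))) \<subseteq> fcong \<Sigma> E"
proof (rule fcong_as_equations)
  fix x y assume "(x, y) \<in> C_pairs RC \<union> U_pairs RU \<union> (\<Union>f \<in> F. AC_pairs f (RF f))"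
  then show "(x, y) \<in> fcong \<Sigma> E"
    using assms unfolding C_pairs_def U_pairs_def AC_pairs_def const_rel_def flat_rel_def mono_rel_def by fastforce
qed

theorem theorem8p1:
  fixes \<Sigma> :: "('c, 'u, 'f) signature"
    and S :: "(('c, 'u, 'f) trm \<times> ('c, 'u, 'f) trm) set"
    and \<nu> :: "('c, 'u, 'f) fterm \<Rightarrow> 'c"
    and gtC :: "'c \<Rightarrow> 'c \<Rightarrow> bool"
    and gt :: "'f \<Rightarrow> 'c multiset \<Rightarrow> 'c multiset \<Rightarrow> bool"
    and pick :: "'f \<Rightarrow> 'c mrules \<Rightarrow> 'c mrules \<Rightarrow> 'c multiset \<times> 'c multiset"
    and nf :: "'f \<Rightarrow> 'c mrules \<Rightarrow> 'c multiset \<Rightarrow> 'c multiset"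
  assumes "finite (Consts \<Sigma>)" and "finite (Usyms \<Sigma>)" and "finite (ACsyms \<Sigma>)"
    and "finite S" and "S \<subseteq> terms \<Sigma> \<times> terms \<Sigma>"
    and "fresh_naming \<Sigma> S \<nu>"
    and "strict_total_on (Consts (ext_sig \<Sigma> S \<nu>)) gtC"
    and "\<And>f. f \<in> ACsyms \<Sigma> \<Longrightarrow> admissible (Consts (ext_sig \<Sigma> S \<nu>)) gtC (gt f)"
    and "\<And>f. f \<in> ACsyms \<Sigma> \<Longrightarrow> selection (pick f)"
    and "\<And>f. f \<in> ACsyms \<Sigma> \<Longrightarrow> normalizer (Consts (ext_sig \<Sigma> S \<nu>)) (gt f) (nf f)"
  shows "\<exists>RC RU RF R_C R_U R_S.
    GeneralCongruenceClosure (ACsyms \<Sigma>) gtC gt pick nf (pure_C S \<nu>) (pure_U S \<nu>) (pure_AC S \<nu>)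
      = Some (RC, RU, RF) \<and>
    R_C = C_pairs RC \<and> R_U = C_pairs RC \<union> U_pairs RU \<and>
    R_S = R_C \<union> R_U \<union> (\<Union>f \<in> ACsyms \<Sigma>. AC_pairs f (RF f)) \<and>
    finite R_S \<and>
    R_C \<subseteq> C_rules (ext_sig \<Sigma> S \<nu>) gtC \<and>
    R_U \<subseteq> U_rules (ext_sig \<Sigma> S \<nu>) (gtU (Usyms \<Sigma>) (Consts (ext_sig \<Sigma> S \<nu>)) gtC) \<and>
    (\<forall>f \<in> ACsyms \<Sigma>. AC_pairs f (RF f) \<subseteq> AC_rules (ext_sig \<Sigma> S \<nu>) (gt f) f) \<and>
    reduced_canonical (ext_sig \<Sigma> S \<nu>) R_C \<and>
    reduced_canonical (ext_sig \<Sigma> S \<nu>) R_U \<and>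
    (\<forall>f \<in> ACsyms \<Sigma>. reduced_canonical (ext_sig \<Sigma> S \<nu>) (AC_pairs f (RF f))) \<and>
    reduced_canonical (ext_sig \<Sigma> S \<nu>) R_S \<and>
    ACCC (ext_sig \<Sigma> S \<nu>) (as_equations R_S) \<inter> (terms \<Sigma> \<times> terms \<Sigma>) = ACCC \<Sigma> S \<and>
    ACCC (ext_sig \<Sigma> S \<nu>) (as_equations R_S)
      = ACCC (ext_sig \<Sigma> S \<nu>) (as_equations (pure_form \<Sigma> S \<nu>)) \<and>
    (\<forall>R. R \<subseteq> U_rules (ext_sig \<Sigma> S \<nu>) (gtU (Usyms \<Sigma>) (Consts (ext_sig \<Sigma> S \<nu>)) gtC)
              \<union> (\<Union>f \<in> ACsyms \<Sigma>. AC_rules (ext_sig \<Sigma> S \<nu>) (gt f) f) \<and>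
         reduced_canonical (ext_sig \<Sigma> S \<nu>) R \<and>
         ACCC (ext_sig \<Sigma> S \<nu>) (as_equations R)
           = ACCC (ext_sig \<Sigma> S \<nu>) (as_equations (pure_form \<Sigma> S \<nu>))
       \<longrightarrow> R = R_S)"
proof -
  let ?E = "ext_sig \<Sigma> S \<nu>"
  interpret purification \<Sigma> S \<nu> using assms(4-6) by unfold_locales
  have finC: "finite (Consts ?E)" using assms(1) finite_named by simp
  interpret ordered_signature ?E gtC gt
    using finC assms(7,8) by unfold_locales simp_all
  interpret G: combined "Consts ?E" gtC "ACsyms \<Sigma>" gt pick nf
    using finC assms(7-10) by unfold_locales auto
  let ?W = "\<lambda>h n. h \<in> Usyms \<Sigma> \<and> n = arity \<Sigma> h"
  obtain RC RU RF where gcc: "GeneralCongruenceClosure (ACsyms \<Sigma>) gtC gt pick nf (pure_C S \<nu>) (pure_U S \<nu>) (pure_AC S \<nu>) = Some (RC, RU, RF)"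
    and res: "G.result ?W RC RU RF"
    and sat: "\<And>q u r. G.model q u r \<Longrightarrow> G.sat q u r RC RU RF \<longleftrightarrow> G.sat q u r (pure_C S \<nu>) (pure_U S \<nu>) (pure_AC S \<nu>)"
    using G.GCC_correct[where SF = "pure_AC S \<nu>", OF pure_C_Consts finite_pure_U pure_U_over finite_pure_AC pure_AC_monomials]
    by blast
  have RCC: "RC \<subseteq> Consts ?E \<times> Consts ?E" and RCn: "G.normalized RC" and RUf: "finite RU"
    and RUo: "U_over (G.canon RC) ?W RU" and RUn: "new_eqs RU = {}"
    and RFi: "\<And>f. f \<in> ACsyms \<Sigma> \<Longrightarrow> completion_inv (Consts ?E) (gt f) (RF f) {}"
    and RFc: "\<And>f. f \<in> ACsyms \<Sigma> \<Longrightarrow> RF f \<subseteq> monomials (G.canon RC) \<times> monomials (G.canon RC)"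
    and RF0: "\<And>f. f \<in> ACsyms \<Sigma> \<Longrightarrow> const_rules (RF f) = {}"
    using res unfolding G.result_def by auto
  note RCp = G.normalized_gt[OF RCn RCC]
  have canon: "c \<in> Consts ?E - Domain RC" if "c \<in> G.canon RC" for c
    using that RCp(4) G.canon_C by blast
  have RC1: "c \<in> Consts ?E \<and> d \<in> Consts ?E - Domain RC \<and> gtC c d" if "(c, d) \<in> RC" for c d
    using RCp[OF that] canon by blast
  have RC2: "single_valued RC" using RCp(5) by (auto simp: single_valued_def)
  have RU1: "h \<in> Usyms ?E \<and> length cs = arity ?E h \<and> set cs \<subseteq> Consts ?E - Domain RC \<and> d \<in> Consts ?E - Domain RC"
    if "((h, cs), d) \<in> RU" for h cs d
  proof -
    have "set cs \<subseteq> G.canon RC" "d \<in> G.canon RC" "?W h (length cs)" using RUo that unfolding U_over_def by blast+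
    then show ?thesis using canon unfolding ext_sig_simps(2,3) by blast
  qed
  have RU2: "single_valued RU" using RUn unfolding new_eqs_def single_valued_def by blast
  have RF1: "2 \<le> size A \<and> set_mset A \<inter> Domain RC = {} \<and> set_mset B \<inter> Domain RC = {}"
    if f: "f \<in> ACsyms \<Sigma>" and AB: "(A, B) \<in> RF f" for f A B
  proof -
    interpret M: monomial_order "Consts ?E" gtC "gt f" using orderF f by simp
    have m: "A \<in> monomials (Consts ?E)" "B \<in> monomials (Consts ?E)" "gt f A B"
      using RFi[OF f] AB unfolding completion_inv_def oriented_def by blast+
    have c: "A \<in> monomials (G.canon RC)" "B \<in> monomials (G.canon RC)" using RFc[OF f] AB by auto
    \<comment> \<open>A singleton left side would force a singleton right side, since
      \<open>gt_big\<close> puts larger monomials above constants; but \<open>RF f\<close> contains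
      no constant rules any more.\<close>
    have "size A \<noteq> 1"
    proof
      assume "size A = 1"
      then obtain c where A: "A = {#c#}" using size_1_singleton_mset by blast
      have cC: "c \<in> Consts ?E" using m(1) unfolding A by (simp only: monomials_def) auto
      have "\<not> 1 < size B"
        using M.gt_big[OF m(2) cC] m(3) A M.gt_trans[OF m(1,2,1)] M.gt_irrefl[OF m(1)] by blast
      moreover have "size B \<noteq> 0" using m(2) by (simp add: monomials_def)
      ultimately have "size B = 1" by linarith
      then obtain d where "B = {#d#}" using size_1_singleton_mset by blast
      then have "(c, d) \<in> const_rules (RF f)" using AB A by (simp add: const_rules_def)
      then show False using RF0[OF f] by simp
    qed
    moreover have "size A \<noteq> 0" using m(1) by (simp add: monomials_def)
    ultimately have "2 \<le> size A" by linarith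
    then show ?thesis using c canon unfolding monomials_def by blast
  qed
  have inv0: "completion_inv (Consts ?E) (gt f) {} {}" for f
    by (simp add: completion_inv_def oriented_def left_reduced_def right_reduced_def peaks_def)
  have fsC: "final_system ?E gtC gt RC {} (\<lambda>_. {})"
    using RC1 RC2 inv0 by unfold_locales auto
  have fsU: "final_system ?E gtC gt RC RU (\<lambda>_. {})"
    using RC1 RC2 RU1 RU2 inv0 by unfold_locales auto
  \<comment> \<open>The locale takes the rules of all AC symbols at once, so the components of the
    other symbols are emptied.\<close>
  have fsA: "final_system ?E gtC gt {} {} (\<lambda>g. if g = f then RF f else {})" if f: "f \<in> ACsyms \<Sigma>" for f
    using RFi[OF f] RF1[OF f] inv0 by unfold_locales (auto split: if_splits)
  have fsS: "final_system ?E gtC gt RC RU RF"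
    using RC1 RC2 RU1 RU2 RFi RF1 by unfold_locales auto
  define R_C where "R_C = (C_pairs RC :: (('c, 'u, 'f) fterm \<times> ('c, 'u, 'f) fterm) set)"
  define R_U where "R_U = (C_pairs RC \<union> U_pairs RU :: (('c, 'u, 'f) fterm \<times> ('c, 'u, 'f) fterm) set)"
  define R_S where "R_S = R_C \<union> R_U \<union> (\<Union>f \<in> ACsyms \<Sigma>. AC_pairs f (RF f))"
  have sysC: "final_system.sys ?E RC {} (\<lambda>_. {}) = R_C"
    unfolding final_system.sys_def[OF fsC] R_C_def by (auto simp: U_pairs_def AC_pairs_def)
  have sysU: "final_system.sys ?E RC RU (\<lambda>_. {}) = R_U"
    unfolding final_system.sys_def[OF fsU] R_U_def by (auto simp: AC_pairs_def)
  have sysA: "final_system.sys ?E {} {} (\<lambda>g. if g = f then RF f else {}) = AC_pairs f (RF f)" if "f \<in> ACsyms \<Sigma>" for f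
    unfolding final_system.sys_def[OF fsA[OF that]] using that by (auto simp: C_pairs_def U_pairs_def AC_pairs_def split: if_splits)
  have sysS: "final_system.sys ?E RC RU RF = R_S"
    unfolding final_system.sys_def[OF fsS] R_S_def R_C_def R_U_def by auto
  have rcS: "reduced_canonical ?E R_S" using final_system.sys_reduced_canonical[OF fsS] unfolding sysS .
  have flatS: "flat_system ?E R_S" "decreasing ?E gtC gt R_S"
    using final_system.sys_flat[OF fsS] final_system.sys_decreasing[OF fsS] unfolding sysS by auto
  have R_S: "R_S = C_pairs RC \<union> U_pairs RU \<union> (\<Union>f \<in> ACsyms \<Sigma>. AC_pairs f (RF f))"
    unfolding R_S_def R_C_def R_U_def by auto
  note model = G.fcong_model[of ?E, OF HOL.refl ext_sig_simps(4)[symmetric]]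
  \<comment> \<open>The purified equations hold in the congruence they generate, hence by
    \<open>sat\<close> so do the computed rules. The converse takes the congruence of the computed
    rules as model.\<close>
  have "fcong ?E (as_equations R_S) \<subseteq> fcong ?E Pure"
  proof -
    have "G.sat (const_rel ?E Pure) (flat_rel ?E Pure) (mono_rel ?E Pure) (pure_C S \<nu>) (pure_U S \<nu>) (pure_AC S \<nu>)"
      unfolding G.sat_def const_rel_def flat_rel_def mono_rel_def
      using pure_C_base pure_U_base pure_AC_base by auto
    then have "G.sat (const_rel ?E Pure) (flat_rel ?E Pure) (mono_rel ?E Pure) RC RU RF"
      unfolding sat[OF model] .
    then show ?thesis unfolding R_S G.sat_def by (intro sat_fcong_subset) blast+
  qed
  moreover have "fcong ?E Pure \<subseteq> fcong ?E (as_equations R_S)"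
  proof -
    let ?Q = "as_equations R_S"
    have base: "(x, y) \<in> fcong ?E ?Q" if "(x, y) \<in> R_S" for x y
      using fcong_base[OF that] flat_system_fterms[OF flatS(1) that] by blast
    have "G.sat (const_rel ?E ?Q) (flat_rel ?E ?Q) (mono_rel ?E ?Q) RC RU RF"
      unfolding G.sat_def const_rel_def flat_rel_def mono_rel_def
    proof (intro conjI ballI subsetI; clarify)
      show "(FCst c, FCst d) \<in> fcong ?E ?Q" if "(c, d) \<in> RC" for c d
        using that by (intro base) (auto simp: R_S C_pairs_def)
      show "(FFun h (map FCst cs), FCst d) \<in> fcong ?E ?Q" if "((h, cs), d) \<in> RU" for h cs d
        using that by (intro base) (auto simp: R_S U_pairs_def)
      show "(monom f A, monom f B) \<in> fcong ?E ?Q" if "f \<in> ACsyms \<Sigma>" "(A, B) \<in> RF f" for f A B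
        using that by (intro base) (auto simp: R_S AC_pairs_def)
    qed
    then have "G.sat (const_rel ?E ?Q) (flat_rel ?E ?Q) (mono_rel ?E ?Q) (pure_C S \<nu>) (pure_U S \<nu>) (pure_AC S \<nu>)"
      unfolding sat[OF model] .
    then show ?thesis unfolding pure_form_def G.sat_def by (intro sat_fcong_subset) blast+
  qed
  ultimately have fc: "fcong ?E (as_equations R_S) = fcong ?E Pure" by blast
  then have accc: "ACCC ?E (as_equations R_S) = ACCC ?E Pure" unfolding ACCC_fcong by simp
  have unique: "R = R_S" if R: "R \<subseteq> U_rules ?E (gtU (Usyms \<Sigma>) (Consts ?E) gtC) \<union> (\<Union>f \<in> ACsyms \<Sigma>. AC_rules ?E (gt f) f)"
    "reduced_canonical ?E R" "ACCC ?E (as_equations R) = ACCC ?E Pure" for R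
  proof -
    have sysR: "flat_system ?E R" "decreasing ?E gtC gt R" using oriented_rules_system[of R] R(1) by simp_all
    have "fcong ?E (as_equations R) = fcong ?E (as_equations R_S)"
      unfolding fc unfolding fcong_def R(3) ..
    then show ?thesis
      using reduced_canonical_subset[OF sysR _ _ flatS] reduced_canonical_subset[OF flatS _ _ sysR] R(2) rcS
      unfolding reduced_canonical_def by (intro subset_antisym) auto
  qed
  have finRC: "finite RC" using finite_subset[OF RCC] finC by blast
  have finS: "finite R_S"
  proof -
    have "finite (RF f)" if "f \<in> ACsyms \<Sigma>" for f using RFi[OF that] by (simp add: completion_inv_def)
    then show ?thesis unfolding R_S using finRC RUf assms(3) by (simp add: finite_pairs)
  qed
  have p1: "R_C \<subseteq> C_rules ?E gtC" unfolding R_C_def C_pairs_def C_rules_def using RC1 by blast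
  have p2: "R_U \<subseteq> U_rules ?E (gtU (Usyms \<Sigma>) (Consts ?E) gtC)"
  proof -
    have "C_pairs RC \<subseteq> U_rules ?E (gtU (Usyms \<Sigma>) (Consts ?E) gtC)"
      unfolding C_pairs_def U_rules_def gtU.simps using RC1 by blast
    moreover have "U_pairs RU \<subseteq> U_rules ?E (gtU (Usyms \<Sigma>) (Consts ?E) gtC)"
      unfolding U_pairs_def U_rules_def gtU.simps using RU1[unfolded ext_sig_simps(2,3)] unfolding ext_sig_simps(2,3) by blast
    ultimately show ?thesis unfolding R_U_def by blast
  qed
  have p3: "\<forall>f \<in> ACsyms \<Sigma>. AC_pairs f (RF f) \<subseteq> AC_rules ?E (gt f) f"
    unfolding AC_pairs_def AC_rules_def using RFi unfolding completion_inv_def oriented_def by blast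
  have p4: "reduced_canonical ?E R_C" using final_system.sys_reduced_canonical[OF fsC] unfolding sysC .
  have p5: "reduced_canonical ?E R_U" using final_system.sys_reduced_canonical[OF fsU] unfolding sysU .
  have p6: "\<forall>f \<in> ACsyms \<Sigma>. reduced_canonical ?E (AC_pairs f (RF f))"
    using final_system.sys_reduced_canonical[OF fsA] sysA by simp
  have p7: "ACCC ?E (as_equations R_S) \<inter> (terms \<Sigma> \<times> terms \<Sigma>) = ACCC \<Sigma> S"
    unfolding accc by (rule ACCC_Pure_conservative)
  have p8: "\<forall>R. R \<subseteq> U_rules ?E (gtU (Usyms \<Sigma>) (Consts ?E) gtC) \<union> (\<Union>f \<in> ACsyms \<Sigma>. AC_rules ?E (gt f) f) \<and>
      reduced_canonical ?E R \<and> ACCC ?E (as_equations R) = ACCC ?E Pure \<longrightarrow> R = R_S"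
    using unique by simp
  show ?thesis
    by (rule exI[of _ RC], rule exI[of _ RU], rule exI[of _ RF], rule exI[of _ R_C], rule exI[of _ R_U], rule exI[of _ R_S])
      (intro conjI gcc R_C_def R_U_def R_S_def finS p1 p2 p3 p4 p5 p6 rcS p7 accc p8)
qed

end
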